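(* Let $(Z,d)$ be a pseudometric space, $X\cup Y=Z$ a cover, $A:=X\cap Y$, and $r\in[0,\infty)$. Assume $A$ is finite, $(Z,d)$ is a metric gluing of $X$ and $Y$, and the strong simplex assumption holds for $r$. Let $P:=\{\sigma\in \mathrm{VR}_r(Z)\mid \sigma\subset X\text{ or }\sigma\subset Y\text{ or }\sigma\cap A\ne\emptyset\}$. Then for every simplex $\sigma\in\mathrm{VR}_r(Z)\setminus P$ such that either $|\sigma\cap X|=1$ or $|\sigma\cap Y|=1$, the obstruction complex $\mathrm{St}(\sigma,A)$ is contractible. Moreover, the homotopy fibers of the inclusion $\mathrm{VR}_r(X)\cup\mathrm{VR}_r(Y)\hookrightarrow\mathrm{VR}_r(Z)$ are simply connected, and this map induces an isomorphism on $\pi_0$ and $\pi_1$ and a surjection on $\pi_2$.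
   Context: A pseudometric on $Z$ is a function $d\colon Z\times Z\to[0,\infty]$ that is symmetric, satisfies $d(x,x)=0$, and satisfies the triangle inequality. For $r\in[0,\infty)$, the Vietoris–Rips complex $\mathrm{VR}_r(Z)$ is the simplicial complex of all finite nonempty $\sigma\subset Z$ with $d(x,y)\le r$ for all $x,y\in\sigma$; for $B\subset Z$, $\mathrm{VR}_r(B)$ is defined using the restricted distance. $(Z,d)$ is a metric gluing (of $X$ and $Y$ along $A$) if for all $x\in X\setminus A$ and $y\in Y\setminus A$ one has $d(x,y)=\inf\{d(x,a)+d(a,y)\mid a\in A\}$. The strong simplex assumption for $r$: for every vertex $v$ of an edge (1-dimensional simplex) $\sigma$ of $\mathrm{VR}_r(Z)\setminus P$, and all $a,b\in A$ with $d(a,v)\le r$ and $d(v,b)\le r$, one has $2d(a,b)\le d(a,v)+d(v,b)$. For a simplex $\sigma$ of $K=\mathrm{VR}_r(Z)$, $\mathrm{St}(\sigma,A):=\{\mu\subset A\mid 0<|\mu|<\infty,\ \mu\cup\sigma\in K\}$. Homotopical notions refer to geometric realizations. *)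

theory Defs
  imports "HOL-Analysis.Analysis"
begin

definition pseudometric_on :: "'a set \<Rightarrow> ('a \<Rightarrow> 'a \<Rightarrow> ennreal) \<Rightarrow> bool" where
  "pseudometric_on Z d \<longleftrightarrow>
     (\<forall>x\<in>Z. d x x = 0) \<and> (\<forall>x\<in>Z. \<forall>y\<in>Z. d x y = d y x) \<and>
     (\<forall>x\<in>Z. \<forall>y\<in>Z. \<forall>z\<in>Z. d x z \<le> d x y + d y z)"

definition metric_gluing :: "('a \<Rightarrow> 'a \<Rightarrow> ennreal) \<Rightarrow> 'a set \<Rightarrow> 'a set \<Rightarrow> bool" where
  "metric_gluing d X Y \<longleftrightarrow>
     (\<forall>x\<in>X - (X \<inter> Y). \<forall>y\<in>Y - (X \<inter> Y). d x y = (INF a\<in>X \<inter> Y. d x a + d a y))"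

definition VR :: "('a \<Rightarrow> 'a \<Rightarrow> ennreal) \<Rightarrow> real \<Rightarrow> 'a set \<Rightarrow> 'a set set" where
  "VR d r B = {\<sigma>. \<sigma> \<subseteq> B \<and> finite \<sigma> \<and> \<sigma> \<noteq> {} \<and> (\<forall>x\<in>\<sigma>. \<forall>y\<in>\<sigma>. d x y \<le> ennreal r)}"

definition VR_P :: "('a \<Rightarrow> 'a \<Rightarrow> ennreal) \<Rightarrow> real \<Rightarrow> 'a set \<Rightarrow> 'a set \<Rightarrow> 'a set set" where
  "VR_P d r X Y = {\<sigma>\<in>VR d r (X \<union> Y). \<sigma> \<subseteq> X \<or> \<sigma> \<subseteq> Y \<or> \<sigma> \<inter> (X \<inter> Y) \<noteq> {}}"

definition strong_simplex_assumption ::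
    "('a \<Rightarrow> 'a \<Rightarrow> ennreal) \<Rightarrow> real \<Rightarrow> 'a set \<Rightarrow> 'a set \<Rightarrow> bool" where
  "strong_simplex_assumption d r X Y \<longleftrightarrow>
     (\<forall>\<sigma>\<in>VR d r (X \<union> Y) - VR_P d r X Y. card \<sigma> = 2 \<longrightarrow>
        (\<forall>v\<in>\<sigma>. \<forall>a\<in>X \<inter> Y. \<forall>b\<in>X \<inter> Y.
            d a v \<le> ennreal r \<and> d v b \<le> ennreal r \<longrightarrow> 2 * d a b \<le> d a v + d v b))"

definition St :: "'a set set \<Rightarrow> 'a set \<Rightarrow> 'a set \<Rightarrow> 'a set set" where
  "St K \<sigma> A = {\<mu>. \<mu> \<subseteq> A \<and> finite \<mu> \<and> \<mu> \<noteq> {} \<and> \<mu> \<union> \<sigma> \<in> K}"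

text \<open>Points are barycentric coordinate functions; the closed simplex of \<sigma> carries
  the Euclidean (product) topology, and the realization the coherent topology.\<close>
definition simplex_pts :: "'a set \<Rightarrow> ('a \<Rightarrow> real) set" where
  "simplex_pts \<sigma> = {f. (\<forall>v. 0 \<le> f v) \<and> (\<forall>v. v \<notin> \<sigma> \<longrightarrow> f v = 0) \<and> sum f \<sigma> = 1}"

definition realization :: "'a set set \<Rightarrow> ('a \<Rightarrow> real) topology" where
  "realization K = topology (\<lambda>U. U \<subseteq> (\<Union>\<sigma>\<in>K. simplex_pts \<sigma>) \<and>
      (\<forall>\<sigma>\<in>K. openin (top_of_set (simplex_pts \<sigma>)) (U \<inter> simplex_pts \<sigma>)))"

text \<open>Contractible in the usual sense (nonempty; the library notion allows the empty space).\<close>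
definition contractible :: "'b topology \<Rightarrow> bool" where
  "contractible X \<longleftrightarrow> topspace X \<noteq> {} \<and> contractible_space X"

definition simply_connected_space :: "'b topology \<Rightarrow> bool" where
  "simply_connected_space X \<longleftrightarrow> topspace X \<noteq> {} \<and> path_connected_space X \<and>
     (\<forall>g. pathin X g \<and> g 1 = g 0 \<longrightarrow>
        homotopic_with (\<lambda>h. h 0 = g 0 \<and> h 1 = g 0) (top_of_set {0..1}) X g (\<lambda>t. g 0))"

text \<open>Path space of X with the compact-open topology (paths normalised outside [0,1]).\<close>
definition path_space :: "'b topology \<Rightarrow> (real \<Rightarrow> 'b) topology" where
  "path_space X = topology_generated_by
     {{\<gamma>. pathin X \<gamma> \<and> \<gamma> \<in> extensional {0..1} \<and> \<gamma> ` C \<subseteq> U} | C U.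
        compactin (top_of_set {0..1}) C \<and> openin X U}"

definition hofiber :: "('b \<Rightarrow> 'c) \<Rightarrow> 'b topology \<Rightarrow> 'c topology \<Rightarrow> 'c \<Rightarrow> ('b \<times> (real \<Rightarrow> 'c)) topology" where
  "hofiber f L K y = subtopology (prod_topology L (path_space K))
     {(x, \<gamma>). x \<in> topspace L \<and> \<gamma> \<in> topspace (path_space K) \<and> \<gamma> 0 = f x \<and> \<gamma> 1 = y}"

definition hclass :: "'s topology \<Rightarrow> 's \<Rightarrow> 'b topology \<Rightarrow> 'b \<Rightarrow> ('s \<Rightarrow> 'b) \<Rightarrow> ('s \<Rightarrow> 'b) set" where
  "hclass S s0 X x g = {h. continuous_map S X h \<and> h s0 = x \<and> homotopic_with (\<lambda>k. k s0 = x) S X g h}"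

definition hset :: "'s topology \<Rightarrow> 's \<Rightarrow> 'b topology \<Rightarrow> 'b \<Rightarrow> ('s \<Rightarrow> 'b) set set" where
  "hset S s0 X x = {hclass S s0 X x g | g. continuous_map S X g \<and> g s0 = x}"

definition induced :: "('b \<Rightarrow> 'c) \<Rightarrow> 's topology \<Rightarrow> 's \<Rightarrow> 'c topology \<Rightarrow> 'b \<Rightarrow> ('s \<Rightarrow> 'b) set \<Rightarrow> ('s \<Rightarrow> 'c) set" where
  "induced f S s0 K x C = hclass S s0 K (f x) (f \<circ> (SOME g. g \<in> C))"

definition sphere1 :: "complex topology" where "sphere1 = top_of_set (sphere 0 1)"
definition sphere2 :: "(real^3) topology" where "sphere2 = top_of_set (sphere 0 1)"

abbreviation pi1 where "pi1 X x \<equiv> hset sphere1 1 X x"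
abbreviation pi2 where "pi2 X x \<equiv> hset sphere2 (axis 1 1) X x"

definition pi0_map :: "('b \<Rightarrow> 'c) \<Rightarrow> 'c topology \<Rightarrow> 'b set \<Rightarrow> 'c set" where
  "pi0_map f K C = path_component_of_set K (f (SOME x. x \<in> C))"

end

theory Submission
  imports Defs
begin

text \<open>Call a simplex crossing if it lies in neither \<open>X\<close> nor \<open>Y\<close>. If a crossing simplex \<open>\<sigma>\<close> has a
  single vertex outside \<open>Y\<close> (or outside \<open>X\<close>), the gluing formula and the strong simplex assumption
  give a point of \<open>A\<close> within \<open>r\<close> of all of \<open>\<sigma>\<close>, and any two such points are within \<open>r\<close> of each
  other; so the obstruction complex is a full simplex. Every simplex with at most three vertices is of
  this kind if it crosses. A map from a planar compactum into the realization of \<open>VR d r (X \<union> Y)\<close> can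
  be pushed into the 2-skeleton and then, replacing the crossing vertices of the barycentric
  subdivision by points of \<open>A\<close>, into the realization of \<open>VR d r X \<union> VR d r Y\<close>, while points that are
  already there stay there. Applied to points, intervals, squares and discs, such deformations yield
  all the homotopical claims.\<close>

section \<open>Geometric realizations\<close>

text \<open>The obstacle is a crossing simplex with two or more vertices on each side: the
  construction of a common neighbour in \<open>A\<close> starts from a simplex whose part outside
  \<open>X\<close> or outside \<open>Y\<close> is a single vertex. A simplex violating this has at
  least four vertices, so it is invisible to maps all of whose values have at most three nonzero
  coordinates. This fixes the range of degrees. Loops, 2-spheres and homotopies of loops have
  parameter spaces of dimension at most two, but a homotopy of 2-spheres does not; hence bijectivity
  for the fundamental group and only surjectivity one degree higher. Points already in the
  subcomplex may move during the deformation, though only inside it, so a collar is used to convert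
  this into homotopies that are fixed on a boundary. A disc in a homotopy fibre is a family over
  disc times interval, which is three-dimensional, but only its face at time 0 has to be brought
  into the subcomplex, so planar deformations suffice there too. Parameter spaces are not
  triangulated: all maps are built from finite partitions of unity, so the coherent topology is met
  only on finite sets of vertices.\<close>

definition is_complex :: "'a set set \<Rightarrow> bool" where
  "is_complex K \<longleftrightarrow>
     (\<forall>\<sigma>\<in>K. finite \<sigma> \<and> \<sigma> \<noteq> {} \<and> (\<forall>\<tau>. \<tau> \<subseteq> \<sigma> \<and> \<tau> \<noteq> {} \<longrightarrow> \<tau> \<in> K))"

definition support :: "('a \<Rightarrow> real) \<Rightarrow> 'a set" where
  "support p = {v. p v \<noteq> 0}"

lemma is_complexD:
  assumes "is_complex K" "\<sigma> \<in> K"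
  shows "finite \<sigma>" "\<sigma> \<noteq> {}" "\<And>\<tau>. \<tau> \<subseteq> \<sigma> \<Longrightarrow> \<tau> \<noteq> {} \<Longrightarrow> \<tau> \<in> K"
proof -
  have "finite \<sigma> \<and> \<sigma> \<noteq> {} \<and> (\<forall>\<tau>. \<tau> \<subseteq> \<sigma> \<and> \<tau> \<noteq> {} \<longrightarrow> \<tau> \<in> K)"
    using assms(1)[unfolded is_complex_def] assms(2) by (rule bspec)
  then show "finite \<sigma>" "\<sigma> \<noteq> {}" "\<And>\<tau>. \<tau> \<subseteq> \<sigma> \<Longrightarrow> \<tau> \<noteq> {} \<Longrightarrow> \<tau> \<in> K" by blast+
qed

lemma istopology_realization:
  "istopology (\<lambda>U. U \<subseteq> (\<Union>\<sigma>\<in>K. simplex_pts \<sigma>) \<and>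
      (\<forall>\<sigma>\<in>K. openin (top_of_set (simplex_pts \<sigma>)) (U \<inter> simplex_pts \<sigma>)))"
  unfolding istopology_def
proof (intro conjI allI impI ballI, goal_cases)
  case (1 S T)
  then show ?case by blast
next
  case (2 S T \<sigma>)
  then have "openin (top_of_set (simplex_pts \<sigma>)) ((S \<inter> simplex_pts \<sigma>) \<inter> (T \<inter> simplex_pts \<sigma>))"
    by blast
  then show ?case by (simp add: Int_ac)
next
  case (3 \<U>)
  then show ?case by blast
next
  case (4 \<U> \<sigma>)
  then have "openin (top_of_set (simplex_pts \<sigma>)) (\<Union>U\<in>\<U>. U \<inter> simplex_pts \<sigma>)"
    by blast
  moreover have "(\<Union>U\<in>\<U>. U \<inter> simplex_pts \<sigma>) = \<Union>\<U> \<inter> simplex_pts \<sigma>" by blast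
  ultimately show ?case by simp
qed

lemma openin_realization:
  "openin (realization K) U \<longleftrightarrow> U \<subseteq> (\<Union>\<sigma>\<in>K. simplex_pts \<sigma>) \<and>
      (\<forall>\<sigma>\<in>K. openin (top_of_set (simplex_pts \<sigma>)) (U \<inter> simplex_pts \<sigma>))"
  unfolding realization_def topology_inverse'[OF istopology_realization] ..

lemma topspace_realization: "topspace (realization K) = (\<Union>\<sigma>\<in>K. simplex_pts \<sigma>)"
proof -
  have "openin (realization K) (\<Union>\<sigma>\<in>K. simplex_pts \<sigma>)"
    unfolding openin_realization
    by (auto intro!: openin_subtopology_self simp: Int_absorb1 UN_upper)
  moreover have "topspace (realization K) \<subseteq> (\<Union>\<sigma>\<in>K. simplex_pts \<sigma>)"
    using openin_topspace[of "realization K"] openin_realization by blast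
  ultimately show ?thesis using openin_subset by blast
qed

lemma closedin_realization:
  "closedin (realization K) C \<longleftrightarrow> C \<subseteq> (\<Union>\<sigma>\<in>K. simplex_pts \<sigma>) \<and>
      (\<forall>\<sigma>\<in>K. closedin (top_of_set (simplex_pts \<sigma>)) (C \<inter> simplex_pts \<sigma>))"
proof -
  have "(topspace (realization K) - C) \<inter> simplex_pts \<sigma> = simplex_pts \<sigma> - C \<inter> simplex_pts \<sigma>"
    if "\<sigma> \<in> K" for \<sigma>
    using that by (auto simp: topspace_realization)
  then show ?thesis
    unfolding closedin_def openin_realization topspace_realization by auto
qed

lemma mem_realization_iff:
  assumes "is_complex K"
  shows "p \<in> topspace (realization K) \<longleftrightarrow>
    (\<forall>v. 0 \<le> p v) \<and> support p \<in> K \<and> sum p (support p) = 1"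
proof
  assume "p \<in> topspace (realization K)"
  then obtain \<sigma> where \<sigma>: "\<sigma> \<in> K" "p \<in> simplex_pts \<sigma>" by (auto simp: topspace_realization)
  then have sub: "support p \<subseteq> \<sigma>" by (auto simp: simplex_pts_def support_def)
  have fin: "finite \<sigma>" using \<sigma>(1) assms is_complexD by blast
  have "sum p (support p) = sum p \<sigma>"
    by (rule sum.mono_neutral_left[OF fin sub]) (auto simp: support_def)
  then have one: "sum p (support p) = 1" using \<sigma> by (simp add: simplex_pts_def)
  then have "support p \<noteq> {}" by auto
  then show "(\<forall>v. 0 \<le> p v) \<and> support p \<in> K \<and> sum p (support p) = 1"
    using one sub \<sigma> is_complexD(3)[OF assms \<sigma>(1)] by (auto simp: simplex_pts_def)
next
  assume "(\<forall>v. 0 \<le> p v) \<and> support p \<in> K \<and> sum p (support p) = 1"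
  then have "p \<in> simplex_pts (support p)" "support p \<in> K"
    by (auto simp: simplex_pts_def support_def)
  then show "p \<in> topspace (realization K)" by (auto simp: topspace_realization)
qed

lemma support_in_complex:
  assumes "is_complex K" "p \<in> topspace (realization K)"
  shows "support p \<in> K"
  using assms(2) mem_realization_iff[OF assms(1)] by simp

lemma continuous_on_coordinate: "continuous_on S (\<lambda>f::'a \<Rightarrow> real. f v)"
  using continuous_on_product_then_coordinatewise[OF continuous_on_id, of S v] by simp

lemma closed_simplex_pts: "finite \<sigma> \<Longrightarrow> closed (simplex_pts \<sigma>)"
proof -
  have "closed {f::'a\<Rightarrow>real. 0 \<le> f v}" for v
    by (intro closed_Collect_le continuous_on_coordinate continuous_on_const)
  moreover have "closed {f::'a\<Rightarrow>real. f v = 0}" for v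
    by (intro closed_Collect_eq continuous_on_coordinate continuous_on_const)
  moreover have "closed {f::'a\<Rightarrow>real. sum f \<sigma> = 1}"
    by (intro closed_Collect_eq continuous_on_sum continuous_on_coordinate continuous_on_const)
  moreover have "simplex_pts \<sigma> = (\<Inter>v. {f. 0 \<le> f v}) \<inter> (\<Inter>v\<in>-\<sigma>. {f. f v = 0}) \<inter> {f. sum f \<sigma> = 1}"
    by (auto simp: simplex_pts_def)
  ultimately show ?thesis by (auto intro!: closed_Int closed_INT)
qed

lemma closed_finite_functions: "finite F \<Longrightarrow> closed (F :: ('a \<Rightarrow> real) set)"
proof (induction F rule: finite_induct)
  case (insert p F)
  have "closed {f::'a \<Rightarrow> real. f v = p v}" for v
    by (intro closed_Collect_eq continuous_on_coordinate continuous_on_const)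
  then have "closed (\<Inter>v. {f::'a \<Rightarrow> real. f v = p v})" by (intro closed_INT) auto
  moreover have "(\<Inter>v. {f. f v = p v}) = {p}" by auto
  ultimately show ?case using insert closed_Un[of "{p}" F] by simp
qed simp

lemma closedin_realization':
  assumes "is_complex K"
  shows "closedin (realization K) C \<longleftrightarrow> C \<subseteq> topspace (realization K) \<and>
      (\<forall>\<sigma>\<in>K. closed (C \<inter> simplex_pts \<sigma>))"
proof -
  have "closedin (top_of_set (simplex_pts \<sigma>)) (C \<inter> simplex_pts \<sigma>) \<longleftrightarrow> closed (C \<inter> simplex_pts \<sigma>)"
    if "\<sigma> \<in> K" for \<sigma>
  proof -
    have "closed (simplex_pts \<sigma>)"
      using closed_simplex_pts is_complexD(1)[OF assms that] by blast
    then show ?thesis using closedin_closed_eq[of "simplex_pts \<sigma>"] by auto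
  qed
  then show ?thesis by (auto simp: closedin_realization topspace_realization)
qed

text \<open>A simplex of \<open>K\<close> has only finitely many faces in \<open>L\<close>, so a set
  closed in the realization of \<open>L\<close> meets it in a finite union of closed sets. Knowing
  that both topologies agree allows the later sections to work with a subset of one fixed
  space.\<close>

lemma realization_subcomplex:
  assumes K: "is_complex K" and L: "is_complex L" and "L \<subseteq> K"
  shows "realization L = subtopology (realization K) (topspace (realization L))"
proof -
  have top: "topspace (realization L) \<subseteq> topspace (realization K)"
    using \<open>L \<subseteq> K\<close> by (auto simp: topspace_realization)
  have up: "closedin (realization K) C" if C: "closedin (realization L) C" for C
    unfolding closedin_realization'[OF K]
  proof (intro conjI ballI)
    show "C \<subseteq> topspace (realization K)" using closedin_subset[OF C] top by blast
    fix \<sigma> assume \<sigma>: "\<sigma> \<in> K"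
    have fin: "finite \<sigma>" using is_complexD(1)[OF K \<sigma>] .
    have "C \<inter> simplex_pts \<sigma> = (\<Union>\<tau>\<in>{\<tau>\<in>L. \<tau> \<subseteq> \<sigma>}. C \<inter> simplex_pts \<tau>) \<inter> simplex_pts \<sigma>"
    proof (intro equalityI subsetI)
      fix p assume p: "p \<in> C \<inter> simplex_pts \<sigma>"
      then have "p \<in> topspace (realization L)" using closedin_subset[OF C] by blast
      then have "support p \<in> L" "p \<in> simplex_pts (support p)"
        by (auto simp: mem_realization_iff[OF L] simplex_pts_def support_def)
      moreover have "support p \<subseteq> \<sigma>" using p by (auto simp: simplex_pts_def support_def)
      ultimately show "p \<in> (\<Union>\<tau>\<in>{\<tau>\<in>L. \<tau> \<subseteq> \<sigma>}. C \<inter> simplex_pts \<tau>) \<inter> simplex_pts \<sigma>"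
        using p by blast
    qed auto
    moreover have "finite {\<tau>\<in>L. \<tau> \<subseteq> \<sigma>}" using fin by (simp add: finite_subset[OF _ finite_Pow_iff[THEN iffD2]])
    moreover have "\<forall>\<tau>\<in>L. closed (C \<inter> simplex_pts \<tau>)"
      using C by (simp add: closedin_realization'[OF L])
    ultimately show "closed (C \<inter> simplex_pts \<sigma>)"
      using closed_simplex_pts[OF fin] by (metis (no_types, lifting) closed_Int closed_UN mem_Collect_eq)
  qed
  have down: "closedin (realization L) (C \<inter> topspace (realization L))"
    if C: "closedin (realization K) C" for C
    unfolding closedin_realization'[OF L]
  proof (intro conjI ballI)
    fix \<sigma> assume \<sigma>: "\<sigma> \<in> L"
    then have "C \<inter> topspace (realization L) \<inter> simplex_pts \<sigma> = C \<inter> simplex_pts \<sigma>"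
      by (auto simp: topspace_realization)
    then show "closed (C \<inter> topspace (realization L) \<inter> simplex_pts \<sigma>)"
      using C \<sigma> \<open>L \<subseteq> K\<close> by (auto simp: closedin_realization'[OF K])
  qed auto
  have "closedin (realization L) C \<longleftrightarrow>
      closedin (subtopology (realization K) (topspace (realization L))) C" for C
    unfolding closedin_subtopology using up down closedin_subset by (metis inf.absorb1)
  then have "openin (realization L) U \<longleftrightarrow>
      openin (subtopology (realization K) (topspace (realization L))) U" for U
    unfolding openin_closedin_eq using top by (simp add: inf.absorb2)
  then show ?thesis unfolding topology_eq by blast
qed

lemma continuous_map_coordinate_realization:
  assumes "is_complex K"
  shows "continuous_map (realization K) euclideanreal (\<lambda>p. p v)"
proof -
  have "closedin (realization K) {p \<in> topspace (realization K). p v \<in> C}" if "closed C" for C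
    unfolding closedin_realization'[OF assms]
  proof (intro conjI ballI)
    fix \<sigma> assume \<sigma>: "\<sigma> \<in> K"
    have "{p \<in> topspace (realization K). p v \<in> C} \<inter> simplex_pts \<sigma>
        = ((\<lambda>f. f v) -` C) \<inter> simplex_pts \<sigma>"
      using \<sigma> by (auto simp: topspace_realization)
    moreover have "closed ((\<lambda>f::'a \<Rightarrow> real. f v) -` C)"
      by (rule closed_vimage[OF that continuous_on_coordinate])
    ultimately show "closed ({p \<in> topspace (realization K). p v \<in> C} \<inter> simplex_pts \<sigma>)"
      using closed_simplex_pts is_complexD(1)[OF assms \<sigma>] by auto
  qed auto
  then show ?thesis by (auto simp: continuous_map_closedin)
qed

text \<open>Choose one point of \<open>C\<close> for each support that occurs. A simplex contains
  only finitely many chosen points, since their supports are faces of it, so every set of chosen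
  points is closed. They form a closed discrete subset of a compact set.\<close>

lemma compactin_realization_finite:
  assumes K: "is_complex K" and C: "compactin (realization K) C"
  shows "finite (\<Union>p\<in>C. support p)"
proof -
  define \<Sigma> where "\<Sigma> = support ` C"
  have "\<forall>\<sigma>\<in>\<Sigma>. \<exists>p\<in>C. support p = \<sigma>" unfolding \<Sigma>_def by blast
  then obtain pt where pt: "\<And>\<sigma>. \<sigma> \<in> \<Sigma> \<Longrightarrow> pt \<sigma> \<in> C \<and> support (pt \<sigma>) = \<sigma>" by metis
  have CK: "C \<subseteq> topspace (realization K)" using C compactin_subset_topspace by blast
  have cl: "closedin (realization K) (pt ` R)" if "R \<subseteq> \<Sigma>" for R
    unfolding closedin_realization'[OF K]
  proof (intro conjI ballI)
    show "pt ` R \<subseteq> topspace (realization K)" using that pt CK by blast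
    fix \<sigma> assume \<sigma>: "\<sigma> \<in> K"
    have "pt ` R \<inter> simplex_pts \<sigma> \<subseteq> pt ` Pow \<sigma>"
      using that pt by (fastforce simp: simplex_pts_def support_def)
    moreover have "finite (Pow \<sigma>)" using is_complexD(1)[OF K \<sigma>] by simp
    ultimately show "closed (pt ` R \<inter> simplex_pts \<sigma>)"
      by (meson finite_imageI closed_finite_functions finite_subset)
  qed
  \<comment> \<open>The member belonging to \<open>\<sigma>\<close> omits every chosen point except
    \<open>pt \<sigma>\<close>, so a finite subcover leaves room for finitely many supports
    only.\<close>
  define \<U> where "\<U> = (\<lambda>\<sigma>. topspace (realization K) - pt ` (\<Sigma> - {\<sigma>})) ` \<Sigma>"
  have "\<forall>U\<in>\<U>. openin (realization K) U"
    unfolding \<U>_def using cl by (auto intro!: openin_diff)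
  moreover have "C \<subseteq> \<Union>\<U>"
  proof
    fix p assume p: "p \<in> C"
    then have "p \<notin> pt ` (\<Sigma> - {support p})" using pt by auto
    then have "p \<in> topspace (realization K) - pt ` (\<Sigma> - {support p})" using p CK by blast
    then show "p \<in> \<Union>\<U>" using p unfolding \<U>_def \<Sigma>_def by blast
  qed
  ultimately obtain \<F> where \<F>: "finite \<F>" "\<F> \<subseteq> \<U>" "C \<subseteq> \<Union>\<F>"
    using C unfolding compactin_def by meson
  then obtain R where R: "finite R" "R \<subseteq> \<Sigma>"
      "\<F> = (\<lambda>\<sigma>. topspace (realization K) - pt ` (\<Sigma> - {\<sigma>})) ` R"
    unfolding \<U>_def by (meson finite_subset_image)
  have "\<Sigma> \<subseteq> R"
  proof
    fix \<sigma> assume \<sigma>: "\<sigma> \<in> \<Sigma>"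
    then have "pt \<sigma> \<in> \<Union>\<F>" using pt \<F> by blast
    then obtain \<tau> where \<tau>: "\<tau> \<in> R" "pt \<sigma> \<notin> pt ` (\<Sigma> - {\<tau>})" using R by blast
    then have "\<sigma> = \<tau>" using \<sigma> by blast
    then show "\<sigma> \<in> R" using \<tau> by simp
  qed
  then have "finite \<Sigma>" using R finite_subset by blast
  moreover have "\<forall>\<sigma>\<in>\<Sigma>. finite \<sigma>"
    using CK support_in_complex[OF K] is_complexD(1)[OF K] unfolding \<Sigma>_def by blast
  ultimately have "finite (\<Union>\<Sigma>)" by blast
  then show ?thesis by (simp add: \<Sigma>_def)
qed

text \<open>The coherent topology can be finer than the product topology, so continuous coordinates
  alone do not suffice. When all supports lie in the finite set \<open>V\<close>, the preimage of a
  closed set is a finite union over the simplices inside \<open>V\<close>, and on each of these the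
  two topologies agree.\<close>

lemma continuous_map_into_realization:
  assumes K: "is_complex K" and "finite V"
    and im: "\<And>x. x \<in> topspace T \<Longrightarrow> f x \<in> topspace (realization K) \<and> support (f x) \<subseteq> V"
    and cont: "\<And>v. v \<in> V \<Longrightarrow> continuous_map T euclideanreal (\<lambda>x. f x v)"
  shows "continuous_map T (realization K) f"
proof -
  have "continuous_map T euclideanreal (\<lambda>x. f x v)" for v
  proof (cases "v \<in> V")
    case False
    then have "0 = f x v" if "x \<in> topspace T" for x
      using im[OF that] by (auto simp: support_def)
    then show ?thesis using continuous_map_eq[of T euclideanreal "\<lambda>_. 0" "\<lambda>x. f x v"] by simp
  qed (use cont in auto)
  then have fc: "continuous_map T euclidean f"
    using continuous_map_componentwise_UNIV[of T "\<lambda>_. euclideanreal" f]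
    by (simp add: euclidean_product_topology)
  have "closedin T {x \<in> topspace T. f x \<in> C}" if C: "closedin (realization K) C" for C
  proof -
    have "{x \<in> topspace T. f x \<in> C}
        = (\<Union>\<sigma>\<in>{\<sigma>\<in>K. \<sigma> \<subseteq> V}. {x \<in> topspace T. f x \<in> C \<inter> simplex_pts \<sigma>})"
    proof (intro equalityI subsetI)
      fix x assume x: "x \<in> {x \<in> topspace T. f x \<in> C}"
      then have "support (f x) \<in> K" "support (f x) \<subseteq> V" "f x \<in> simplex_pts (support (f x))"
        using im[of x] by (auto simp: mem_realization_iff[OF K] simplex_pts_def support_def)
      then show "x \<in> (\<Union>\<sigma>\<in>{\<sigma>\<in>K. \<sigma> \<subseteq> V}. {x \<in> topspace T. f x \<in> C \<inter> simplex_pts \<sigma>})"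
        using x by blast
    qed auto
    moreover have "finite {\<sigma>\<in>K. \<sigma> \<subseteq> V}"
      using \<open>finite V\<close> by (simp add: finite_subset[OF _ finite_Pow_iff[THEN iffD2]])
    moreover have "closedin T {x \<in> topspace T. f x \<in> C \<inter> simplex_pts \<sigma>}" if "\<sigma> \<in> K" for \<sigma>
    proof -
      have "closed (C \<inter> simplex_pts \<sigma>)" using C that by (simp add: closedin_realization'[OF K])
      then show ?thesis using fc unfolding continuous_map_closedin closed_closedin by blast
    qed
    ultimately show ?thesis by (auto intro!: closedin_Union)
  qed
  then show ?thesis using im by (auto simp: continuous_map_closedin)
qed

section \<open>Maps given by weights, and straight-line homotopies\<close>

text \<open>The normalized weights are a partition of unity indexed by \<open>I\<close>, that is, a
  map to a nerve; \<open>u\<close> is the vertex assignment of a simplicial map out of this nerve.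
  Indices with equal image pool their weights.\<close>

definition vertex_map :: "'i set \<Rightarrow> ('i \<Rightarrow> real) \<Rightarrow> ('i \<Rightarrow> 'a) \<Rightarrow> 'a \<Rightarrow> real" where
  "vertex_map I w u = (\<lambda>v. (\<Sum>i\<in>{i\<in>I. u i = v}. w i) / (\<Sum>i\<in>I. w i))"

lemma
  assumes "finite I" and nonneg: "\<And>i. i \<in> I \<Longrightarrow> 0 \<le> w i" and pos: "\<exists>i\<in>I. 0 < w i"
  shows support_vertex_map: "support (vertex_map I w u) = u ` {i\<in>I. 0 < w i}"
    and vertex_map_nonneg: "0 \<le> vertex_map I w u v"
    and sum_vertex_map: "sum (vertex_map I w u) (support (vertex_map I w u)) = 1"
proof -
  have W: "0 < sum w I" using assms by (meson sum_pos2)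
  show supp: "support (vertex_map I w u) = u ` {i\<in>I. 0 < w i}"
  proof (intro equalityI subsetI)
    fix v assume "v \<in> support (vertex_map I w u)"
    then have "(\<Sum>i\<in>{i\<in>I. u i = v}. w i) \<noteq> 0" by (simp add: support_def vertex_map_def)
    then obtain i where i: "i \<in> {i\<in>I. u i = v}" "w i \<noteq> 0" by (meson sum.neutral)
    then have "0 < w i" using nonneg[of i] by auto
    then show "v \<in> u ` {i\<in>I. 0 < w i}" using i by blast
  next
    fix v assume "v \<in> u ` {i\<in>I. 0 < w i}"
    then obtain i where i: "i \<in> {i\<in>I. u i = v}" "0 < w i" by blast
    have "0 < (\<Sum>i\<in>{i\<in>I. u i = v}. w i)"
      by (rule sum_pos2[where i = i]) (use assms i in auto)
    then show "v \<in> support (vertex_map I w u)" using W by (simp add: support_def vertex_map_def)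
  qed
  show "0 \<le> vertex_map I w u v"
    unfolding vertex_map_def using nonneg W by (auto intro!: divide_nonneg_pos sum_nonneg)
  have "sum (vertex_map I w u) (support (vertex_map I w u)) = sum (vertex_map I w u) (u ` I)"
    by (rule sum.mono_neutral_left) (use supp \<open>finite I\<close> in \<open>auto simp: support_def\<close>)
  also have "\<dots> = (\<Sum>v\<in>u ` I. \<Sum>i\<in>{i\<in>I. u i = v}. w i) / sum w I"
    by (simp add: vertex_map_def sum_divide_distrib)
  also have "(\<Sum>v\<in>u ` I. \<Sum>i\<in>{i\<in>I. u i = v}. w i) = sum w I"
    by (rule sum.image_gen[OF \<open>finite I\<close>, symmetric])
  finally show "sum (vertex_map I w u) (support (vertex_map I w u)) = 1" using W by simp
qed

lemma continuous_map_vertex_map: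
  assumes K: "is_complex K" and "finite I"
    and cont: "\<And>i. i \<in> I \<Longrightarrow> continuous_map T euclideanreal (\<lambda>x. w x i)"
    and nonneg: "\<And>x i. x \<in> topspace T \<Longrightarrow> i \<in> I \<Longrightarrow> 0 \<le> w x i"
    and pos: "\<And>x. x \<in> topspace T \<Longrightarrow> \<exists>i\<in>I. 0 < w x i"
    and simp: "\<And>x. x \<in> topspace T \<Longrightarrow> u ` {i\<in>I. 0 < w x i} \<in> K"
  shows "continuous_map T (realization K) (\<lambda>x. vertex_map I (w x) u)"
proof (rule continuous_map_into_realization[OF K, of "u ` I"])
  fix x assume x: "x \<in> topspace T"
  show "vertex_map I (w x) u \<in> topspace (realization K) \<and> support (vertex_map I (w x) u) \<subseteq> u ` I"
    unfolding mem_realization_iff[OF K]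
    using support_vertex_map[OF \<open>finite I\<close> nonneg[OF x] pos[OF x], of u]
      vertex_map_nonneg[OF \<open>finite I\<close> nonneg[OF x] pos[OF x], of u]
      sum_vertex_map[OF \<open>finite I\<close> nonneg[OF x] pos[OF x], of u] simp[OF x] by auto
next
  fix v
  have "sum (w x) I \<noteq> 0" if "x \<in> topspace T" for x
    using sum_pos2[OF \<open>finite I\<close>, of _ "w x"] nonneg[OF that] pos[OF that]
    by (metis less_irrefl)
  then show "continuous_map T euclideanreal (\<lambda>x. vertex_map I (w x) u v)"
    unfolding vertex_map_def using \<open>finite I\<close> cont
    by (auto intro!: continuous_map_real_divide continuous_map_sum)
qed (use \<open>finite I\<close> in auto)

lemma sum_superset_support:
  assumes "finite S" "support p \<subseteq> S"
  shows "sum p S = sum p (support p)"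
  by (rule sum.mono_neutral_right[OF assms]) (simp add: support_def)

lemma realization_segment:
  assumes K: "is_complex K" and p: "p \<in> topspace (realization K)" and q: "q \<in> topspace (realization K)"
    and M: "support p \<union> support q \<in> M" and t: "0 \<le> t" "t \<le> 1"
  shows "(\<lambda>v. (1 - t) * p v + t * q v) \<in> topspace (realization M)"
proof -
  let ?s = "support p \<union> support q"
  have fin: "finite (support p)" "finite (support q)"
    using support_in_complex[OF K] p q is_complexD(1)[OF K] by auto
  have 1: "sum p ?s = 1" "sum q ?s = 1"
    using sum_superset_support[of ?s p] sum_superset_support[of ?s q] p q fin mem_realization_iff[OF K]
    by simp_all
  have "(\<Sum>v\<in>?s. (1 - t) * p v + t * q v) = (1 - t) * sum p ?s + t * sum q ?s"
    by (simp add: sum.distrib sum_distrib_left)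
  then have "(\<lambda>v. (1 - t) * p v + t * q v) \<in> simplex_pts ?s"
    using 1 t mem_realization_iff[OF K, of p] mem_realization_iff[OF K, of q] p q
    unfolding simplex_pts_def by (simp add: support_def)
  then show ?thesis using M by (auto simp: topspace_realization)
qed

text \<open>Maps whose supports span a common simplex at every parameter are joined by straight
  segments, and the finite vertex set makes the segments jointly continuous for the coherent
  topology. \<open>Q\<close> marks the parameters whose segments have to stay in \<open>L\<close>;
  this is how relative information is carried along.\<close>

lemma homotopic_with_linear_realization:
  assumes K: "is_complex K" and "finite V"
    and f: "continuous_map T (realization K) f" and g: "continuous_map T (realization K) g"
    and V: "\<And>x. x \<in> topspace T \<Longrightarrow> support (f x) \<union> support (g x) \<subseteq> V"
    and simp: "\<And>x. x \<in> topspace T \<Longrightarrow> support (f x) \<union> support (g x) \<in> K"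
    and simpL: "\<And>x. x \<in> topspace T \<Longrightarrow> Q x \<Longrightarrow> support (f x) \<union> support (g x) \<in> L"
  shows "homotopic_with (\<lambda>h. \<forall>x\<in>topspace T. Q x \<longrightarrow> h x \<in> topspace (realization L))
           T (realization K) f g"
proof -
  define h where "h = (\<lambda>(t, x) v. (1 - t) * f x v + t * g x v)"
  have fg: "f x \<in> topspace (realization K)" "g x \<in> topspace (realization K)" if "x \<in> topspace T" for x
    using f g that continuous_map_image_subset_topspace by blast+
  have supp: "support (h (t, x)) \<subseteq> V" if "x \<in> topspace T" for t x
  proof
    fix v assume "v \<in> support (h (t, x))"
    then have "f x v \<noteq> 0 \<or> g x v \<noteq> 0" unfolding h_def support_def by auto
    then show "v \<in> V" using V[OF that] unfolding support_def by auto
  qed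
  have c: "continuous_map (prod_topology (top_of_set {0..1}) T) euclideanreal (\<lambda>z. f (snd z) v)"
          "continuous_map (prod_topology (top_of_set {0..1}) T) euclideanreal (\<lambda>z. g (snd z) v)" for v
    using continuous_map_compose[OF continuous_map_compose[OF continuous_map_snd f]
        continuous_map_coordinate_realization[OF K]]
      continuous_map_compose[OF continuous_map_compose[OF continuous_map_snd g]
        continuous_map_coordinate_realization[OF K]] by (simp_all add: o_def)
  have c1: "continuous_map (prod_topology (top_of_set {0..1}) T) euclideanreal fst"
    using continuous_map_fst continuous_map_in_subtopology by blast
  have "continuous_map (prod_topology (top_of_set {0..1}) T) (realization K) h"
  proof (rule continuous_map_into_realization[OF K \<open>finite V\<close>])
    fix z assume "z \<in> topspace (prod_topology (top_of_set {0..1::real}) T)"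
    then obtain t x where z: "z = (t, x)" "0 \<le> t" "t \<le> 1" "x \<in> topspace T" by auto
    show "h z \<in> topspace (realization K) \<and> support (h z) \<subseteq> V"
      using realization_segment[OF K fg[OF z(4)] simp[OF z(4)] z(2,3)] supp[OF z(4)] z(1)
      by (simp add: h_def)
  next
    fix v
    show "continuous_map (prod_topology (top_of_set {0..1}) T) euclideanreal (\<lambda>z. h z v)"
      unfolding h_def case_prod_beta by (intro continuous_intros c c1)
  qed
  moreover have "h (t, x) \<in> topspace (realization L)"
    if "t \<in> {0..1}" "x \<in> topspace T" "Q x" for t x
    using realization_segment[OF K fg[OF that(2)] simpL[OF that(2,3)], of t] that(1) by (simp add: h_def)
  ultimately show ?thesis
    unfolding homotopic_with_def by (intro exI[of _ h]) (auto simp: h_def)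
qed

section \<open>Deforming maps from planar compacta\<close>

lemma compact_map_finite_support:
  assumes K: "is_complex K" and "compact T" and f: "continuous_map (top_of_set T) (realization K) f"
  shows "finite (\<Union>x\<in>T. support (f x))"
proof -
  have "compactin (top_of_set T) T" using \<open>compact T\<close> by (simp add: compactin_subtopology)
  then have "compactin (realization K) (f ` T)" using f image_compactin by blast
  from compactin_realization_finite[OF K this] show ?thesis by simp
qed

text \<open>The hexagonal bumps around the points of a lattice of small mesh cover the plane with
  multiplicity three.\<close>

definition hex_bump :: "real \<Rightarrow> complex \<Rightarrow> int \<times> int \<Rightarrow> real" where
  "hex_bump e z = (\<lambda>(i, j). max 0 (1 - max \<bar>Re z / e - i\<bar>
     (max \<bar>Im z / e - j\<bar> \<bar>(Re z / e - i) - (Im z / e - j)\<bar>)))"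

lemma hex_bump_pos_iff:
  "0 < hex_bump e z (i, j) \<longleftrightarrow> \<bar>Re z / e - i\<bar> < 1 \<and> \<bar>Im z / e - j\<bar> < 1 \<and>
     \<bar>(Re z / e - i) - (Im z / e - j)\<bar> < 1"
proof -
  have "0 < max 0 (1 - max a (max b c)) \<longleftrightarrow> a < 1 \<and> b < 1 \<and> c < 1" for a b c :: real
    by linarith
  then show ?thesis by (simp only: hex_bump_def prod.case)
qed

lemma hex_bump_floor: "0 < hex_bump e z (\<lfloor>Re z / e\<rfloor>, \<lfloor>Im z / e\<rfloor>)"
proof -
  have "\<bar>x - \<lfloor>x\<rfloor>\<bar> < 1" "\<bar>y - \<lfloor>y\<rfloor>\<bar> < 1" "\<bar>(x - \<lfloor>x\<rfloor>) - (y - \<lfloor>y\<rfloor>)\<bar> < 1" for x y :: real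
    by linarith+
  then show ?thesis unfolding hex_bump_pos_iff by blast
qed

text \<open>The strict bounds on the two coordinates leave at most the four corners of the lattice
  square around the rescaled point. The bound on the difference cuts this square along a diagonal
  and discards the corner on the far side.\<close>

lemma card_hex_bump_le: "finite {l. 0 < hex_bump e z l} \<and> card {l. 0 < hex_bump e z l} \<le> 3"
proof -
  define x y where "x = Re z / e" and "y = Im z / e"
  define S where "S = (if frac y \<le> frac x
    then {(\<lfloor>x\<rfloor>, \<lfloor>y\<rfloor>), (\<lfloor>x\<rfloor> + 1, \<lfloor>y\<rfloor>), (\<lfloor>x\<rfloor> + 1, \<lfloor>y\<rfloor> + 1)}
    else {(\<lfloor>x\<rfloor>, \<lfloor>y\<rfloor>), (\<lfloor>x\<rfloor>, \<lfloor>y\<rfloor> + 1), (\<lfloor>x\<rfloor> + 1, \<lfloor>y\<rfloor> + 1)})"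
  have "(i, j) \<in> S" if "0 < hex_bump e z (i, j)" for i j
  proof -
    have b: "\<bar>x - i\<bar> < 1" "\<bar>y - j\<bar> < 1" "\<bar>(x - i) - (y - j)\<bar> < 1"
      using that unfolding hex_bump_pos_iff x_def y_def by auto
    then have "i = \<lfloor>x\<rfloor> \<or> i = \<lfloor>x\<rfloor> + 1" "j = \<lfloor>y\<rfloor> \<or> j = \<lfloor>y\<rfloor> + 1" by linarith+
    then show ?thesis using b unfolding S_def frac_def by auto
  qed
  then have sub: "{l. 0 < hex_bump e z l} \<subseteq> S" by auto
  have "finite S" "card S \<le> 3" unfolding S_def by (auto simp: card_insert_if)
  then show ?thesis using sub card_mono[OF _ sub] finite_subset[OF sub] by auto
qed

text \<open>The sets where a coordinate of \<open>f\<close> is positive cover \<open>T\<close>. If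
  the lattice is fine compared with a Lebesgue number, each bump can be given a coordinate that is
  positive on its whole support. The vertices used at a point then belong to the carrier of
  \<open>f\<close> there, and at most three bumps are positive. Staying in the carrier makes the
  straight-line homotopy to \<open>f\<close> available.\<close>

lemma map_into_2_skeleton:
  fixes T :: "complex set"
  assumes K: "is_complex K" and "compact T" and f: "continuous_map (top_of_set T) (realization K) f"
  shows "\<exists>g. continuous_map (top_of_set T) (realization K) g \<and>
     (\<forall>x\<in>T. support (g x) \<subseteq> support (f x) \<and> card (support (g x)) \<le> 3)"
proof -
  define V where "V = (\<Union>x\<in>T. support (f x))"
  have V: "finite V" unfolding V_def by (rule compact_map_finite_support[OF assms])
  have fx: "f x \<in> topspace (realization K)" if "x \<in> T" for x
    using continuous_map_image_subset_topspace[OF f] that by auto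
  have "openin (top_of_set T) {x \<in> T. 0 < f x v}" for v
  proof -
    have "continuous_map (top_of_set T) euclideanreal (\<lambda>x. f x v)"
      using continuous_map_compose[OF f continuous_map_coordinate_realization[OF K]] by (simp add: o_def)
    then have "openin (top_of_set T) {x \<in> topspace (top_of_set T). f x v \<in> {0<..}}"
      unfolding continuous_map_def by (metis open_greaterThan open_openin)
    then show ?thesis by simp
  qed
  then have "\<forall>v. \<exists>W. open W \<and> {x \<in> T. 0 < f x v} = T \<inter> W" by (simp add: openin_open)
  then obtain W where W: "\<And>v. open (W v)" "\<And>v. {x \<in> T. 0 < f x v} = T \<inter> W v" by metis
  have cover: "T \<subseteq> \<Union>(W ` V)"
  proof
    fix x assume x: "x \<in> T"
    have "support (f x) \<noteq> {}" "\<forall>v. 0 \<le> f x v"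
      using is_complexD(2)[OF K support_in_complex[OF K fx[OF x]]] fx[OF x] mem_realization_iff[OF K] by auto
    then obtain v where v: "0 < f x v" "v \<in> support (f x)" by (force simp: support_def less_le)
    then have "x \<in> T \<inter> W v" using x W(2)[of v] by auto
    then show "x \<in> \<Union>(W ` V)" using v x unfolding V_def by blast
  qed
  show ?thesis
  proof (cases "T = {}")
    case True
    then show ?thesis using f by (intro exI[of _ f]) auto
  next
    case False
    then have "W ` V \<noteq> {}" using cover by auto
    then obtain \<delta> where \<delta>: "0 < \<delta>" "\<And>S. \<lbrakk>S \<subseteq> T; diameter S < \<delta>\<rbrakk> \<Longrightarrow> \<exists>B\<in>W ` V. S \<subseteq> B"
      using Lebesgue_number_lemma[OF \<open>compact T\<close> _ cover] W(1) by (metis imageE)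
    \<comment> \<open>On the support of a bump both coordinates are within \<open>e\<close> of the
      lattice point, so its diameter is at most \<open>4 * e\<close>, which is below
      \<open>\<delta>\<close>.\<close>
    define e where "e = \<delta> / 5"
    have e: "0 < e" using \<delta> by (simp add: e_def)
    obtain B where B: "\<And>x. x \<in> T \<Longrightarrow> cmod x \<le> B"
      using compact_imp_bounded[OF \<open>compact T\<close>] unfolding bounded_iff by blast
    \<comment> \<open>Large enough that the floor indices of every point of \<open>T\<close> lie in
      \<open>I\<close>, so that some bump indexed by \<open>I\<close> is positive there.\<close>
    define N where "N = \<lceil>B / e\<rceil> + 1"
    define I where "I = {-N..N} \<times> {-N..N}"
    have "finite I" by (simp add: I_def)
    have "\<exists>v\<in>V. {x\<in>T. 0 < hex_bump e x l} \<subseteq> W v" for l :: "int \<times> int"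
    proof -
      obtain i j where l: "l = (i, j)" by force
      have "diameter {x\<in>T. 0 < hex_bump e x l} \<le> 4 * e"
      proof (rule diameter_le)
        fix x y assume xy: "x \<in> {x\<in>T. 0 < hex_bump e x l}" "y \<in> {x\<in>T. 0 < hex_bump e x l}"
        then have "\<bar>Re x / e - Re y / e\<bar> < 2" "\<bar>Im x / e - Im y / e\<bar> < 2"
          unfolding l by (auto simp: hex_bump_pos_iff)
        then have "\<bar>Re (x - y)\<bar> < 2 * e" "\<bar>Im (x - y)\<bar> < 2 * e"
          using e by (auto simp: diff_divide_distrib[symmetric] field_simps abs_less_iff)
        then have "cmod (x - y) \<le> 4 * e" using cmod_le[of "x - y"] by linarith
        then show "norm (x - y) \<le> 4 * e" .
      qed (use e in auto)
      also have "\<dots> < \<delta>" using \<delta>(1) by (simp add: e_def)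
      finally show ?thesis using \<delta>(2)[of "{x\<in>T. 0 < hex_bump e x l}"] by blast
    qed
    then obtain u where u: "\<And>l. u l \<in> V" "\<And>l. {x\<in>T. 0 < hex_bump e x l} \<subseteq> W (u l)" by metis
    have in_supp: "u l \<in> support (f x)" if "x \<in> T" "0 < hex_bump e x l" for x l
    proof -
      have "x \<in> T \<inter> W (u l)" using u(2)[of l] that by blast
      then have "x \<in> {x \<in> T. 0 < f x (u l)}" using W(2) by blast
      then show ?thesis by (auto simp: support_def)
    qed
    have nonneg: "0 \<le> hex_bump e x l" for x l by (auto simp: hex_bump_def split: prod.split)
    have pos: "\<exists>l\<in>I. 0 < hex_bump e x l" if "x \<in> T" for x
    proof -
      have "\<bar>Re x\<bar> \<le> B" "\<bar>Im x\<bar> \<le> B"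
        using B[OF that] abs_Re_le_cmod[of x] abs_Im_le_cmod[of x] by linarith+
      then have "\<bar>Re x / e\<bar> \<le> B / e" "\<bar>Im x / e\<bar> \<le> B / e"
        using e by (auto simp: divide_right_mono abs_divide)
      then have "(\<lfloor>Re x / e\<rfloor>, \<lfloor>Im x / e\<rfloor>) \<in> I" unfolding I_def N_def by (auto; linarith)
      then show ?thesis using hex_bump_floor by blast
    qed
    define g where "g = (\<lambda>x. vertex_map I (hex_bump e x) u)"
    have supp: "support (g x) = u ` {l\<in>I. 0 < hex_bump e x l}" if "x \<in> T" for x
      unfolding g_def by (rule support_vertex_map[OF \<open>finite I\<close> nonneg pos[OF that]])
    have sub: "support (g x) \<subseteq> support (f x)" if "x \<in> T" for x
      using supp[OF that] in_supp[OF that] by auto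
    have "card (support (g x)) \<le> 3" if "x \<in> T" for x
    proof -
      have "card {l\<in>I. 0 < hex_bump e x l} \<le> card {l. 0 < hex_bump e x l}"
        using card_hex_bump_le by (intro card_mono) auto
      then have "card (u ` {l\<in>I. 0 < hex_bump e x l}) \<le> 3"
        using card_hex_bump_le[of e x] card_image_le[of "{l\<in>I. 0 < hex_bump e x l}" u] \<open>finite I\<close> by force
      then show ?thesis using supp[OF that] by simp
    qed
    moreover have "continuous_map (top_of_set T) (realization K) g"
      unfolding g_def
    proof (rule continuous_map_vertex_map[OF K \<open>finite I\<close>])
      fix l :: "int \<times> int"
      obtain i j where l: "l = (i, j)" by force
      show "continuous_map (top_of_set T) euclideanreal (\<lambda>x. hex_bump e x l)"
        unfolding hex_bump_def l using e by (auto intro!: continuous_intros)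
    next
      fix x assume "x \<in> topspace (top_of_set T)"
      then have x: "x \<in> T" by simp
      then show "\<exists>l\<in>I. 0 < hex_bump e x l" by (rule pos)
      have "u ` {l \<in> I. 0 < hex_bump e x l} \<noteq> {}" using pos[OF x] by auto
      then show "u ` {l \<in> I. 0 < hex_bump e x l} \<in> K"
        using sub[OF x] supp[OF x] is_complexD(3)[OF K support_in_complex[OF K fx[OF x]]] by simp
    qed (rule nonneg)
    ultimately show ?thesis using sub by blast
  qed
qed

text \<open>The weight of a set \<open>\<sigma>\<close> is positive exactly when \<open>\<sigma>\<close> is a superlevel set of the barycentric
  coordinates, so the sets of positive weight form a flag, as in the barycentric subdivision.\<close>

definition flag_weight :: "'a set \<Rightarrow> ('a \<Rightarrow> real) \<Rightarrow> 'a set \<Rightarrow> real" where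
  "flag_weight V p \<sigma> = (\<Prod>v\<in>\<sigma>. max 0 (p v) * (\<Prod>u\<in>V - \<sigma>. max 0 (p v - p u)))"

lemma flag_weight_nonneg: "0 \<le> flag_weight V p \<sigma>"
  unfolding flag_weight_def by (intro prod_nonneg mult_nonneg_nonneg ballI) auto

lemma flag_weight_pos_iff:
  assumes "finite V" "\<sigma> \<subseteq> V"
  shows "0 < flag_weight V p \<sigma> \<longleftrightarrow> (\<forall>v\<in>\<sigma>. 0 < p v \<and> (\<forall>u\<in>V - \<sigma>. p u < p v))"
proof -
  have fin: "finite \<sigma>" "finite (V - \<sigma>)" using assms finite_subset by auto
  have "flag_weight V p \<sigma> \<noteq> 0 \<longleftrightarrow>
      (\<forall>v\<in>\<sigma>. max 0 (p v) \<noteq> 0 \<and> (\<forall>u\<in>V - \<sigma>. max 0 (p v - p u) \<noteq> 0))"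
    unfolding flag_weight_def using fin by (simp add: prod_zero_iff)
  also have "\<dots> \<longleftrightarrow> (\<forall>v\<in>\<sigma>. 0 < p v \<and> (\<forall>u\<in>V - \<sigma>. p u < p v))"
  proof -
    have m: "max 0 x \<noteq> 0 \<longleftrightarrow> 0 < x" for x :: real by linarith
    show ?thesis by (simp only: m diff_gt_0_iff_gt)
  qed
  finally show ?thesis using flag_weight_nonneg[of V p \<sigma>] by linarith
qed

lemma flag_weight_chain:
  assumes "finite V" "\<sigma> \<subseteq> V" "\<tau> \<subseteq> V" "0 < flag_weight V p \<sigma>" "0 < flag_weight V p \<tau>"
  shows "\<sigma> \<subseteq> \<tau> \<or> \<tau> \<subseteq> \<sigma>"
proof (rule ccontr)
  assume "\<not> (\<sigma> \<subseteq> \<tau> \<or> \<tau> \<subseteq> \<sigma>)"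
  then obtain v u where vu: "v \<in> \<sigma>" "v \<notin> \<tau>" "u \<in> \<tau>" "u \<notin> \<sigma>" by blast
  then have "p u < p v" "p v < p u"
    using assms(2-5) flag_weight_pos_iff[OF assms(1)] by (metis Diff_iff subsetD)+
  then show False by simp
qed

text \<open>The vertices where \<open>p\<close> is maximal form the smallest nonempty superlevel
  set; it has positive weight because the maximum is positive.\<close>

lemma flag_weight_ex_pos:
  assumes "finite V" "v \<in> V" "0 < p v"
  shows "\<exists>\<sigma>\<in>Pow V - {{}}. 0 < flag_weight V p \<sigma>"
proof -
  define m where "m = Max (p ` V)"
  have m: "p u \<le> m" if "u \<in> V" for u using that assms by (simp add: m_def)
  have "m \<in> p ` V" unfolding m_def using assms by (intro Max_in) auto
  then have ne: "{u\<in>V. p u = m} \<noteq> {}" by auto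
  have "0 < m" using m[of v] assms by linarith
  then have "0 < flag_weight V p {u\<in>V. p u = m}"
    using m by (subst flag_weight_pos_iff) (auto simp: assms less_le)
  then show ?thesis using ne by blast
qed

text \<open>A point with flag \<open>\<C>\<close> of superlevel sets is moved to the span of \<open>s ` \<C>\<close> inside its carrier,
  and then to the span of \<open>\<rho> ` \<C>\<close>.\<close>

lemma deform_along_flags:
  assumes K: "is_complex K" and L: "is_complex L" and "finite V"
    and g: "continuous_map T (realization K) g"
    and gV: "\<And>x. x \<in> topspace T \<Longrightarrow> support (g x) \<subseteq> V \<and> support (g x) \<in> G"
    and flags: "\<And>\<sigma> \<C>. \<lbrakk>\<sigma> \<in> G; \<C> \<noteq> {}; \<C> \<subseteq> Pow \<sigma> - {{}}; \<And>\<alpha> \<beta>. \<alpha> \<in> \<C> \<Longrightarrow> \<beta> \<in> \<C> \<Longrightarrow> \<alpha> \<subseteq> \<beta> \<or> \<beta> \<subseteq> \<alpha>\<rbrakk>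
      \<Longrightarrow> s ` \<C> \<subseteq> \<sigma> \<and> s ` \<C> \<union> \<rho> ` \<C> \<in> K \<and> \<rho> ` \<C> \<in> L \<and> (\<sigma> \<in> L \<longrightarrow> s ` \<C> \<union> \<rho> ` \<C> \<in> L)"
  shows "\<exists>k. homotopic_with (\<lambda>h. \<forall>x\<in>topspace T. support (g x) \<in> L \<longrightarrow> h x \<in> topspace (realization L))
      T (realization K) g k \<and> k ` topspace T \<subseteq> topspace (realization L)"
proof -
  define I where "I = Pow V - {{}}"
  define w where "w = (\<lambda>x. flag_weight V (g x))"
  define C where "C = (\<lambda>x. {\<sigma>\<in>I. 0 < w x \<sigma>})"
  have I: "finite I" unfolding I_def using \<open>finite V\<close> by simp
  have gK: "g x \<in> topspace (realization K)" if "x \<in> topspace T" for x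
    using continuous_map_image_subset_topspace[OF g] that by auto
  have nonneg: "0 \<le> w x \<sigma>" for x \<sigma> by (simp add: w_def flag_weight_nonneg)
  have pos: "\<exists>\<sigma>\<in>I. 0 < w x \<sigma>" if "x \<in> topspace T" for x
  proof -
    have "support (g x) \<noteq> {}" "\<forall>v. 0 \<le> g x v"
      using is_complexD(2)[OF K support_in_complex[OF K gK[OF that]]] gK[OF that]
        mem_realization_iff[OF K] by auto
    then obtain v where "0 < g x v" "v \<in> support (g x)" by (force simp: support_def less_le)
    then show ?thesis
      unfolding I_def w_def using flag_weight_ex_pos[OF \<open>finite V\<close>] gV[OF that] by blast
  qed
  have C: "s ` C x \<subseteq> support (g x) \<and> s ` C x \<union> \<rho> ` C x \<in> K \<and> \<rho> ` C x \<in> L \<and>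
      (support (g x) \<in> L \<longrightarrow> s ` C x \<union> \<rho> ` C x \<in> L)" if x: "x \<in> topspace T" for x
  proof (rule flags)
    show "support (g x) \<in> G" using gV[OF x] by blast
    show "C x \<noteq> {}" using pos[OF x] unfolding C_def by blast
    show "C x \<subseteq> Pow (support (g x)) - {{}}"
    proof
      fix \<sigma> assume "\<sigma> \<in> C x"
      then have \<sigma>: "\<sigma> \<subseteq> V" "\<sigma> \<noteq> {}" "0 < flag_weight V (g x) \<sigma>"
        by (auto simp: C_def I_def w_def)
      then have "\<forall>v\<in>\<sigma>. 0 < g x v" using flag_weight_pos_iff[OF \<open>finite V\<close>] by blast
      then show "\<sigma> \<in> Pow (support (g x)) - {{}}" using \<sigma> by (force simp: support_def)
    qed
    show "\<alpha> \<subseteq> \<beta> \<or> \<beta> \<subseteq> \<alpha>" if "\<alpha> \<in> C x" "\<beta> \<in> C x" for \<alpha> \<beta>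
      using that by (intro flag_weight_chain[OF \<open>finite V\<close>]) (auto simp: C_def I_def w_def)
  qed
  have sub: "s ` C x \<in> K \<and> \<rho> ` C x \<in> K" if "x \<in> topspace T" for x
    using C[OF that] is_complexD(3)[OF K, of "s ` C x \<union> \<rho> ` C x"] pos[OF that]
    unfolding C_def by blast
  \<comment> \<open>Both maps use the same weights, so at each point their supports are the images
    of one flag under \<open>s\<close> and \<open>\<rho>\<close>. The hypothesis on flags puts the
    union of these images into a single simplex.\<close>
  define f1 f2 where "f1 = (\<lambda>x. vertex_map I (w x) s)" and "f2 = (\<lambda>x. vertex_map I (w x) \<rho>)"
  have supp1: "support (f1 x) = s ` C x" and supp2: "support (f2 x) = \<rho> ` C x"
    if "x \<in> topspace T" for x
    unfolding f1_def f2_def C_def by (rule support_vertex_map[OF I nonneg pos[OF that]])+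
  have wc: "continuous_map T euclideanreal (\<lambda>x. w x \<sigma>)" if "\<sigma> \<in> I" for \<sigma>
  proof -
    have c: "continuous_map T euclideanreal (\<lambda>x. g x v)" for v
      using continuous_map_compose[OF g continuous_map_coordinate_realization[OF K]] by (simp add: o_def)
    have "finite \<sigma>" "finite (V - \<sigma>)" using that \<open>finite V\<close> by (auto simp: I_def finite_subset)
    then show ?thesis
      unfolding w_def flag_weight_def by (intro continuous_intros c) auto
  qed
  have f1: "continuous_map T (realization K) f1" and f2: "continuous_map T (realization K) f2"
    unfolding f1_def f2_def
    by (rule continuous_map_vertex_map[OF K I wc nonneg pos]; use sub in \<open>simp add: C_def\<close>)+
  let ?H = "homotopic_with (\<lambda>h. \<forall>x\<in>topspace T. support (g x) \<in> L \<longrightarrow> h x \<in> topspace (realization L))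
      T (realization K)"
  have "?H g f1"
  proof (rule homotopic_with_linear_realization[OF K \<open>finite V\<close> g f1])
    fix x assume x: "x \<in> topspace T"
    have eq: "support (g x) \<union> support (f1 x) = support (g x)"
      using supp1[OF x] C[OF x] by auto
    show "support (g x) \<union> support (f1 x) \<subseteq> V" "support (g x) \<union> support (f1 x) \<in> K"
      "support (g x) \<in> L \<Longrightarrow> support (g x) \<union> support (f1 x) \<in> L"
      unfolding eq using gV[OF x] support_in_complex[OF K gK[OF x]] by auto
  qed
  moreover have "?H f1 f2"
  proof (rule homotopic_with_linear_realization[OF K _ f1 f2])
    show "finite (s ` I \<union> \<rho> ` I)" using I by simp
    fix x assume x: "x \<in> topspace T"
    show "support (f1 x) \<union> support (f2 x) \<subseteq> s ` I \<union> \<rho> ` I"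
      unfolding supp1[OF x] supp2[OF x] by (auto simp: C_def)
    show "support (f1 x) \<union> support (f2 x) \<in> K"
      "support (g x) \<in> L \<Longrightarrow> support (f1 x) \<union> support (f2 x) \<in> L"
      unfolding supp1[OF x] supp2[OF x] using C[OF x] by auto
  qed
  ultimately have "?H g f2" by (rule homotopic_with_trans)
  moreover have "f2 x \<in> topspace (realization L)" if x: "x \<in> topspace T" for x
  proof -
    have "f2 x \<in> topspace (realization K)"
      using continuous_map_image_subset_topspace[OF f2] x by blast
    then show ?thesis using supp2[OF x] C[OF x] by (simp add: mem_realization_iff[OF K] mem_realization_iff[OF L])
  qed
  ultimately show ?thesis by blast
qed

section \<open>Vietoris-Rips complexes of metric gluings\<close>

lemma is_complexI:
  assumes "\<And>\<sigma>. \<sigma> \<in> K \<Longrightarrow> finite \<sigma> \<and> \<sigma> \<noteq> {}"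
    and "\<And>\<sigma> \<tau>. \<sigma> \<in> K \<Longrightarrow> \<tau> \<subseteq> \<sigma> \<Longrightarrow> \<tau> \<noteq> {} \<Longrightarrow> \<tau> \<in> K"
  shows "is_complex K"
  unfolding is_complex_def by (intro ballI conjI allI impI; use assms in blast)

lemma is_complex_VR: "is_complex (VR d r B)"
proof (rule is_complexI)
  fix \<sigma> \<tau> assume s: "\<sigma> \<in> VR d r B" "\<tau> \<subseteq> \<sigma>" "\<tau> \<noteq> {}"
  then have "finite \<tau>" by (simp add: VR_def finite_subset)
  then show "\<tau> \<in> VR d r B" using s unfolding VR_def by blast
qed (simp add: VR_def)

lemma is_complex_Un:
  assumes "is_complex K" "is_complex L"
  shows "is_complex (K \<union> L)"
proof (rule is_complexI)
  fix \<sigma> \<tau> assume "\<sigma> \<in> K \<union> L" "\<tau> \<subseteq> \<sigma>" "\<tau> \<noteq> {}"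
  then show "\<tau> \<in> K \<union> L"
    using is_complexD(3)[OF assms(1)] is_complexD(3)[OF assms(2)] by blast
qed (use is_complexD(1,2)[OF assms(1)] is_complexD(1,2)[OF assms(2)] in blast)

locale vr_gluing =
  fixes d :: "'a \<Rightarrow> 'a \<Rightarrow> ennreal" and X Y :: "'a set" and r :: real
  assumes pseudometric: "pseudometric_on (X \<union> Y) d"
    and r_nonneg: "0 \<le> r"
    and finite_A: "finite (X \<inter> Y)"
    and gluing: "metric_gluing d X Y"
    and strong: "strong_simplex_assumption d r X Y"
begin

abbreviation "A \<equiv> X \<inter> Y"
abbreviation "K \<equiv> VR d r (X \<union> Y)"
abbreviation "L \<equiv> VR d r X \<union> VR d r Y"

lemma d_refl: "x \<in> X \<union> Y \<Longrightarrow> d x x = 0"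
  and d_sym: "x \<in> X \<union> Y \<Longrightarrow> y \<in> X \<union> Y \<Longrightarrow> d x y = d y x"
  and d_tri: "x \<in> X \<union> Y \<Longrightarrow> y \<in> X \<union> Y \<Longrightarrow> z \<in> X \<union> Y \<Longrightarrow> d x z \<le> d x y + d y z"
  using pseudometric unfolding pseudometric_on_def by blast+

text \<open>Symmetry of \<open>d\<close> makes the hypotheses symmetric in the two sides, so an
  argument about a single vertex in \<open>X\<close> also serves for a single vertex in
  \<open>Y\<close>.\<close>

lemma swap: "vr_gluing d Y X r"
proof
  show "metric_gluing d Y X"
    unfolding metric_gluing_def
  proof (intro ballI)
    fix y x assume yx: "y \<in> Y - (Y \<inter> X)" "x \<in> X - (Y \<inter> X)"
    then have "d y x = (INF a\<in>X \<inter> Y. d x a + d a y)"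
      using gluing d_sym[of y x] by (auto simp: metric_gluing_def)
    also have "\<dots> = (INF a\<in>Y \<inter> X. d y a + d a x)"
    proof (rule INF_cong)
      fix a assume "a \<in> Y \<inter> X"
      then show "d x a + d a y = d y a + d a x"
        using yx d_sym[of x a] d_sym[of a y] by (simp add: add.commute)
    qed auto
    finally show "d y x = (INF a\<in>Y \<inter> X. d y a + d a x)" .
  qed
  have "VR_P d r Y X = VR_P d r X Y" unfolding VR_P_def by (auto simp: Un_commute)
  then show "strong_simplex_assumption d r Y X"
    using strong by (simp add: strong_simplex_assumption_def Un_commute Int_commute)
qed (use pseudometric r_nonneg finite_A in \<open>simp_all add: Un_commute Int_commute\<close>)

lemma strong_edge:
  assumes xy: "x \<in> X - Y" "y \<in> Y - X" "d x y \<le> ennreal r"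
    and ab: "a \<in> A" "b \<in> A" "d a x \<le> ennreal r" "d x b \<le> ennreal r"
  shows "2 * d a b \<le> d a x + d x b"
proof -
  have "{x, y} \<in> K"
    using xy d_refl[of x] d_refl[of y] d_sym[of x y] by (auto simp: VR_def)
  moreover have "{x, y} \<notin> VR_P d r X Y" using xy by (auto simp: VR_P_def)
  moreover have "x \<noteq> y" using xy by blast
  then have "card {x, y} = 2" by simp
  ultimately show ?thesis using strong ab unfolding strong_simplex_assumption_def by blast
qed

text \<open>The triangle inequality through \<open>x\<close> would only give the bound
  \<open>2 * r\<close>; the factor 2 in the strong simplex assumption halves it. This makes the
  common neighbours of a crossing simplex pairwise adjacent.\<close>

lemma common_neighbours_close:
  assumes "x \<in> X - Y" "y \<in> Y - X" "d x y \<le> ennreal r"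
    and "a \<in> A" "b \<in> A" "d a x \<le> ennreal r" "d b x \<le> ennreal r"
  shows "d a b \<le> ennreal r"
proof -
  have xb: "d x b \<le> ennreal r" using d_sym[of x b] assms by auto
  have "2 * d a b \<le> d a x + d x b" by (rule strong_edge) (use assms xb in auto)
  also have "\<dots> \<le> ennreal r + ennreal r" by (intro add_mono assms xb)
  finally have "2 * d a b \<le> 2 * ennreal r" by (simp add: mult_2)
  then show ?thesis by (simp add: ennreal_mult_le_mult_iff)
qed

text \<open>Gluing gives for each other vertex \<open>y\<close> a point \<open>al y\<close> of
  \<open>A\<close> with \<open>d x (al y) + d (al y) y \<le> r\<close>. Of these points the one
  nearest to \<open>x\<close>, called \<open>a\<close>, works for all \<open>y\<close>: the strong
  assumption on the edge from \<open>x\<close> to \<open>y\<close> yields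
  \<open>d a (al y) \<le> d x (al y)\<close>, so the route from \<open>a\<close> through
  \<open>al y\<close> to \<open>y\<close> is no longer than the one from \<open>x\<close>.\<close>

lemma common_neighbour_one:
  assumes \<sigma>: "\<sigma> \<in> K" "\<sigma> \<inter> A = {}" "\<sigma> \<inter> X = {x}" "\<not> \<sigma> \<subseteq> X"
  shows "\<exists>a\<in>A. \<forall>v\<in>\<sigma>. d a v \<le> ennreal r"
proof -
  have fin: "finite \<sigma>" and sub: "\<sigma> \<subseteq> X \<union> Y"
    and dr: "\<And>u v. u \<in> \<sigma> \<Longrightarrow> v \<in> \<sigma> \<Longrightarrow> d u v \<le> ennreal r" using \<sigma>(1) by (auto simp: VR_def)
  have x: "x \<in> X - Y" "x \<in> \<sigma>" using \<sigma> by auto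
  have y: "y \<in> Y - X" if "y \<in> \<sigma> - {x}" for y using that \<sigma> sub by auto
  have "\<exists>a\<in>A. d x a + d a y \<le> ennreal r" if "y \<in> \<sigma> - {x}" for y
  proof -
    have "x \<in> X - A" "y \<in> Y - A" using x y[OF that] by auto
    then have "d x y = (INF a\<in>A. d x a + d a y)"
      using gluing unfolding metric_gluing_def by blast
    then have "(INF a\<in>A. d x a + d a y) \<le> ennreal r"
      using dr[of x y] x that by simp
    \<comment> \<open>An infimum over the empty set would be infinite. Since \<open>A\<close> is
      nonempty and finite, the infimum is attained, which yields the witness for
      \<open>y\<close>.\<close>
    moreover from this have "A \<noteq> {}" by (auto simp: top_unique)
    moreover have "(INF a\<in>A. d x a + d a y) \<in> (\<lambda>a. d x a + d a y) ` A"
      using finite_A \<open>A \<noteq> {}\<close> Min_Inf[of "(\<lambda>a. d x a + d a y) ` A"] Min_in[of "(\<lambda>a. d x a + d a y) ` A"]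
      by simp
    ultimately show ?thesis by (metis (no_types, lifting) imageE)
  qed
  then obtain al where al: "\<And>y. y \<in> \<sigma> - {x} \<Longrightarrow> al y \<in> A \<and> d x (al y) + d (al y) y \<le> ennreal r"
    by metis
  have al1: "d x (al y) \<le> ennreal r" if "y \<in> \<sigma> - {x}" for y
  proof -
    have "d x (al y) \<le> d x (al y) + d (al y) y" by simp
    then show ?thesis using al[OF that] order_trans by blast
  qed
  have ne: "\<sigma> - {x} \<noteq> {}" using \<sigma> x by auto
  define m where "m = Min ((\<lambda>y. d x (al y)) ` (\<sigma> - {x}))"
  have "m \<in> (\<lambda>y. d x (al y)) ` (\<sigma> - {x})" unfolding m_def using fin ne by (intro Min_in) auto
  then obtain y0 where y0: "y0 \<in> \<sigma> - {x}" "m = d x (al y0)" by auto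
  have min: "d x (al y0) \<le> d x (al y)" if "y \<in> \<sigma> - {x}" for y
    using that fin unfolding y0(2)[symmetric] m_def by (intro Min_le) auto
  define a where "a = al y0"
  have a: "a \<in> A" "d a x \<le> ennreal r" "d a x = d x a"
    using al[OF y0(1)] al1[OF y0(1)] d_sym[of a x] x by (auto simp: a_def)
  have "d a y \<le> ennreal r" if "y \<in> \<sigma> - {x}" for y
  proof -
    have b: "al y \<in> A" using al[OF that] by blast
    have "2 * d a (al y) \<le> d a x + d x (al y)"
      using dr[of x y] x that al1[OF that] a b by (intro strong_edge[OF _ y[OF that]]) auto
    also have "\<dots> \<le> d x (al y) + d x (al y)" using min[OF that] a by (intro add_mono) (auto simp: a_def)
    finally have "d a (al y) \<le> d x (al y)" by (simp add: ennreal_mult_le_mult_iff flip: mult_2)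
    then have "d a (al y) + d (al y) y \<le> d x (al y) + d (al y) y" by (rule add_right_mono)
    also have "\<dots> \<le> ennreal r" using al[OF that] by blast
    finally show ?thesis using d_tri[of a "al y" y] a(1) b y[OF that] order_trans by blast
  qed
  then have "\<forall>v\<in>\<sigma>. d a v \<le> ennreal r" using a(2) by blast
  then show ?thesis using a(1) by blast
qed

text \<open>Within \<open>K\<close> this is the complement of \<open>L\<close>, so it also includes
  the simplices of \<open>VR_P\<close> that meet \<open>A\<close> without lying on one side.
  Supersets of crossing sets are crossing; therefore a flag consists of a lower non-crossing and an
  upper crossing part.\<close>

definition crossing :: "'a set \<Rightarrow> bool" where "crossing \<sigma> \<longleftrightarrow> \<not> \<sigma> \<subseteq> X \<and> \<not> \<sigma> \<subseteq> Y"

lemma in_L_iff: "\<sigma> \<in> K \<Longrightarrow> \<sigma> \<in> L \<longleftrightarrow> \<not> crossing \<sigma>"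
  unfolding VR_def crossing_def by blast

lemma L_subset_K: "L \<subseteq> K" by (auto simp: VR_def)

lemma is_complex_L: "is_complex L" by (intro is_complex_Un is_complex_VR)

text \<open>If the simplex meets \<open>A\<close>, a vertex in \<open>A\<close> is itself within
  \<open>r\<close> of all the others. Otherwise \<open>\<sigma> - Y\<close> is
  \<open>\<sigma> \<inter> X\<close>, and the single-vertex argument applies on one of the two
  sides.\<close>

lemma common_neighbour:
  assumes \<sigma>: "\<sigma> \<in> K" "crossing \<sigma>" and one: "(\<exists>x. \<sigma> - Y = {x}) \<or> (\<exists>y. \<sigma> - X = {y})"
  shows "\<exists>a\<in>A. \<forall>v\<in>\<sigma>. d a v \<le> ennreal r"
proof (cases "\<sigma> \<inter> A = {}")
  case False
  then show ?thesis using \<sigma>(1) by (fastforce simp: VR_def)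
next
  case True
  have sub: "\<sigma> \<subseteq> X \<union> Y" using \<sigma>(1) by (auto simp: VR_def)
  from one show ?thesis
  proof (elim disjE exE)
    fix x assume "\<sigma> - Y = {x}"
    then have "\<sigma> \<inter> X = {x}" using True sub by blast
    then show ?thesis using common_neighbour_one[OF \<sigma>(1) True] \<sigma>(2) by (auto simp: crossing_def)
  next
    interpret s: vr_gluing d Y X r by (rule swap)
    fix y assume "\<sigma> - X = {y}"
    then have "\<sigma> \<inter> Y = {y}" using True sub by blast
    then show ?thesis using s.common_neighbour_one[of \<sigma>] \<sigma> True
      by (auto simp: crossing_def Un_commute Int_commute)
  qed
qed

text \<open>A crossing simplex has a vertex in \<open>X - Y\<close> and one in \<open>Y - X\<close>.
  The edge between them forces its common neighbours in \<open>A\<close> to be within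
  \<open>r\<close> of each other, so any set of them can be adjoined at once.\<close>

lemma crossing_join:
  assumes \<sigma>: "\<sigma> \<in> K" "crossing \<sigma>" and N: "N \<subseteq> {a\<in>A. \<forall>v\<in>\<sigma>. d a v \<le> ennreal r}"
  shows "\<sigma> \<union> N \<in> K"
proof -
  have sub: "\<sigma> \<subseteq> X \<union> Y" and dr: "\<And>u v. u \<in> \<sigma> \<Longrightarrow> v \<in> \<sigma> \<Longrightarrow> d u v \<le> ennreal r"
    using \<sigma>(1) by (auto simp: VR_def)
  then obtain x y where xy: "x \<in> \<sigma>" "x \<in> X - Y" "y \<in> \<sigma>" "y \<in> Y - X"
    using \<sigma>(2) unfolding crossing_def by blast
  have "d a b \<le> ennreal r" if "a \<in> N" "b \<in> N" for a b
  proof (rule common_neighbours_close[OF xy(2,4) dr[OF xy(1,3)]])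
    show "a \<in> A" "b \<in> A" "d a x \<le> ennreal r" "d b x \<le> ennreal r" using that N xy(1) by blast+
  qed
  moreover have "d a v \<le> ennreal r \<and> d v a \<le> ennreal r" if "a \<in> N" "v \<in> \<sigma>" for a v
  proof -
    have "d a v \<le> ennreal r" "a \<in> A" "v \<in> X \<union> Y" using that N sub by auto
    then show ?thesis using d_sym[of a v] by auto
  qed
  ultimately have "\<forall>u\<in>\<sigma> \<union> N. \<forall>v\<in>\<sigma> \<union> N. d u v \<le> ennreal r" using dr by blast
  moreover have "finite (\<sigma> \<union> N)"
  proof -
    have "N \<subseteq> A" using N by blast
    then show ?thesis using \<sigma>(1) finite_subset[OF _ finite_A] by (simp add: VR_def)
  qed
  moreover have "\<sigma> \<union> N \<subseteq> X \<union> Y" "\<sigma> \<union> N \<noteq> {}" using sub N xy by auto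
  ultimately show ?thesis by (simp add: VR_def)
qed

end

section \<open>Contractibility of the obstruction complexes\<close>

lemma contractible_full_simplex:
  assumes "finite N" "N \<noteq> {}"
  shows "contractible (realization {\<mu>. \<mu> \<subseteq> N \<and> \<mu> \<noteq> {}})" (is "contractible (realization ?M)")
proof -
  have M: "is_complex ?M"
    by (rule is_complexI) (use assms finite_subset in blast)+
  obtain n where n: "n \<in> N" using assms by blast
  \<comment> \<open>The vertex \<open>n\<close> as a point of the realization, written as a
    \<open>vertex_map\<close> with one index; segments towards it stay in the full simplex.\<close>
  define p where "p = vertex_map {n} (\<lambda>_. 1) id"
  have p: "support p = {n}" "p \<in> topspace (realization ?M)"
    using support_vertex_map[of "{n}" "\<lambda>_. 1" id] vertex_map_nonneg[of "{n}" "\<lambda>_. 1" id]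
      sum_vertex_map[of "{n}" "\<lambda>_. 1" id] n unfolding p_def mem_realization_iff[OF M] by simp_all
  have "homotopic_with (\<lambda>h. \<forall>x\<in>topspace (realization ?M). True \<longrightarrow> h x \<in> topspace (realization ?M))
      (realization ?M) (realization ?M) id (\<lambda>_. p)"
  proof (rule homotopic_with_linear_realization[OF M \<open>finite N\<close>])
    fix x assume "x \<in> topspace (realization ?M)"
    then have "support x \<in> ?M" by (rule support_in_complex[OF M])
    then show "support (id x) \<union> support p \<subseteq> N" "support (id x) \<union> support p \<in> ?M"
      "support (id x) \<union> support p \<in> ?M" using p n by auto
  qed (use p in \<open>auto simp: id_def\<close>)
  then have "homotopic_with (\<lambda>h. True) (realization ?M) (realization ?M) id (\<lambda>_. p)"
    by (rule homotopic_with_mono) simp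
  then show ?thesis using p(2) unfolding contractible_def contractible_space_def by blast
qed

context vr_gluing
begin

lemma contractible_obstruction:
  assumes \<sigma>: "\<sigma> \<in> K - VR_P d r X Y" and one: "card (\<sigma> \<inter> X) = 1 \<or> card (\<sigma> \<inter> Y) = 1"
  shows "contractible (realization (St K \<sigma> A))"
proof -
  define N where "N = {a\<in>A. \<forall>v\<in>\<sigma>. d a v \<le> ennreal r}"
  have \<sigma>K: "\<sigma> \<in> K" and cr: "crossing \<sigma>" and dis: "\<sigma> \<inter> A = {}"
    using \<sigma> by (auto simp: VR_P_def crossing_def)
  have "\<sigma> \<subseteq> X \<union> Y" using \<sigma>K by (auto simp: VR_def)
  then have "\<sigma> - Y = \<sigma> \<inter> X" "\<sigma> - X = \<sigma> \<inter> Y" using dis by blast+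
  then have "(\<exists>x. \<sigma> - Y = {x}) \<or> (\<exists>y. \<sigma> - X = {y})" using one by (metis card_1_singletonE)
  then have "\<exists>a\<in>A. \<forall>v\<in>\<sigma>. d a v \<le> ennreal r" using common_neighbour[OF \<sigma>K cr] by blast
  then have "N \<noteq> {}" unfolding N_def by blast
  moreover have "finite N" by (rule finite_subset[OF _ finite_A]) (auto simp: N_def)
  moreover have "St K \<sigma> A = {\<mu>. \<mu> \<subseteq> N \<and> \<mu> \<noteq> {}}"
  proof (intro equalityI subsetI)
    fix \<mu> assume "\<mu> \<in> St K \<sigma> A"
    then show "\<mu> \<in> {\<mu>. \<mu> \<subseteq> N \<and> \<mu> \<noteq> {}}" by (auto simp: St_def VR_def N_def)
  next
    fix \<mu> assume \<mu>: "\<mu> \<in> {\<mu>. \<mu> \<subseteq> N \<and> \<mu> \<noteq> {}}"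
    then have "\<sigma> \<union> \<mu> \<in> K" by (intro crossing_join[OF \<sigma>K cr]) (auto simp: N_def)
    moreover have "\<mu> \<subseteq> A" using \<mu> by (auto simp: N_def)
    ultimately show "\<mu> \<in> St K \<sigma> A"
      using \<mu> finite_subset[OF _ finite_A] by (simp add: St_def Un_commute)
  qed
  ultimately show ?thesis using contractible_full_simplex[of N] by simp
qed

text \<open>If \<open>\<sigma>\<close> is small, one of \<open>\<sigma> - X\<close> and \<open>\<sigma> - Y\<close> is a singleton, and its element lies in all
  crossing faces.\<close>

definition pivot :: "'a set \<Rightarrow> 'a" where
  "pivot \<sigma> = (SOME v. v \<in> \<sigma> \<and> (\<forall>\<tau>. \<tau> \<subseteq> \<sigma> \<and> crossing \<tau> \<longrightarrow> v \<in> \<tau>))"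

text \<open>The target of the barycentre of \<open>\<sigma>\<close>: a common neighbour in
  \<open>A\<close> if \<open>\<sigma>\<close> is crossing, and the pivot otherwise. On faces of a
  simplex of \<open>L\<close> it agrees with \<open>pivot\<close>, so the move from pivots to gates
  is stationary there.\<close>

definition gate :: "'a set \<Rightarrow> 'a" where
  "gate \<sigma> = (if crossing \<sigma> then (SOME a. a \<in> A \<and> (\<forall>v\<in>\<sigma>. d a v \<le> ennreal r)) else pivot \<sigma>)"

text \<open>The parts outside \<open>X\<close> and outside \<open>Y\<close> are disjoint and
  nonempty, so three vertices do not suffice for both to have two elements. This is where the bound
  three enters.\<close>

lemma small_crossing:
  assumes "\<sigma> \<in> K" "card \<sigma> \<le> 3" "crossing \<sigma>"
  shows "(\<exists>x. \<sigma> - Y = {x}) \<or> (\<exists>y. \<sigma> - X = {y})"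
proof -
  have fin: "finite \<sigma>" and sub: "\<sigma> \<subseteq> X \<union> Y" using assms(1) by (auto simp: VR_def)
  have "card ((\<sigma> - Y) \<union> (\<sigma> - X)) \<le> card \<sigma>" using fin by (intro card_mono) auto
  moreover have "card ((\<sigma> - Y) \<union> (\<sigma> - X)) = card (\<sigma> - Y) + card (\<sigma> - X)"
    using fin sub by (intro card_Un_disjoint) auto
  moreover have "card (\<sigma> - Y) \<noteq> 0" "card (\<sigma> - X) \<noteq> 0"
    using assms(3) fin by (auto simp: crossing_def)
  ultimately have "card (\<sigma> - Y) = 1 \<or> card (\<sigma> - X) = 1" using assms(2) by linarith
  then show ?thesis by (metis card_1_singletonE)
qed

lemma pivot:
  assumes "\<sigma> \<in> K" "card \<sigma> \<le> 3"
  shows "pivot \<sigma> \<in> \<sigma> \<and> (\<forall>\<tau>. \<tau> \<subseteq> \<sigma> \<and> crossing \<tau> \<longrightarrow> pivot \<sigma> \<in> \<tau>)"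
proof -
  have "\<exists>v. v \<in> \<sigma> \<and> (\<forall>\<tau>. \<tau> \<subseteq> \<sigma> \<and> crossing \<tau> \<longrightarrow> v \<in> \<tau>)"
  proof (cases "crossing \<sigma>")
    case True
    then have "(\<exists>x. \<sigma> - Y = {x}) \<or> (\<exists>y. \<sigma> - X = {y})" by (rule small_crossing[OF assms])
    then show ?thesis
    proof (elim disjE exE)
      fix x assume x: "\<sigma> - Y = {x}"
      have "x \<in> \<tau>" if "\<tau> \<subseteq> \<sigma>" "crossing \<tau>" for \<tau>
      proof -
        obtain z where "z \<in> \<tau>" "z \<notin> Y" using \<open>crossing \<tau>\<close> unfolding crossing_def by blast
        then have "z \<in> \<sigma> - Y" using that(1) by blast
        then show ?thesis using x \<open>z \<in> \<tau>\<close> by simp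
      qed
      moreover have "x \<in> \<sigma>" using x by blast
      ultimately show ?thesis by blast
    next
      fix y assume y: "\<sigma> - X = {y}"
      have "y \<in> \<tau>" if "\<tau> \<subseteq> \<sigma>" "crossing \<tau>" for \<tau>
      proof -
        obtain z where "z \<in> \<tau>" "z \<notin> X" using \<open>crossing \<tau>\<close> unfolding crossing_def by blast
        then have "z \<in> \<sigma> - X" using that(1) by blast
        then show ?thesis using y \<open>z \<in> \<tau>\<close> by simp
      qed
      moreover have "y \<in> \<sigma>" using y by blast
      ultimately show ?thesis by blast
    qed
  next
    case False
    then have "\<not> crossing \<tau>" if "\<tau> \<subseteq> \<sigma>" for \<tau> using that unfolding crossing_def by (meson order_trans)
    moreover obtain v where "v \<in> \<sigma>" using is_complexD(2)[OF is_complex_VR assms(1)] by blast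
    ultimately show ?thesis by blast
  qed
  then show ?thesis unfolding pivot_def by (rule someI_ex)
qed

lemma gate_crossing:
  assumes "\<sigma> \<in> K" "card \<sigma> \<le> 3" "crossing \<sigma>"
  shows "gate \<sigma> \<in> A \<and> (\<forall>v\<in>\<sigma>. d (gate \<sigma>) v \<le> ennreal r)"
proof -
  have "\<exists>a. a \<in> A \<and> (\<forall>v\<in>\<sigma>. d a v \<le> ennreal r)"
    using common_neighbour[OF assms(1,3) small_crossing[OF assms]] by blast
  then have "(SOME a. a \<in> A \<and> (\<forall>v\<in>\<sigma>. d a v \<le> ennreal r)) \<in> A \<and>
      (\<forall>v\<in>\<sigma>. d (SOME a. a \<in> A \<and> (\<forall>v\<in>\<sigma>. d a v \<le> ennreal r)) v \<le> ennreal r)"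
    by (rule someI_ex)
  then show ?thesis using assms(3) by (simp add: gate_def)
qed

text \<open>The gates of non-crossing members are pivots and lie in the largest such member, hence
  on one side; all other gates lie in \<open>A\<close>, which belongs to both sides. So the gates
  span a simplex of \<open>L\<close>. For the union with the pivots let \<open>m\<close> be the
  smallest crossing member. It contains every pivot: a non-crossing member is a subset of
  \<open>m\<close>, and the pivot of a crossing member lies in its crossing face \<open>m\<close>.
  The gates of crossing members are close to all of \<open>m\<close>, because these members contain
  \<open>m\<close>, so \<open>crossing_join\<close> applies to \<open>m\<close>.\<close>

lemma flag_pivot_gate:
  assumes \<sigma>: "\<sigma> \<in> K" "card \<sigma> \<le> 3" and \<C>: "\<C> \<noteq> {}" "\<C> \<subseteq> Pow \<sigma> - {{}}"
    and chain: "\<And>\<alpha> \<beta>. \<alpha> \<in> \<C> \<Longrightarrow> \<beta> \<in> \<C> \<Longrightarrow> \<alpha> \<subseteq> \<beta> \<or> \<beta> \<subseteq> \<alpha>"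
  shows "pivot ` \<C> \<subseteq> \<sigma> \<and> pivot ` \<C> \<union> gate ` \<C> \<in> K \<and> gate ` \<C> \<in> L \<and>
    (\<sigma> \<in> L \<longrightarrow> pivot ` \<C> \<union> gate ` \<C> \<in> L)"
proof -
  have fin\<sigma>: "finite \<sigma>" using is_complexD(1)[OF is_complex_VR \<sigma>(1)] .
  have fin: "finite \<C>" using fin\<sigma> \<C>(2) by (meson Diff_subset finite_Pow_iff finite_subset)
  have face: "\<tau> \<subseteq> \<sigma> \<and> \<tau> \<in> K \<and> card \<tau> \<le> 3" if "\<tau> \<in> \<C>" for \<tau>
  proof -
    have "\<tau> \<subseteq> \<sigma>" "\<tau> \<noteq> {}" using that \<C> by auto
    then have "\<tau> \<in> K" by (rule is_complexD(3)[OF is_complex_VR \<sigma>(1)])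
    moreover have "card \<tau> \<le> card \<sigma>" by (rule card_mono[OF fin\<sigma> \<open>\<tau> \<subseteq> \<sigma>\<close>])
    ultimately show ?thesis using \<open>\<tau> \<subseteq> \<sigma>\<close> \<sigma>(2) by linarith
  qed
  have piv: "pivot \<tau> \<in> \<tau>" if "\<tau> \<in> \<C>" for \<tau> using pivot face[OF that] by blast
  have sub: "pivot ` \<C> \<subseteq> \<sigma>" using piv face by blast
  define N where "N = gate ` {\<tau>\<in>\<C>. crossing \<tau>}"
  define P where "P = pivot ` {\<tau>\<in>\<C>. \<not> crossing \<tau>}"
  have NA: "N \<subseteq> A" using gate_crossing face unfolding N_def by blast
  have gate_eq: "gate ` \<C> = P \<union> N" unfolding P_def N_def by (auto simp: gate_def)
  have PL: "P \<subseteq> X \<or> P \<subseteq> Y"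
  proof (cases "{\<tau>\<in>\<C>. \<not> crossing \<tau>} = {}")
    case True
    then show ?thesis unfolding P_def True by simp
  next
    case False
    have "finite {\<tau>\<in>\<C>. \<not> crossing \<tau>}" using fin by simp
    from finite_has_maximal[OF this False] obtain M
      where M: "M \<in> \<C>" "\<not> crossing M" "\<And>\<tau>. \<tau> \<in> \<C> \<Longrightarrow> \<not> crossing \<tau> \<Longrightarrow> M \<subseteq> \<tau> \<Longrightarrow> M = \<tau>" by blast
    have "\<tau> \<subseteq> M" if "\<tau> \<in> \<C>" "\<not> crossing \<tau>" for \<tau>
      using chain[OF that(1) M(1)] M(3)[OF that] by blast
    then have "P \<subseteq> M" using piv unfolding P_def by blast
    then show ?thesis using M(2) unfolding crossing_def by blast
  qed
  have all: "pivot ` \<C> \<union> gate ` \<C> \<in> K"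
  proof (cases "{\<tau>\<in>\<C>. crossing \<tau>} = {}")
    case True
    then have "gate ` \<C> = pivot ` \<C>" by (auto simp: gate_def)
    then show ?thesis using is_complexD(3)[OF is_complex_VR \<sigma>(1) sub] \<C>(1) by simp
  next
    case False
    have "finite {\<tau>\<in>\<C>. crossing \<tau>}" using fin by simp
    from finite_has_minimal[OF this False] obtain m
      where m: "m \<in> \<C>" "crossing m" "\<And>\<tau>. \<tau> \<in> \<C> \<Longrightarrow> crossing \<tau> \<Longrightarrow> \<tau> \<subseteq> m \<Longrightarrow> m = \<tau>" by blast
    have below: "m \<subseteq> \<tau>" if "\<tau> \<in> \<C>" "crossing \<tau>" for \<tau>
      using chain[OF that(1) m(1)] m(3)[OF that] by blast
    have above: "\<tau> \<subseteq> m" if "\<tau> \<in> \<C>" "\<not> crossing \<tau>" for \<tau>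
      using chain[OF that(1) m(1)] m(2) that(2) unfolding crossing_def by blast
    have "pivot ` \<C> \<subseteq> m"
    proof
      fix v assume "v \<in> pivot ` \<C>"
      then obtain \<tau> where \<tau>: "\<tau> \<in> \<C>" "v = pivot \<tau>" by blast
      show "v \<in> m"
      proof (cases "crossing \<tau>")
        case True
        then show ?thesis using pivot[of \<tau>] face[OF \<tau>(1)] below[OF \<tau>(1)] m(2) \<tau>(2) by blast
      next
        case False
        then show ?thesis using piv[OF \<tau>(1)] above[OF \<tau>(1)] \<tau>(2) by blast
      qed
    qed
    moreover have "P \<subseteq> pivot ` \<C>" unfolding P_def by blast
    ultimately have le: "pivot ` \<C> \<union> gate ` \<C> \<subseteq> m \<union> N" unfolding gate_eq by blast
    have "N \<subseteq> {a\<in>A. \<forall>v\<in>m. d a v \<le> ennreal r}"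
    proof
      fix a assume "a \<in> N"
      then obtain \<tau> where \<tau>: "\<tau> \<in> \<C>" "crossing \<tau>" "a = gate \<tau>" unfolding N_def by blast
      then show "a \<in> {a\<in>A. \<forall>v\<in>m. d a v \<le> ennreal r}"
        using gate_crossing[of \<tau>] face[OF \<tau>(1)] below[OF \<tau>(1,2)] by blast
    qed
    then have "m \<union> N \<in> K" using crossing_join face[OF m(1)] m(2) by blast
    from is_complexD(3)[OF is_complex_VR this le] show ?thesis using \<C>(1) by simp
  qed
  have "gate ` \<C> \<in> K" using is_complexD(3)[OF is_complex_VR all, of "gate ` \<C>"] \<C>(1) by simp
  moreover have "\<not> crossing (gate ` \<C>)" using PL NA unfolding gate_eq crossing_def by blast
  ultimately have "gate ` \<C> \<in> L" using in_L_iff by blast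
  moreover have "pivot ` \<C> \<union> gate ` \<C> \<in> L" if "\<sigma> \<in> L"
  proof -
    have "\<not> crossing \<sigma>" using that in_L_iff[OF \<sigma>(1)] by blast
    then have "\<not> crossing \<tau>" if "\<tau> \<in> \<C>" for \<tau> using face[OF that] unfolding crossing_def by blast
    then have "gate ` \<C> = pivot ` \<C>" by (auto simp: gate_def)
    then show ?thesis using is_complexD(3)[OF is_complex_L that sub] \<C>(1) by simp
  qed
  ultimately show ?thesis using sub all by blast
qed

text \<open>Two homotopies are concatenated, one inside the carriers of \<open>f\<close> and one
  along flags. Both are controlled by supports, while the predicate here speaks of points;
  \<open>fL\<close> translates. A point over \<open>L\<close> keeps its carrier in \<open>L\<close>
  after the first homotopy because faces of simplices of \<open>L\<close> are in \<open>L\<close>,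
  so the second one respects it as well.\<close>

lemma planar_deformation:
  fixes T :: "complex set"
  assumes "compact T" and f: "continuous_map (top_of_set T) (realization K) f"
  shows "\<exists>g. homotopic_with (\<lambda>h. \<forall>x\<in>T. f x \<in> topspace (realization L) \<longrightarrow> h x \<in> topspace (realization L))
      (top_of_set T) (realization K) f g \<and> g ` T \<subseteq> topspace (realization L)"
proof -
  note K = is_complex_VR[of d r "X \<union> Y"]
  define V where "V = (\<Union>x\<in>T. support (f x))"
  have V: "finite V" unfolding V_def by (rule compact_map_finite_support[OF K assms])
  obtain g where g: "continuous_map (top_of_set T) (realization K) g"
    and g_sub: "\<And>x. x \<in> T \<Longrightarrow> support (g x) \<subseteq> support (f x) \<and> card (support (g x)) \<le> 3"
    using map_into_2_skeleton[OF K assms] by blast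
  have fK: "f x \<in> topspace (realization K)" and gK: "g x \<in> topspace (realization K)" if "x \<in> T" for x
    using continuous_map_image_subset_topspace[OF f] continuous_map_image_subset_topspace[OF g] that by auto
  have fL: "f x \<in> topspace (realization L) \<longleftrightarrow> support (f x) \<in> L" if "x \<in> T" for x
    using fK[OF that] by (simp only: mem_realization_iff[OF K] mem_realization_iff[OF is_complex_L]) blast
  have gL: "support (g x) \<in> L" if "x \<in> T" "support (f x) \<in> L" for x
    using is_complexD(3)[OF is_complex_L that(2)] g_sub[OF that(1)]
      is_complexD(2)[OF K support_in_complex[OF K gK[OF that(1)]]] by blast
  let ?H = "homotopic_with (\<lambda>h. \<forall>x\<in>T. f x \<in> topspace (realization L) \<longrightarrow> h x \<in> topspace (realization L))
      (top_of_set T) (realization K)"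
  have "homotopic_with (\<lambda>h. \<forall>x\<in>topspace (top_of_set T). support (f x) \<in> L \<longrightarrow> h x \<in> topspace (realization L))
      (top_of_set T) (realization K) f g"
  proof (rule homotopic_with_linear_realization[OF K V f g])
    fix x assume "x \<in> topspace (top_of_set T)"
    then have x: "x \<in> T" by simp
    have eq: "support (f x) \<union> support (g x) = support (f x)" using g_sub[OF x] by blast
    show "support (f x) \<union> support (g x) \<subseteq> V" "support (f x) \<union> support (g x) \<in> K"
      "support (f x) \<in> L \<Longrightarrow> support (f x) \<union> support (g x) \<in> L"
      unfolding eq using x support_in_complex[OF K fK[OF x]] by (auto simp: V_def)
  qed
  then have 1: "?H f g" by (rule homotopic_with_mono) (metis fL topspace_euclidean_subtopology)
  have "\<exists>k. homotopic_with (\<lambda>h. \<forall>x\<in>topspace (top_of_set T). support (g x) \<in> L \<longrightarrow> h x \<in> topspace (realization L))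
      (top_of_set T) (realization K) g k \<and> k ` topspace (top_of_set T) \<subseteq> topspace (realization L)"
  \<comment> \<open>The admissible carriers are limited to three vertices, the range in which
    \<open>flag_pivot_gate\<close> is available.\<close>
  proof (rule deform_along_flags[OF K is_complex_L V g, of "{\<sigma>\<in>K. card \<sigma> \<le> 3}" pivot gate])
    fix x assume "x \<in> topspace (top_of_set T)"
    then show "support (g x) \<subseteq> V \<and> support (g x) \<in> {\<sigma>\<in>K. card \<sigma> \<le> 3}"
      using g_sub[of x] support_in_complex[OF K gK[of x]] by (auto simp: V_def)
  next
    fix \<sigma> \<C> assume "\<sigma> \<in> {\<sigma>\<in>K. card \<sigma> \<le> 3}" "\<C> \<noteq> {}" "\<C> \<subseteq> Pow \<sigma> - {{}}"
      "\<And>\<alpha> \<beta>. \<alpha> \<in> \<C> \<Longrightarrow> \<beta> \<in> \<C> \<Longrightarrow> \<alpha> \<subseteq> \<beta> \<or> \<beta> \<subseteq> \<alpha>"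
    then show "pivot ` \<C> \<subseteq> \<sigma> \<and> pivot ` \<C> \<union> gate ` \<C> \<in> K \<and> gate ` \<C> \<in> L \<and>
        (\<sigma> \<in> L \<longrightarrow> pivot ` \<C> \<union> gate ` \<C> \<in> L)"
      using flag_pivot_gate[of \<sigma> \<C>] by blast
  qed
  then obtain k where k: "homotopic_with (\<lambda>h. \<forall>x\<in>topspace (top_of_set T). support (g x) \<in> L \<longrightarrow> h x \<in> topspace (realization L))
      (top_of_set T) (realization K) g k" "k ` T \<subseteq> topspace (realization L)" by auto
  from k(1) have "?H g k" by (rule homotopic_with_mono) (metis fL gL topspace_euclidean_subtopology)
  then have "?H f k" by (rule homotopic_with_trans[OF 1])
  then show ?thesis using k(2) by blast
qed

end

section \<open>Homotopies on cells, and their descent along quotient maps\<close>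

lemma continuous_map_compose_on:
  assumes "continuous_map (top_of_set B) Z k" "continuous_on C \<phi>" "\<And>x. x \<in> C \<Longrightarrow> \<phi> x \<in> B"
  shows "continuous_map (top_of_set C) Z (\<lambda>x. k (\<phi> x))"
proof -
  have "continuous_map (top_of_set C) (top_of_set B) \<phi>"
    using assms(2,3) by (auto simp: continuous_map_in_subtopology)
  from continuous_map_compose[OF this assms(1)] show ?thesis by (simp add: o_def)
qed

lemma homotopic_with_top_of_setE:
  assumes "homotopic_with P (top_of_set D) Z f g"
  obtains k where "continuous_map (top_of_set ({0..1::real} \<times> D)) Z k"
    "\<And>x. k (0, x) = f x" "\<And>x. k (1, x) = g x" "\<And>t. t \<in> {0..1} \<Longrightarrow> P (\<lambda>x. k (t, x))"
proof -
  from assms obtain k where k: "continuous_map (top_of_set ({0..1::real} \<times> D)) Z k"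
    "\<forall>x. k (0, x) = f x" "\<forall>x. k (1, x) = g x" "\<forall>t\<in>{0..1}. P (\<lambda>x. k (t, x))"
    unfolding homotopic_with_def prod_topology_subtopology_eu by (elim exE conjE)
  show ?thesis by (rule that[OF k(1)]) (use k in \<open>simp_all\<close>)
qed

text \<open>The endpoints of \<open>k\<close> are prescribed over \<open>D\<close> only, so the last
  assumption asks that \<open>P\<close> depend only on values over \<open>D\<close>.\<close>

lemma homotopic_with_top_of_setI:
  assumes "continuous_map (top_of_set ({0..1::real} \<times> D)) Z k"
    and "\<And>x. x \<in> D \<Longrightarrow> k (0, x) = f x" "\<And>x. x \<in> D \<Longrightarrow> k (1, x) = g x"
    and "\<And>t. t \<in> {0..1} \<Longrightarrow> P (\<lambda>x. k (t, x))"
    and "\<And>h h'. (\<And>x. x \<in> D \<Longrightarrow> h x = h' x) \<Longrightarrow> P h \<longleftrightarrow> P h'"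
  shows "homotopic_with P (top_of_set D) Z f g"
proof -
  have "\<exists>h. continuous_map (prod_topology (top_of_set {0..1::real}) (top_of_set D)) Z h \<and>
      (\<forall>x\<in>topspace (top_of_set D). h (0, x) = f x) \<and> (\<forall>x\<in>topspace (top_of_set D). h (1, x) = g x) \<and>
      (\<forall>t\<in>{0..1}. P (\<lambda>x. h (t, x)))"
    using assms(1-4) by (intro exI[of _ k]) simp
  moreover have "P h \<longleftrightarrow> P h'" if "\<And>x. x \<in> topspace (top_of_set D) \<Longrightarrow> h x = h' x" for h h'
    using assms(5)[of h h'] that by simp
  ultimately show ?thesis using homotopic_with[of "top_of_set D" P Z f g] by blast
qed

text \<open>The homotopy is slowed down over the collar \<open>1/2 \<le> N w \<le> 1\<close> so that it becomes constant on
  the boundary \<open>N w = 1\<close>, at the cost of inserting the track of the boundary.\<close>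

lemma compression:
  fixes N :: "'e::real_normed_vector \<Rightarrow> real"
  assumes contN: "continuous_on UNIV N" and N0: "\<And>w. 0 \<le> N w"
    and Nscale: "\<And>c w. 0 \<le> c \<Longrightarrow> N (c *\<^sub>R w) = c * N w"
    and hom: "homotopic_with (\<lambda>h. \<forall>w\<in>{w. N w \<le> 1}. f w \<in> S \<longrightarrow> h w \<in> S) (top_of_set {w. N w \<le> 1}) Z f g"
    and g: "g ` {w. N w \<le> 1} \<subseteq> S" and bd: "\<And>w. N w = 1 \<Longrightarrow> f w \<in> S"
  shows "\<exists>g'. homotopic_with (\<lambda>h. \<forall>w\<in>{w. N w \<le> 1}. N w = 1 \<longrightarrow> h w = f w) (top_of_set {w. N w \<le> 1}) Z f g'
    \<and> g' ` {w. N w \<le> 1} \<subseteq> S"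
proof -
  define D where "D = {w. N w \<le> 1}"
  obtain k where k: "continuous_map (top_of_set ({0..1::real} \<times> D)) Z k"
      and k0: "\<And>x. k (0, x) = f x" and k1: "\<And>x. k (1, x) = g x"
      and kS: "\<And>t x. t \<in> {0..1} \<Longrightarrow> x \<in> D \<Longrightarrow> f x \<in> S \<Longrightarrow> k (t, x) \<in> S"
  proof (rule homotopic_with_top_of_setE[OF hom[folded D_def]])
    fix k assume "continuous_map (top_of_set ({0..1::real} \<times> D)) Z k" "\<And>w. k (0, w) = f w"
      "\<And>w. k (1, w) = g w" "\<And>t. t \<in> {0..1} \<Longrightarrow> \<forall>w\<in>D. f w \<in> S \<longrightarrow> k (t, w) \<in> S"
    then show thesis by (intro that[of k]) blast+
  qed
  have f: "continuous_map (top_of_set D) Z f"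
    using homotopic_with_imp_continuous_maps[OF hom] by (simp add: D_def)
  \<comment> \<open>The scaling doubles the inner half \<open>N w \<le> 1/2\<close> onto all of
    \<open>D\<close> and pushes the collar radially to \<open>N w = 1\<close>. Over the collar,
    \<open>\<delta>\<close> rises from 0 to 1.\<close>
  define sc where "sc w = 2 / max 1 (2 * N w)" for w
  define \<delta> where "\<delta> w = max 0 (2 * N w - 1)" for w
  have contN': "continuous_on C (\<lambda>x. N (\<phi> x))" if "continuous_on C \<phi>" for C :: "'x::topological_space set" and \<phi>
    using continuous_on_compose2[OF contN that] by simp
  have contsc: "continuous_on C (\<lambda>x. sc (\<phi> x))" if "continuous_on C \<phi>" for C :: "'x::topological_space set" and \<phi>
    unfolding sc_def by (intro continuous_intros contN' that) auto
  have cont\<delta>: "continuous_on C (\<lambda>x. \<delta> (\<phi> x))" if "continuous_on C \<phi>" for C :: "'x::topological_space set" and \<phi>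
    unfolding \<delta>_def by (intro continuous_intros contN' that)
  have sc: "0 \<le> sc w" "sc w * N w \<le> 1" for w
    unfolding sc_def using N0[of w] by (auto simp: field_simps max_def)
  have sc1: "sc w = 1" if "N w = 1" for w using that by (simp add: sc_def)
  have scbd: "sc w * N w = 1" if "1 / 2 \<le> N w" for w
    using that by (auto simp: sc_def max_def field_simps)
  have scD: "sc w *\<^sub>R w \<in> D" for w using sc[of w] by (simp add: D_def Nscale)
  have \<delta>: "\<delta> w \<in> {0..1}" if "w \<in> D" for w using that N0[of w] by (auto simp: \<delta>_def D_def)
  let ?P = "\<lambda>h. \<forall>w\<in>D. N w = 1 \<longrightarrow> h w = f w"
  have cong: "?P h \<longleftrightarrow> ?P h'" if "\<And>x. x \<in> D \<Longrightarrow> h x = h' x" for h h' using that by auto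
  have 1: "homotopic_with ?P (top_of_set D) Z f (\<lambda>w. f (sc w *\<^sub>R w))"
  proof (rule homotopic_with_top_of_setI[OF _ _ _ _ cong])
    show "continuous_map (top_of_set ({0..1::real} \<times> D)) Z
        (\<lambda>z. f (((1 - fst z) + fst z * sc (snd z)) *\<^sub>R snd z))"
    proof (rule continuous_map_compose_on[OF f])
      show "continuous_on ({0..1::real} \<times> D) (\<lambda>z. ((1 - fst z) + fst z * sc (snd z)) *\<^sub>R snd z)"
        by (intro continuous_intros contsc)
      fix z assume "z \<in> {0..1::real} \<times> D"
      then obtain t w where z: "z = (t, w)" "0 \<le> t" "t \<le> 1" "N w \<le> 1" by (auto simp: D_def)
      have "((1 - t) + t * sc w) * N w = (1 - t) * N w + t * (sc w * N w)" by (simp add: algebra_simps)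
      also have "\<dots> \<le> (1 - t) * 1 + t * 1" using z sc[of w] by (intro add_mono mult_left_mono) auto
      finally have "((1 - t) + t * sc w) * N w \<le> 1" by simp
      moreover have "0 \<le> (1 - t) + t * sc w" using z sc[of w] by simp
      ultimately show "((1 - fst z) + fst z * sc (snd z)) *\<^sub>R snd z \<in> D"
        using z(1) by (simp add: D_def Nscale)
    qed
  qed (auto simp: sc1)
  have 2: "homotopic_with ?P (top_of_set D) Z (\<lambda>w. f (sc w *\<^sub>R w)) (\<lambda>w. k (1 - \<delta> w, sc w *\<^sub>R w))"
  proof (rule homotopic_with_top_of_setI[OF _ _ _ _ cong])
    show "continuous_map (top_of_set ({0..1::real} \<times> D)) Z
        (\<lambda>z. k (fst z * (1 - \<delta> (snd z)), sc (snd z) *\<^sub>R snd z))"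
    proof (rule continuous_map_compose_on[OF k])
      show "continuous_on ({0..1::real} \<times> D) (\<lambda>z. (fst z * (1 - \<delta> (snd z)), sc (snd z) *\<^sub>R snd z))"
        by (intro continuous_intros contsc cont\<delta>)
      fix z assume "z \<in> {0..1::real} \<times> D"
      then show "(fst z * (1 - \<delta> (snd z)), sc (snd z) *\<^sub>R snd z) \<in> {0..1} \<times> D"
        using \<delta>[of "snd z"] scD by (auto intro: mult_le_one)
    qed
  qed (auto simp: sc1 k0 \<delta>_def)
  \<comment> \<open>On the inner half \<open>k\<close> has been run to its end, so this is a value
    of \<open>g\<close>. Over the collar the argument has been moved to the boundary, where
    \<open>f\<close> lies in \<open>S\<close> and \<open>k\<close> keeps it there.\<close>
  have "k (1 - \<delta> w, sc w *\<^sub>R w) \<in> S" if w: "w \<in> D" for w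
  proof (cases "N w \<le> 1 / 2")
    case True
    then have "\<delta> w = 0" by (simp add: \<delta>_def)
    then show ?thesis using g scD[of w] by (auto simp: k1 D_def)
  next
    case False
    then have "N (sc w *\<^sub>R w) = 1" using scbd[of w] sc[of w] by (simp add: Nscale)
    then show ?thesis using bd \<delta>[OF w] by (intro kS scD) auto
  qed
  then show ?thesis
    using homotopic_with_trans[OF 1 2] unfolding D_def by blast
qed

text \<open>A continuous map from a compact space onto a Hausdorff space is closed, hence a quotient
  map. Applied to the product of \<open>q\<close> with the identity of the interval, this lets a
  homotopy that respects the fibres of \<open>q\<close> descend.\<close>

lemma quotient_homotopy:
  fixes q :: "'e::euclidean_space \<Rightarrow> 's::euclidean_space"
  assumes "compact D" and q: "continuous_on D q" "q ` D = Q"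
    and H: "continuous_map (top_of_set ({0..1::real} \<times> D)) Z H"
    and compat: "\<And>t w w'. t \<in> {0..1} \<Longrightarrow> w \<in> D \<Longrightarrow> w' \<in> D \<Longrightarrow> q w = q w' \<Longrightarrow> H (t, w) = H (t, w')"
  shows "\<exists>H'. continuous_map (top_of_set ({0..1::real} \<times> Q)) Z H' \<and>
     (\<forall>t\<in>{0..1}. \<forall>w\<in>D. H' (t, q w) = H (t, w))"
proof -
  let ?j = "\<lambda>z::real \<times> 'e. (fst z, q (snd z))"
  have j: "continuous_on ({0..1::real} \<times> D) ?j"
    by (intro continuous_intros continuous_on_compose2[OF q(1)]) auto
  have im: "?j ` ({0..1::real} \<times> D) = {0..1} \<times> Q" using q(2) by force
  have "quotient_map (top_of_set ({0..1::real} \<times> D)) (top_of_set ({0..1::real} \<times> Q)) ?j"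
  proof (rule continuous_closed_imp_quotient_map)
    show "continuous_map (top_of_set ({0..1::real} \<times> D)) (top_of_set ({0..1::real} \<times> Q)) ?j"
      using j im by (auto simp: continuous_map_in_subtopology)
    show "closed_map (top_of_set ({0..1::real} \<times> D)) (top_of_set ({0..1::real} \<times> Q)) ?j"
    proof (rule continuous_imp_closed_map)
      show "continuous_map (top_of_set ({0..1::real} \<times> D)) (top_of_set ({0..1::real} \<times> Q)) ?j"
        using j im by (auto simp: continuous_map_in_subtopology)
      show "compact_space (top_of_set ({0..1::real} \<times> D))"
        using \<open>compact D\<close> by (simp add: compact_space_subtopology compact_Times)
    qed (simp add: Hausdorff_space_subtopology)
  qed (use im in simp)
  from quotient_map_lift_exists[OF this H]
  obtain H' where "continuous_map (top_of_set ({0..1::real} \<times> Q)) Z H'"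
      "\<And>z. z \<in> {0..1} \<times> D \<Longrightarrow> H' (?j z) = H z"
    using compat by (metis (no_types, lifting) mem_Sigma_iff prod.collapse prod.inject topspace_euclidean_subtopology)
  then show ?thesis by (intro exI[of _ H']) force
qed

text \<open>Since \<open>q\<close> identifies points only within \<open>B\<close>, a homotopy that
  is constantly \<open>x\<close> on \<open>B\<close> is compatible with \<open>q\<close>, and it
  descends to a pointed homotopy.\<close>

lemma quotient_homotopic_with:
  fixes q :: "'e::euclidean_space \<Rightarrow> 's::euclidean_space"
  assumes "compact D" and q: "continuous_on D q" "q ` D = Q"
    and inj: "\<And>w w'. w \<in> D \<Longrightarrow> w' \<in> D \<Longrightarrow> q w = q w' \<Longrightarrow> w = w' \<or> (w \<in> B \<and> w' \<in> B)"
    and B: "B \<subseteq> D" "B \<noteq> {}" "\<And>w. w \<in> B \<Longrightarrow> q w = s0"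
    and g: "g s0 = x"
    and hom: "homotopic_with (\<lambda>h. \<forall>w\<in>D. w \<in> B \<longrightarrow> h w = x) (top_of_set D) Z (g \<circ> q) f"
  shows "\<exists>g'. homotopic_with (\<lambda>k. k s0 = x) (top_of_set Q) Z g g' \<and> (\<forall>w\<in>D. g' (q w) = f w)"
proof -
  obtain H where H: "continuous_map (top_of_set ({0..1::real} \<times> D)) Z H"
      and H0: "\<And>w. H (0, w) = g (q w)" and H1: "\<And>w. H (1, w) = f w"
      and HB: "\<And>t w. t \<in> {0..1} \<Longrightarrow> w \<in> B \<Longrightarrow> H (t, w) = x"
  proof (rule homotopic_with_top_of_setE[OF hom])
    fix H assume "continuous_map (top_of_set ({0..1::real} \<times> D)) Z H" "\<And>w. H (0, w) = (g \<circ> q) w"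
      "\<And>w. H (1, w) = f w" "\<And>t. t \<in> {0..1} \<Longrightarrow> \<forall>w\<in>D. w \<in> B \<longrightarrow> H (t, w) = x"
    then show thesis using B(1) by (intro that[of H]) auto
  qed
  have "H (t, w) = H (t, w')" if "t \<in> {0..1}" "w \<in> D" "w' \<in> D" "q w = q w'" for t w w'
    using inj[OF that(2-4)] HB[OF that(1)] by auto
  from quotient_homotopy[OF \<open>compact D\<close> q H this]
  obtain H' where H': "continuous_map (top_of_set ({0..1::real} \<times> Q)) Z H'"
      "\<And>t w. t \<in> {0..1} \<Longrightarrow> w \<in> D \<Longrightarrow> H' (t, q w) = H (t, w)" by blast
  obtain b where b: "b \<in> B" "q b = s0" "b \<in> D" using B by blast
  then have s0: "s0 \<in> Q" using q by blast
  have "homotopic_with (\<lambda>k. k s0 = x) (top_of_set Q) Z g (\<lambda>y. H' (1, y))"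
  proof (rule homotopic_with_top_of_setI[OF H'(1)])
    fix y assume "y \<in> Q"
    then obtain w where "w \<in> D" "y = q w" using q by blast
    then show "H' (0, y) = g y" using H'(2)[of 0 w] H0 by simp
  next
    fix t :: real assume "t \<in> {0..1}"
    then show "H' (t, s0) = x" using H'(2)[of t b] HB[of t b] b by simp
  qed (use s0 in auto)
  moreover have "H' (1, q w) = f w" if "w \<in> D" for w using H'(2)[of 1 w] H1 that by simp
  ultimately show ?thesis by blast
qed

section \<open>Pairs in which planar families deform into the subspace\<close>

text \<open>All that is retained of the two complexes. For a disc, \<open>deform\<close> combined
  with \<open>compression\<close> says that a map of the disc with boundary in \<open>S\<close> can
  be moved into \<open>S\<close> relative to the boundary, so it plays the role of vanishing
  relative homotopy up to degree two.\<close>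

locale deformable_pair =
  fixes Z :: "'b topology" and S :: "'b set"
  assumes subset: "S \<subseteq> topspace Z"
    and deform: "\<And>(T :: complex set) f. compact T \<Longrightarrow> continuous_map (top_of_set T) Z f \<Longrightarrow>
      \<exists>g. homotopic_with (\<lambda>h. \<forall>w\<in>T. f w \<in> S \<longrightarrow> h w \<in> S) (top_of_set T) Z f g \<and> g ` T \<subseteq> S"
begin

text \<open>The line embeds in the plane by \<open>complex_of_real\<close>, and \<open>Re\<close>
  carries maps back and forth.\<close>

lemma deform_real:
  fixes T :: "real set"
  assumes "compact T" "continuous_map (top_of_set T) Z f"
  shows "\<exists>g. homotopic_with (\<lambda>h. \<forall>w\<in>T. f w \<in> S \<longrightarrow> h w \<in> S) (top_of_set T) Z f g \<and> g ` T \<subseteq> S"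
proof -
  let ?T = "complex_of_real ` T"
  have "continuous_map (top_of_set ?T) Z (\<lambda>z. f (Re z))"
    by (rule continuous_map_compose_on[OF assms(2)]) (auto intro!: continuous_intros)
  moreover have "compact ?T" using assms(1) by (intro compact_continuous_image continuous_intros)
  ultimately obtain g where g: "homotopic_with (\<lambda>h. \<forall>w\<in>?T. f (Re w) \<in> S \<longrightarrow> h w \<in> S) (top_of_set ?T) Z (\<lambda>z. f (Re z)) g"
      "g ` ?T \<subseteq> S" using deform by blast
  have "homotopic_with (\<lambda>h. \<forall>w\<in>T. f w \<in> S \<longrightarrow> h w \<in> S) (top_of_set T) Z ((\<lambda>z. f (Re z)) \<circ> complex_of_real) (g \<circ> complex_of_real)"
    by (rule homotopic_with_compose_continuous_map_right[OF g(1)])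
      (auto simp: continuous_map_in_subtopology intro!: continuous_intros)
  then show ?thesis using g(2) by (intro exI[of _ "g \<circ> complex_of_real"]) (auto simp: o_def)
qed

text \<open>The gauge \<open>N\<close> is kept general because two planar cells occur: the round
  disc for 2-spheres, and the square for homotopies of loops.\<close>

lemma compress_complex:
  fixes N :: "complex \<Rightarrow> real"
  assumes "continuous_on UNIV N" "\<And>w. 0 \<le> N w" "\<And>c w. 0 \<le> c \<Longrightarrow> N (c *\<^sub>R w) = c * N w"
    and "compact {w. N w \<le> 1}"
    and "continuous_map (top_of_set {w. N w \<le> 1}) Z f" "\<And>w. N w = 1 \<Longrightarrow> f w \<in> S"
  shows "\<exists>g. homotopic_with (\<lambda>h. \<forall>w\<in>{w. N w \<le> 1}. N w = 1 \<longrightarrow> h w = f w) (top_of_set {w. N w \<le> 1}) Z f g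
    \<and> g ` {w. N w \<le> 1} \<subseteq> S"
proof -
  from deform[OF assms(4,5)] obtain g
    where "homotopic_with (\<lambda>h. \<forall>w\<in>{w. N w \<le> 1}. f w \<in> S \<longrightarrow> h w \<in> S) (top_of_set {w. N w \<le> 1}) Z f g"
      "g ` {w. N w \<le> 1} \<subseteq> S" by (elim exE conjE)
  from compression[OF assms(1-3) this assms(6)] show ?thesis .
qed

lemma compress_real:
  fixes f :: "real \<Rightarrow> 'b"
  assumes "continuous_map (top_of_set {w. \<bar>w\<bar> \<le> 1}) Z f" "\<And>w. \<bar>w\<bar> = 1 \<Longrightarrow> f w \<in> S"
  shows "\<exists>g. homotopic_with (\<lambda>h. \<forall>w\<in>{w. \<bar>w\<bar> \<le> 1}. \<bar>w\<bar> = 1 \<longrightarrow> h w = f w) (top_of_set {w. \<bar>w\<bar> \<le> 1}) Z f g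
    \<and> g ` {w. \<bar>w\<bar> \<le> 1} \<subseteq> S"
proof -
  have "{w::real. \<bar>w\<bar> \<le> 1} = {-1..1}" by auto
  then have "compact {w::real. \<bar>w\<bar> \<le> 1}" by simp
  from deform_real[OF this assms(1)] obtain g
    where g: "homotopic_with (\<lambda>h. \<forall>w\<in>{w. \<bar>w\<bar> \<le> 1}. f w \<in> S \<longrightarrow> h w \<in> S) (top_of_set {w. \<bar>w\<bar> \<le> 1}) Z f g"
      "g ` {w. \<bar>w\<bar> \<le> 1} \<subseteq> S" by (elim exE conjE)
  show ?thesis
    by (rule compression[OF _ _ _ g assms(2)]) (auto simp: abs_mult intro!: continuous_intros)
qed

text \<open>For a one-point parameter set, the track of the deformation is a path into
  \<open>S\<close>.\<close>

lemma path_component_meets: 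
  assumes "p \<in> topspace Z" shows "\<exists>s\<in>S. path_component_of Z p s"
proof -
  have "continuous_map (top_of_set {0::complex}) Z (\<lambda>_. p)" using assms by simp
  then obtain g where g: "homotopic_with (\<lambda>h. \<forall>w\<in>{0}. p \<in> S \<longrightarrow> h w \<in> S) (top_of_set {0::complex}) Z (\<lambda>_. p) g"
      "g ` {0} \<subseteq> S" using deform[of "{0}" "\<lambda>_. p"] by auto
  obtain k where k: "continuous_map (top_of_set ({0..1::real} \<times> {0::complex})) Z k"
     "\<And>x. k (0, x) = p" "\<And>x. k (1, x) = g x"
    using g(1) by (elim homotopic_with_top_of_setE) blast
  have "pathin Z (\<lambda>t. k (t, 0))"
    unfolding pathin_def
    by (rule continuous_map_compose_on[OF k(1)]) (auto intro!: continuous_intros)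
  then have "path_component_of Z p (g 0)"
    unfolding path_component_of_def using k by (intro exI[of _ "\<lambda>t. k (t, 0)"]) simp
  then show ?thesis using g(2) by auto
qed

text \<open>The path is compressed relative to its ends, after a reparametrization over the interval
  from -1 to 1 that makes these ends the boundary of the unit ball of the line.\<close>

lemma path_component_reflect:
  assumes "path_component_of Z x y" "x \<in> S" "y \<in> S"
  shows "path_component_of (subtopology Z S) x y"
proof -
  obtain \<gamma> where \<gamma>: "pathin Z \<gamma>" "\<gamma> 0 = x" "\<gamma> 1 = y" using assms(1) unfolding path_component_of_def by blast
  let ?f = "\<lambda>w::real. \<gamma> ((w + 1) / 2)"
  have "continuous_map (top_of_set {w. \<bar>w\<bar> \<le> 1}) Z ?f"
    by (rule continuous_map_compose_on[OF \<gamma>(1)[unfolded pathin_def]]) (auto intro!: continuous_intros)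
  moreover have "?f w \<in> S" if "\<bar>w\<bar> = 1" for w
  proof -
    have "w = 1 \<or> w = -1" using that by linarith
    then show ?thesis using assms \<gamma> by auto
  qed
  ultimately obtain g where g: "homotopic_with (\<lambda>h. \<forall>w\<in>{w. \<bar>w\<bar> \<le> 1}. \<bar>w\<bar> = 1 \<longrightarrow> h w = ?f w) (top_of_set {w. \<bar>w\<bar> \<le> 1}) Z ?f g"
      "g ` {w. \<bar>w\<bar> \<le> 1} \<subseteq> S" using compress_real by blast
  have ends: "g 1 = y" "g (-1) = x" using homotopic_with_imp_property[OF g(1)] \<gamma> by auto
  have gc: "continuous_map (top_of_set {w. \<bar>w\<bar> \<le> 1}) Z g" using homotopic_with_imp_continuous_maps[OF g(1)] by simp
  have "continuous_map (top_of_set {0..1}) Z (\<lambda>t. g (2 * t - 1))"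
    by (rule continuous_map_compose_on[OF gc]) (auto intro!: continuous_intros)
  then have "pathin (subtopology Z S) (\<lambda>t. g (2 * t - 1))"
    unfolding pathin_def continuous_map_in_subtopology using g(2) by (auto intro!: subsetD[OF g(2)] imageI)
  then show ?thesis
    unfolding path_component_of_def using ends by (intro exI[of _ "\<lambda>t. g (2 * t - 1)"]) simp
qed

text \<open>Surjectivity holds because every path component of \<open>Z\<close> meets
  \<open>S\<close>, injectivity because a path between points of \<open>S\<close> can be compressed
  into \<open>S\<close>.\<close>

lemma bij_betw_pi0:
  "bij_betw (pi0_map id Z) (path_components_of (subtopology Z S)) (path_components_of Z)"
proof -
  let ?W = "subtopology Z S"
  have top: "topspace ?W = S" using subset by auto
  have mono: "path_component_of Z x y" if "path_component_of ?W x y" for x y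
    using that continuous_map_into_fulltopology unfolding path_component_of_def pathin_def by blast
  have iff: "path_component_of Z x y \<longleftrightarrow> path_component_of ?W x y" if "x \<in> S" "y \<in> S" for x y
    using mono path_component_reflect that by blast
  have comp: "pi0_map id Z (path_component_of_set ?W x) = path_component_of_set Z x" if "x \<in> S" for x
  proof -
    have "x \<in> path_component_of_set ?W x" using that top by (simp add: path_component_of_refl)
    then have "(SOME y. y \<in> path_component_of_set ?W x) \<in> path_component_of_set ?W x" by (rule someI)
    then have "path_component_of Z x (SOME y. y \<in> path_component_of_set ?W x)" using mono by simp
    then show ?thesis unfolding pi0_map_def id_def
      by (metis path_component_of_equiv)
  qed
  show ?thesis
    unfolding bij_betw_def
  proof
    show "inj_on (pi0_map id Z) (path_components_of ?W)"
    proof (rule inj_onI)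
      fix C C' assume "C \<in> path_components_of ?W" "C' \<in> path_components_of ?W"
        and eq: "pi0_map id Z C = pi0_map id Z C'"
      then obtain x x' where x: "x \<in> S" "C = path_component_of_set ?W x" "x' \<in> S" "C' = path_component_of_set ?W x'"
        unfolding path_components_of_def top by blast
      then have "path_component_of_set Z x = path_component_of_set Z x'" using eq comp by simp
      moreover have "x' \<in> topspace Z" using x subset by blast
      ultimately have "path_component_of Z x x'" by (metis mem_Collect_eq path_component_of_refl)
      then have "path_component_of ?W x x'" using iff x by blast
      then show "C = C'" unfolding x by (metis path_component_of_equiv)
    qed
    show "pi0_map id Z ` path_components_of ?W = path_components_of Z"
    proof (intro equalityI subsetI)
      fix C assume "C \<in> pi0_map id Z ` path_components_of ?W"
      then obtain x where "x \<in> S" "C = path_component_of_set Z x"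
        unfolding path_components_of_def top using comp by auto
      then show "C \<in> path_components_of Z" using subset unfolding path_components_of_def by blast
    next
      fix C assume "C \<in> path_components_of Z"
      then obtain p where p: "p \<in> topspace Z" "C = path_component_of_set Z p" unfolding path_components_of_def by blast
      then obtain x where x: "x \<in> S" "path_component_of Z p x" using path_component_meets by blast
      then have "C = path_component_of_set Z x" unfolding p(2) by (metis path_component_of_equiv)
      then have "C = pi0_map id Z (path_component_of_set ?W x)" using comp[OF x(1)] by simp
      moreover have "path_component_of_set ?W x \<in> path_components_of ?W"
        unfolding path_components_of_def top using x(1) by blast
      ultimately show "C \<in> pi0_map id Z ` path_components_of ?W" by blast
    qed
  qed
qed

end

section \<open>Pointed homotopy classes under an inclusion\<close>

lemma hclass_eq:
  assumes "homotopic_with (\<lambda>k. k s0 = x) T X g h"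
  shows "hclass T s0 X x g = hclass T s0 X x h"
  unfolding hclass_def using assms homotopic_with_trans homotopic_with_sym by blast

lemma hclass_eqD:
  assumes "hclass T s0 X x g = hclass T s0 X x h" "continuous_map T X h" "h s0 = x"
  shows "homotopic_with (\<lambda>k. k s0 = x) T X g h"
proof -
  have "h \<in> hclass T s0 X x h" using assms(2,3) by (simp add: hclass_def)
  then show ?thesis unfolding assms(1)[symmetric] by (simp add: hclass_def)
qed

lemma homotopic_with_into_fulltopology:
  "homotopic_with P T (subtopology Z S) g h \<Longrightarrow> homotopic_with P T Z g h"
  unfolding homotopic_with_def using continuous_map_into_fulltopology by blast

text \<open>Whatever representative \<open>SOME\<close> selects in \<open>induced\<close>, it is
  homotopic to \<open>g\<close> inside the subspace and therefore also in \<open>Z\<close>.\<close>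

lemma induced_id_hclass:
  assumes "continuous_map T (subtopology Z S) g" "g s0 = x"
  shows "induced id T s0 Z x (hclass T s0 (subtopology Z S) x g) = hclass T s0 Z x g"
proof -
  let ?C = "hclass T s0 (subtopology Z S) x g"
  have "\<exists>g. g \<in> ?C" using assms by (auto simp: hclass_def)
  then have "(SOME g. g \<in> ?C) \<in> ?C" by (rule someI_ex)
  then have "homotopic_with (\<lambda>k. k s0 = x) T (subtopology Z S) g (SOME g. g \<in> ?C)"
    unfolding hclass_def by simp
  from hclass_eq[OF homotopic_with_into_fulltopology[OF this]]
  show ?thesis unfolding induced_def by simp
qed

lemma induced_id_surj:
  assumes "\<And>g. continuous_map T Z g \<Longrightarrow> g s0 = x \<Longrightarrow>
    \<exists>g'. continuous_map T (subtopology Z S) g' \<and> g' s0 = x \<and> homotopic_with (\<lambda>k. k s0 = x) T Z g g'"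
  shows "induced id T s0 Z x ` hset T s0 (subtopology Z S) x = hset T s0 Z x"
proof (intro equalityI subsetI)
  fix C assume "C \<in> induced id T s0 Z x ` hset T s0 (subtopology Z S) x"
  then obtain g where g: "continuous_map T (subtopology Z S) g" "g s0 = x"
      "C = induced id T s0 Z x (hclass T s0 (subtopology Z S) x g)"
    unfolding hset_def by blast
  then have "C = hclass T s0 Z x g" using induced_id_hclass by metis
  moreover have "continuous_map T Z g" by (rule continuous_map_into_fulltopology[OF g(1)])
  ultimately show "C \<in> hset T s0 Z x" unfolding hset_def using g(2) by blast
next
  fix C assume "C \<in> hset T s0 Z x"
  then obtain g where g: "continuous_map T Z g" "g s0 = x" "C = hclass T s0 Z x g"
    unfolding hset_def by blast
  from assms[OF g(1,2)] obtain g' where g': "continuous_map T (subtopology Z S) g'" "g' s0 = x"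
      "homotopic_with (\<lambda>k. k s0 = x) T Z g g'" by blast
  have "C = induced id T s0 Z x (hclass T s0 (subtopology Z S) x g')"
    using hclass_eq[OF g'(3)] induced_id_hclass[OF g'(1,2)] g(3) by simp
  moreover have "hclass T s0 (subtopology Z S) x g' \<in> hset T s0 (subtopology Z S) x"
    unfolding hset_def using g' by blast
  ultimately show "C \<in> induced id T s0 Z x ` hset T s0 (subtopology Z S) x" by blast
qed

lemma induced_id_inj:
  assumes "\<And>g h. continuous_map T (subtopology Z S) g \<Longrightarrow> continuous_map T (subtopology Z S) h \<Longrightarrow>
    g s0 = x \<Longrightarrow> h s0 = x \<Longrightarrow> homotopic_with (\<lambda>k. k s0 = x) T Z g h \<Longrightarrow>
    homotopic_with (\<lambda>k. k s0 = x) T (subtopology Z S) g h"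
  shows "inj_on (induced id T s0 Z x) (hset T s0 (subtopology Z S) x)"
proof (rule inj_onI)
  fix C C' assume "C \<in> hset T s0 (subtopology Z S) x" "C' \<in> hset T s0 (subtopology Z S) x"
    and eq: "induced id T s0 Z x C = induced id T s0 Z x C'"
  then obtain g h where g: "continuous_map T (subtopology Z S) g" "g s0 = x" "C = hclass T s0 (subtopology Z S) x g"
    and h: "continuous_map T (subtopology Z S) h" "h s0 = x" "C' = hclass T s0 (subtopology Z S) x h"
    unfolding hset_def by blast
  have "hclass T s0 Z x g = hclass T s0 Z x h"
    using eq g h induced_id_hclass by metis
  then have "homotopic_with (\<lambda>k. k s0 = x) T Z g h"
    using hclass_eqD continuous_map_into_fulltopology[OF h(1)] h(2) by metis
  then have "homotopic_with (\<lambda>k. k s0 = x) T (subtopology Z S) g h" using assms g h by blast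
  then show "C = C'" using hclass_eq g h by metis
qed

section \<open>The circle and the 2-sphere as quotients of an interval and a disc\<close>

text \<open>The minus sign sends both ends of the interval from -1 to 1 to the base point 1;
  \<open>cis\<close> alone would send them to -1.\<close>

definition wrap_circle :: "real \<Rightarrow> complex" where "wrap_circle t = - cis (pi * t)"

lemma continuous_on_wrap_circle: "continuous_on A wrap_circle"
  unfolding wrap_circle_def by (intro continuous_intros)

lemma norm_wrap_circle: "cmod (wrap_circle t) = 1"
  by (simp add: wrap_circle_def)

lemma wrap_circle_ends: "\<bar>t\<bar> = 1 \<Longrightarrow> wrap_circle t = 1"
proof -
  assume "\<bar>t\<bar> = 1"
  then have "t = 1 \<or> t = -1" by linarith
  then show ?thesis by (auto simp: wrap_circle_def complex_eq_iff)
qed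

lemma wrap_circle_image: "wrap_circle ` {t. \<bar>t\<bar> \<le> 1} = sphere 0 1"
proof (intro equalityI subsetI)
  fix z assume "z \<in> wrap_circle ` {t. \<bar>t\<bar> \<le> 1}"
  then show "z \<in> sphere 0 1" by (auto simp: wrap_circle_def)
next
  fix z :: complex assume z: "z \<in> sphere 0 1"
  then have "- z \<noteq> 0" "cmod (- z) = 1" by auto
  then have "- z = cis (Arg (- z))" using cis_Arg[of "- z"] by (simp add: sgn_eq)
  then have "z = wrap_circle (Arg (- z) / pi)" by (simp add: wrap_circle_def minus_equation_iff)
  moreover have "\<bar>Arg (- z) / pi\<bar> \<le> 1"
    using Arg_bounded[of "- z"] by (auto simp: abs_le_iff field_simps)
  ultimately show "z \<in> wrap_circle ` {t. \<bar>t\<bar> \<le> 1}" by blast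
qed

lemma wrap_circle_eq:
  assumes "\<bar>t\<bar> \<le> 1" "\<bar>u\<bar> \<le> 1" "wrap_circle t = wrap_circle u"
  shows "t = u \<or> (\<bar>t\<bar> = 1 \<and> \<bar>u\<bar> = 1)"
proof -
  have "exp (\<i> * of_real (pi * t)) = exp (\<i> * of_real (pi * u))"
    using assms(3) by (simp add: wrap_circle_def cis_conv_exp)
  then obtain n :: int where "\<i> * of_real (pi * t) = \<i> * of_real (pi * u) + of_real (real_of_int (2 * n) * pi) * \<i>"
    unfolding exp_eq by blast
  then have "Im (\<i> * of_real (pi * t)) = Im (\<i> * of_real (pi * u) + of_real (real_of_int (2 * n) * pi) * \<i>)" by simp
  then have "pi * t = pi * (u + 2 * of_int n)" by (simp add: algebra_simps)
  then have n: "t = u + 2 * of_int n" by simp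
  \<comment> \<open>Both parameters lie in an interval of length 2, so a nonzero \<open>n\<close> is
    1 or -1 and places them at opposite ends.\<close>
  then have "\<bar>real_of_int n\<bar> \<le> 1" using assms(1,2) by linarith
  then have "n = 0 \<or> n = 1 \<or> n = -1" by linarith
  then show ?thesis using n assms(1,2) by auto
qed

text \<open>Collapses the boundary circle of the unit disc to \<open>axis 1 1\<close>. With
  \<open>R\<close> the squared modulus, the height is \<open>2 * R - 1\<close>, and the scaling of
  the remaining coordinates is dictated by
  \<open>(2 * R - 1)^2 + 4 * R * (1 - R) = 1\<close>.\<close>

definition wrap_sphere :: "complex \<Rightarrow> real^3" where
  "wrap_sphere w = (\<chi> i. if i = 1 then 2 * (cmod w)\<^sup>2 - 1
     else 2 * sqrt (1 - (cmod w)\<^sup>2) * (if i = 2 then Re w else Im w))"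

lemma wrap_sphere_nth:
  "wrap_sphere w $ 1 = 2 * (cmod w)\<^sup>2 - 1"
  "wrap_sphere w $ 2 = 2 * sqrt (1 - (cmod w)\<^sup>2) * Re w"
  "wrap_sphere w $ 3 = 2 * sqrt (1 - (cmod w)\<^sup>2) * Im w"
  by (simp_all add: wrap_sphere_def)

lemma continuous_on_wrap_sphere: "continuous_on A wrap_sphere"
  unfolding wrap_sphere_def
proof (rule continuous_on_vec_lambda)
  show "continuous_on A (\<lambda>w. if i = 1 then 2 * (cmod w)\<^sup>2 - 1
     else 2 * sqrt (1 - (cmod w)\<^sup>2) * (if i = 2 then Re w else Im w))" for i :: 3
    by (cases "i = 1"; cases "i = 2") (auto intro!: continuous_intros)
qed

lemma wrap_sphere_boundary: "cmod w = 1 \<Longrightarrow> wrap_sphere w = axis 1 1"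
  by (simp add: vec_eq_iff forall_3 wrap_sphere_nth axis_def)

lemma sphere_3_iff: "v \<in> sphere (0 :: real^3) 1 \<longleftrightarrow> (v $ 1)\<^sup>2 + (v $ 2)\<^sup>2 + (v $ 3)\<^sup>2 = 1"
  by (simp add: norm_vec_def L2_set_def sum_3)

lemma wrap_sphere_image: "wrap_sphere ` {w. cmod w \<le> 1} = sphere 0 1"
proof (intro equalityI subsetI)
  fix v assume "v \<in> wrap_sphere ` {w. cmod w \<le> 1}"
  then obtain w where w: "cmod w \<le> 1" "v = wrap_sphere w" by blast
  define R where "R = (cmod w)\<^sup>2"
  have R: "R \<le> 1" "R = (Re w)\<^sup>2 + (Im w)\<^sup>2"
    using w(1) unfolding R_def by (simp_all add: power_le_one cmod_power2[symmetric])
  have "(2 * R - 1)\<^sup>2 + (2 * sqrt (1 - R) * Re w)\<^sup>2 + (2 * sqrt (1 - R) * Im w)\<^sup>2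
      = (2 * R - 1)\<^sup>2 + 4 * (1 - R) * ((Re w)\<^sup>2 + (Im w)\<^sup>2)"
    using R(1) by (simp add: power_mult_distrib algebra_simps)
  also have "\<dots> = 1" unfolding R(2)[symmetric] by (simp add: power2_eq_square algebra_simps)
  finally show "v \<in> sphere 0 1" unfolding sphere_3_iff w(2) wrap_sphere_nth R_def .
next
  fix v :: "real^3" assume "v \<in> sphere 0 1"
  then have v: "(v $ 1)\<^sup>2 + (v $ 2)\<^sup>2 + (v $ 3)\<^sup>2 = 1" by (simp only: sphere_3_iff)
  have le: "v $ 1 \<le> 1"
  proof (rule ccontr)
    assume "\<not> v $ 1 \<le> 1"
    then have "1 < (v $ 1)\<^sup>2" by (simp add: one_less_power)
    then show False using v zero_le_power2[of "v $ 2"] zero_le_power2[of "v $ 3"] by linarith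
  qed
  show "v \<in> wrap_sphere ` {w. cmod w \<le> 1}"
  proof (cases "v $ 1 = 1")
    case True
    then have "(v $ 2)\<^sup>2 + (v $ 3)\<^sup>2 = 0" using v by simp
    then have "v $ 2 = 0" "v $ 3 = 0" by (simp_all add: sum_power2_eq_zero_iff)
    then have "v = axis 1 1" using True by (simp add: vec_eq_iff forall_3 axis_def)
    then have "v = wrap_sphere 1" by (simp add: wrap_sphere_boundary)
    then show ?thesis by auto
  next
    case False
    \<comment> \<open>Solves \<open>v $ 1 = 2 * R - 1\<close> for \<open>sqrt (1 - R)\<close>, where
      \<open>R\<close> is the squared modulus of the preimage sought. Dividing the other two
      coordinates by \<open>2 * s\<close> then recovers this preimage.\<close>
    define s where "s = sqrt ((1 - v $ 1) / 2)"
    have s: "0 < s" "s\<^sup>2 = (1 - v $ 1) / 2" using False le by (auto simp: s_def)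
    define w where "w = Complex (v $ 2 / (2 * s)) (v $ 3 / (2 * s))"
    have "(cmod w)\<^sup>2 = ((v $ 2)\<^sup>2 + (v $ 3)\<^sup>2) / (4 * s\<^sup>2)"
      by (simp add: cmod_power2 w_def power_divide power_mult_distrib add_divide_distrib)
    also have "(v $ 2)\<^sup>2 + (v $ 3)\<^sup>2 = (1 - v $ 1) * (1 + v $ 1)"
      using v by (simp add: algebra_simps power2_eq_square)
    also have "\<dots> / (4 * s\<^sup>2) = (1 + v $ 1) / 2"
      unfolding s(2) using False by (simp add: field_simps)
    finally have w: "(cmod w)\<^sup>2 = (1 + v $ 1) / 2" .
    then have "sqrt (1 - (cmod w)\<^sup>2) = s" unfolding s_def by (simp add: field_simps)
    then have "wrap_sphere w = v"
      using s(1) w by (simp add: vec_eq_iff forall_3 wrap_sphere_nth w_def)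
    moreover have "cmod w \<le> 1" using w le by (simp add: power2_le_imp_le abs_square_le_1[symmetric])
    ultimately show ?thesis by blast
  qed
qed

text \<open>The first coordinate determines the modulus; inside the open disc the square root is
  nonzero and can be cancelled from the other two.\<close>

lemma wrap_sphere_eq:
  assumes "cmod w \<le> 1" "cmod z \<le> 1" "wrap_sphere w = wrap_sphere z"
  shows "w = z \<or> (cmod w = 1 \<and> cmod z = 1)"
proof -
  have R: "(cmod w)\<^sup>2 = (cmod z)\<^sup>2" using assms(3) wrap_sphere_nth(1)[of w] wrap_sphere_nth(1)[of z] by simp
  then have eq: "cmod w = cmod z" by simp
  show ?thesis
  proof (cases "cmod w = 1")
    case False
    then have "(cmod w)\<^sup>2 < 1" using assms(1) by (simp add: abs_square_less_1)
    then have "sqrt (1 - (cmod w)\<^sup>2) \<noteq> 0" by simp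
    then have "Re w = Re z" "Im w = Im z"
      using assms(3) wrap_sphere_nth(2,3)[of w] wrap_sphere_nth(2,3)[of z] unfolding R by auto
    then show ?thesis by (simp add: complex_eq_iff)
  qed (use eq in simp)
qed

section \<open>Fundamental group and second homotopy group of a deformable pair\<close>

context deformable_pair
begin

text \<open>\<open>q\<close> is the characteristic map of a cell whose boundary
  \<open>N w = 1\<close> collapses to the base point. The map \<open>g\<close> is pulled back along
  \<open>q\<close>, compressed with the boundary fixed, and the result descends again. Circle and
  2-sphere are the two instances.\<close>

lemma lift_from_cell:
  fixes q :: "'e::euclidean_space \<Rightarrow> 's::euclidean_space" and N :: "'e \<Rightarrow> real"
  assumes compact: "compact {w. N w \<le> 1}"
    and q: "continuous_on {w. N w \<le> 1} q" "q ` {w. N w \<le> 1} = Q"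
    and inj: "\<And>w w'. N w \<le> 1 \<Longrightarrow> N w' \<le> 1 \<Longrightarrow> q w = q w' \<Longrightarrow> w = w' \<or> (N w = 1 \<and> N w' = 1)"
    and bd: "N w0 = 1" "\<And>w. N w = 1 \<Longrightarrow> q w = s0"
    and compress: "\<And>f. continuous_map (top_of_set {w. N w \<le> 1}) Z f \<Longrightarrow> (\<And>w. N w = 1 \<Longrightarrow> f w \<in> S) \<Longrightarrow>
      \<exists>g. homotopic_with (\<lambda>h. \<forall>w\<in>{w. N w \<le> 1}. N w = 1 \<longrightarrow> h w = f w) (top_of_set {w. N w \<le> 1}) Z f g
        \<and> g ` {w. N w \<le> 1} \<subseteq> S"
    and g: "continuous_map (top_of_set Q) Z g" "g s0 = x" and x: "x \<in> S"
  shows "\<exists>g'. continuous_map (top_of_set Q) (subtopology Z S) g' \<and> g' s0 = x \<and>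
    homotopic_with (\<lambda>k. k s0 = x) (top_of_set Q) Z g g'"
proof -
  let ?D = "{w. N w \<le> 1}"
  have "continuous_map (top_of_set ?D) Z (\<lambda>w. g (q w))"
    by (rule continuous_map_compose_on[OF g(1) q(1)]) (use q(2) in blast)
  moreover have "g (q w) \<in> S" if "N w = 1" for w using bd(2)[OF that] g(2) x by simp
  ultimately obtain f where f: "homotopic_with (\<lambda>h. \<forall>w\<in>?D. N w = 1 \<longrightarrow> h w = g (q w)) (top_of_set ?D) Z (\<lambda>w. g (q w)) f"
      "f ` ?D \<subseteq> S" using compress[of "\<lambda>w. g (q w)"] by blast
  have f1: "homotopic_with (\<lambda>h. \<forall>w\<in>?D. w \<in> {w. N w = 1} \<longrightarrow> h w = x) (top_of_set ?D) Z (g \<circ> q) f"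
    using f(1) unfolding o_def by (rule homotopic_with_mono) (simp add: bd(2) g(2))
  have "\<exists>g'. homotopic_with (\<lambda>k. k s0 = x) (top_of_set Q) Z g g' \<and> (\<forall>w\<in>?D. g' (q w) = f w)"
    by (rule quotient_homotopic_with[OF compact q _ _ _ _ g(2) f1]) (use inj bd in auto)
  then obtain g' where g': "homotopic_with (\<lambda>k. k s0 = x) (top_of_set Q) Z g g'" "\<And>w. w \<in> ?D \<Longrightarrow> g' (q w) = f w"
    by blast
  have "g' y \<in> S" if "y \<in> Q" for y using that q(2) g'(2) f(2) by auto
  then have "continuous_map (top_of_set Q) (subtopology Z S) g'"
    using homotopic_with_imp_continuous_maps[OF g'(1)] by (auto simp: continuous_map_in_subtopology)
  moreover have "g' s0 = x" using homotopic_with_imp_property[OF g'(1)] by simp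
  ultimately show ?thesis using g'(1) by blast
qed

lemma pi2_surj:
  assumes "x \<in> S"
  shows "induced id sphere2 (axis 1 1) Z x ` pi2 (subtopology Z S) x = pi2 Z x"
proof (rule induced_id_surj)
  fix g assume g: "continuous_map sphere2 Z g" "g (axis 1 1) = x"
  have comp: "compact {w. cmod w \<le> 1}" using compact_cball[of "0::complex" 1] by (simp add: cball_def)
  show "\<exists>g'. continuous_map sphere2 (subtopology Z S) g' \<and> g' (axis 1 1) = x \<and>
      homotopic_with (\<lambda>k. k (axis 1 1) = x) sphere2 Z g g'"
    unfolding sphere2_def
  proof (rule lift_from_cell[where N = cmod and ?w0.0 = 1,
        OF comp continuous_on_wrap_sphere wrap_sphere_image wrap_sphere_eq])
    fix f assume "continuous_map (top_of_set {w. cmod w \<le> 1}) Z f" "\<And>w. cmod w = 1 \<Longrightarrow> f w \<in> S"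
    then show "\<exists>g. homotopic_with (\<lambda>h. \<forall>w\<in>{w. cmod w \<le> 1}. cmod w = 1 \<longrightarrow> h w = f w)
        (top_of_set {w. cmod w \<le> 1}) Z f g \<and> g ` {w. cmod w \<le> 1} \<subseteq> S"
      by (intro compress_complex[OF _ _ _ comp]) (auto intro!: continuous_intros)
  qed (use g assms in \<open>auto simp: sphere2_def wrap_sphere_boundary\<close>)
qed

lemma pi1_surj:
  assumes "x \<in> S"
  shows "induced id sphere1 1 Z x ` pi1 (subtopology Z S) x = pi1 Z x"
proof (rule induced_id_surj)
  fix g assume g: "continuous_map sphere1 Z g" "g 1 = x"
  have "{w::real. \<bar>w\<bar> \<le> 1} = {-1..1}" by auto
  then have comp: "compact {w::real. \<bar>w\<bar> \<le> 1}" by simp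
  show "\<exists>g'. continuous_map sphere1 (subtopology Z S) g' \<and> g' 1 = x \<and>
      homotopic_with (\<lambda>k. k 1 = x) sphere1 Z g g'"
    unfolding sphere1_def
    by (rule lift_from_cell[where N = "\<lambda>w::real. \<bar>w\<bar>" and ?w0.0 = 1,
        OF comp continuous_on_wrap_circle wrap_circle_image wrap_circle_eq])
      (use g assms compress_real in \<open>auto simp: sphere1_def wrap_circle_ends\<close>)
qed

text \<open>A homotopy of loops is unrolled onto a square, with time in the real part and the circle
  wrapped along the imaginary part. On the boundary of the square it takes values of
  \<open>g\<close> and \<open>h\<close> or the base point, all of which lie in \<open>S\<close>, so
  it can be compressed with the boundary fixed. Rolling up the second direction gives a pointed
  homotopy inside \<open>S\<close>.\<close>

lemma circle_homotopy_reflect: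
  assumes g: "continuous_map sphere1 (subtopology Z S) g" and h: "continuous_map sphere1 (subtopology Z S) h"
    and gh: "g 1 = x" "h 1 = x" and hom: "homotopic_with (\<lambda>k. k 1 = x) sphere1 Z g h"
  shows "homotopic_with (\<lambda>k. k 1 = x) sphere1 (subtopology Z S) g h"
proof -
  \<comment> \<open>The maximum norm, whose closed unit ball is the square.\<close>
  define N where "N w = max \<bar>Re w\<bar> \<bar>Im w\<bar>" for w
  have gS: "g z \<in> S" "h z \<in> S" if "z \<in> sphere 0 1" for z
    using g h that by (auto simp: continuous_map_in_subtopology sphere1_def)
  have x: "x \<in> S" using gS[of 1] gh by simp
  obtain M where M: "continuous_map (top_of_set ({0..1::real} \<times> sphere (0::complex) 1)) Z M"
    "\<And>z. M (0, z) = g z" "\<And>z. M (1, z) = h z" "\<And>t. t \<in> {0..1} \<Longrightarrow> M (t, 1) = x"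
    using hom unfolding sphere1_def by (rule homotopic_with_top_of_setE) blast
  define f where "f w = M ((Re w + 1) / 2, wrap_circle (Im w))" for w
  have wc: "wrap_circle t \<in> sphere 0 1" for t by (simp add: norm_wrap_circle)
  have fc: "continuous_map (top_of_set {w. N w \<le> 1}) Z f"
    unfolding f_def
    by (rule continuous_map_compose_on[OF M(1)])
      (auto simp: N_def abs_le_iff norm_wrap_circle intro!: continuous_intros continuous_on_compose2[OF continuous_on_wrap_circle[of UNIV]])
  have fbd: "f w \<in> S" if "N w = 1" for w
  proof -
    have b: "\<bar>Re w\<bar> \<le> 1" "\<bar>Im w\<bar> \<le> 1" and "\<bar>Re w\<bar> = 1 \<or> \<bar>Im w\<bar> = 1"
      using that unfolding N_def by linarith+
    then consider "Re w = 1" | "Re w = -1" | "\<bar>Im w\<bar> = 1" by linarith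
    then show ?thesis
    proof cases
      case 3
      then show ?thesis using b x M(4)[of "(Re w + 1) / 2"] by (auto simp: f_def wrap_circle_ends abs_le_iff)
    qed (use b in \<open>auto simp: f_def M(2,3) intro!: gS wc\<close>)
  qed
  have contN: "continuous_on UNIV N" unfolding N_def by (intro continuous_intros)
  have "bounded {w. N w \<le> 1}"
    unfolding bounded_iff
  proof (intro exI ballI)
    fix w assume "w \<in> {w. N w \<le> 1}"
    then show "norm w \<le> 2" using cmod_le[of w] by (auto simp: N_def)
  qed
  moreover have "closed {w. N w \<le> 1}" by (intro closed_Collect_le contN continuous_intros)
  ultimately have "compact {w. N w \<le> 1}" by (simp add: compact_eq_bounded_closed)
  moreover have "N (c *\<^sub>R w) = c * N w" if "0 \<le> c" for c w
    using that by (simp add: N_def abs_mult max_mult_distrib_left)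
  moreover have "0 \<le> N w" for w by (simp add: N_def le_max_iff_disj)
  ultimately obtain f' where f': "homotopic_with (\<lambda>h. \<forall>w\<in>{w. N w \<le> 1}. N w = 1 \<longrightarrow> h w = f w) (top_of_set {w. N w \<le> 1}) Z f f'"
      "f' ` {w. N w \<le> 1} \<subseteq> S"
    using compress_complex[OF contN, of f] fc fbd by blast
  have f'c: "continuous_map (top_of_set {w. N w \<le> 1}) Z f'" using homotopic_with_imp_continuous_maps[OF f'(1)] by simp
  have f'b: "f' w = f w" if "N w = 1" for w using homotopic_with_imp_property[OF f'(1)] that by simp
  define H where "H = (\<lambda>(t, u). f' (Complex (2 * t - 1) u))"
  let ?D = "{u::real. \<bar>u\<bar> \<le> 1}"
  have ND: "N (Complex (2 * t - 1) u) \<le> 1" if "t \<in> {0..1}" "u \<in> ?D" for t u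
    using that by (auto simp: N_def)
  have Hc: "continuous_map (top_of_set ({0..1::real} \<times> ?D)) Z H"
    unfolding H_def case_prod_beta
    by (rule continuous_map_compose_on[OF f'c]) (use ND in \<open>auto intro!: continuous_intros simp: Complex_eq\<close>)
  have Hend: "H (t, u) = x" if "t \<in> {0..1}" "\<bar>u\<bar> = 1" for t u
  proof -
    have "N (Complex (2 * t - 1) u) = 1" using that by (auto simp: N_def)
    then show ?thesis using that M(4)[of t] by (simp add: H_def f'b f_def wrap_circle_ends)
  qed
  have "{w::real. \<bar>w\<bar> \<le> 1} = {-1..1}" by auto
  then have comp: "compact ?D" by simp
  have "H (t, w) = H (t, w')" if "t \<in> {0..1}" "w \<in> ?D" "w' \<in> ?D" "wrap_circle w = wrap_circle w'" for t w w'
    using wrap_circle_eq[of w w'] that Hend[of t] by auto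
  from quotient_homotopy[OF comp continuous_on_wrap_circle wrap_circle_image Hc this]
  obtain H' where H': "continuous_map (top_of_set ({0..1::real} \<times> sphere 0 1)) Z H'"
      "\<And>t u. t \<in> {0..1} \<Longrightarrow> u \<in> ?D \<Longrightarrow> H' (t, wrap_circle u) = H (t, u)" by blast
  have lift: "\<exists>u\<in>?D. z = wrap_circle u" if "z \<in> sphere 0 1" for z using that wrap_circle_image by blast
  have "H' (t, z) \<in> S" if t: "t \<in> {0..1}" and z: "z \<in> sphere 0 1" for t z
  proof -
    obtain u where u: "u \<in> ?D" "z = wrap_circle u" using lift[OF z] by blast
    have "f' (Complex (2 * t - 1) u) \<in> S" using ND[OF t u(1)] f'(2) by blast
    then show ?thesis using H'(2)[OF t u(1)] u(2) by (simp add: H_def)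
  qed
  then have "continuous_map (top_of_set ({0..1::real} \<times> sphere 0 1)) (subtopology Z S) H'"
    using H'(1) by (auto simp: continuous_map_in_subtopology)
  then show ?thesis
    unfolding sphere1_def
  proof (rule homotopic_with_top_of_setI)
    fix z :: complex assume "z \<in> sphere 0 1"
    then obtain u where u: "u \<in> ?D" "z = wrap_circle u" using lift by blast
    have "N (Complex (- 1) u) = 1" "N (Complex 1 u) = 1" using u by (auto simp: N_def)
    then show "H' (0, z) = g z" "H' (1, z) = h z"
      using H'(2)[of 0 u] H'(2)[of 1 u] u by (simp_all add: H_def f'b f_def M(2,3))
  next
    fix t :: real assume "t \<in> {0..1}"
    then show "H' (t, 1) = x" using H'(2)[of t 1] Hend[of t 1] by (simp add: wrap_circle_ends)
  qed auto
qed

lemma pi1_bij: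
  assumes "x \<in> S"
  shows "bij_betw (induced id sphere1 1 Z x) (pi1 (subtopology Z S) x) (pi1 Z x)"
  unfolding bij_betw_def using pi1_surj[OF assms] induced_id_inj[OF circle_homotopy_reflect] by blast

end

section \<open>Homotopy fibers\<close>

lemma topspace_path_space:
  "topspace (path_space Z) = {\<gamma>. pathin Z \<gamma> \<and> \<gamma> \<in> extensional {0..1}}"
proof (intro equalityI subsetI)
  fix \<gamma> assume "\<gamma> \<in> {\<gamma>. pathin Z \<gamma> \<and> \<gamma> \<in> extensional {0..1}}"
  \<comment> \<open>The empty compact set imposes no condition, so a single generating set already
    contains all admissible paths.\<close>
  then have "\<gamma> \<in> {\<gamma>. pathin Z \<gamma> \<and> \<gamma> \<in> extensional {0..1} \<and> \<gamma> ` {} \<subseteq> {}}" by simp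
  moreover have "compactin (top_of_set {0..1::real}) {}" "openin Z {}" by simp_all
  ultimately show "\<gamma> \<in> topspace (path_space Z)"
    unfolding path_space_def topology_generated_by_topspace by blast
next
  fix \<gamma> assume "\<gamma> \<in> topspace (path_space Z)"
  then show "\<gamma> \<in> {\<gamma>. pathin Z \<gamma> \<and> \<gamma> \<in> extensional {0..1}}"
    unfolding path_space_def topology_generated_by_topspace by blast
qed

text \<open>One half of the exponential law. If the path at \<open>w\<close> sends the compact set
  \<open>C\<close> into \<open>U\<close>, the tube lemma supplies a neighbourhood of
  \<open>w\<close> over which this remains true.\<close>

lemma continuous_map_curry:
  assumes \<Gamma>: "continuous_map (top_of_set (D \<times> {0..1::real})) Z \<Gamma>"
  shows "continuous_map (top_of_set D) (path_space Z) (\<lambda>w. restrict (\<lambda>t. \<Gamma> (w, t)) {0..1})"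
proof -
  let ?\<phi> = "\<lambda>w. restrict (\<lambda>t. \<Gamma> (w, t)) {0..1::real}"
  have path: "pathin Z (?\<phi> w)" if "w \<in> D" for w
  proof -
    have "continuous_map (top_of_set {0..1}) Z (\<lambda>t. \<Gamma> (w, t))"
      by (rule continuous_map_compose_on[OF \<Gamma>]) (use that in \<open>auto intro!: continuous_intros\<close>)
    then show ?thesis unfolding pathin_def by (rule continuous_map_eq) simp
  qed
  show ?thesis
    unfolding path_space_def
  proof (rule continuous_on_generated_topo)
    fix G assume "G \<in> {{\<gamma>. pathin Z \<gamma> \<and> \<gamma> \<in> extensional {0..1} \<and> \<gamma> ` C \<subseteq> U} | C U.
        compactin (top_of_set {0..1::real}) C \<and> openin Z U}"
    then obtain C U where G: "G = {\<gamma>. pathin Z \<gamma> \<and> \<gamma> \<in> extensional {0..1} \<and> \<gamma> ` C \<subseteq> U}"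
        and C: "compactin (top_of_set {0..1::real}) C" and U: "openin Z U" by blast
    have C01: "C \<subseteq> {0..1}" using compactin_subset_topspace[OF C] by simp
    have eq: "?\<phi> -` G \<inter> topspace (top_of_set D) = {w\<in>D. \<forall>t\<in>C. \<Gamma> (w, t) \<in> U}"
      using path C01 unfolding G by (auto simp: image_subset_iff subset_iff)
    define W where "W = {z \<in> D \<times> {0..1}. \<Gamma> z \<in> U}"
    have W: "openin (prod_topology (top_of_set D) (top_of_set {0..1::real})) W"
      using \<Gamma> U unfolding W_def continuous_map_def by simp
    show "openin (top_of_set D) (?\<phi> -` G \<inter> topspace (top_of_set D))"
      unfolding eq
    proof (subst openin_subopen, intro ballI)
      fix w assume w: "w \<in> {w\<in>D. \<forall>t\<in>C. \<Gamma> (w, t) \<in> U}"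
      have "{w} \<times> C \<subseteq> W" using w C01 by (auto simp: W_def)
      from tube_lemma_right[OF W C _ this] w
      obtain M N where MN: "openin (top_of_set D) M" "w \<in> M" "C \<subseteq> N" "M \<times> N \<subseteq> W" by auto
      have "M \<subseteq> {w\<in>D. \<forall>t\<in>C. \<Gamma> (w, t) \<in> U}"
        using MN(3,4) openin_subset[OF MN(1)] by (auto simp: W_def)
      then show "\<exists>T. openin (top_of_set D) T \<and> w \<in> T \<and> T \<subseteq> {w\<in>D. \<forall>t\<in>C. \<Gamma> (w, t) \<in> U}"
        using MN by blast
    qed
  next
    have "?\<phi> w \<in> topspace (path_space Z)" if "w \<in> D" for w
      using path[OF that] by (simp add: topspace_path_space)
    then show "?\<phi> ` topspace (top_of_set D) \<subseteq> \<Union> {{\<gamma>. pathin Z \<gamma> \<and> \<gamma> \<in> extensional {0..1} \<and> \<gamma> ` C \<subseteq> U} | C U.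
        compactin (top_of_set {0..1::real}) C \<and> openin Z U}"
      unfolding path_space_def topology_generated_by_topspace by (simp add: image_subset_iff)
  qed
qed

text \<open>The other half, resting on local compactness of the interval: the path at
  \<open>w\<close> maps a compact neighbourhood \<open>C\<close> of \<open>t\<close> into
  \<open>U\<close>, and to map \<open>C\<close> into \<open>U\<close> is an open condition on
  paths.\<close>

lemma continuous_map_uncurry:
  assumes \<phi>: "continuous_map (top_of_set D) (path_space Z) \<phi>"
  shows "continuous_map (top_of_set (D \<times> {0..1::real})) Z (\<lambda>z. \<phi> (fst z) (snd z))"
proof -
  have path: "pathin Z (\<phi> w)" "\<phi> w \<in> extensional {0..1}" if "w \<in> D" for w
    using continuous_map_image_subset_topspace[OF \<phi>] that by (auto simp: topspace_path_space)
  have "\<exists>M N. openin (top_of_set D) M \<and> openin (top_of_set {0..1::real}) N \<and> w \<in> M \<and> t \<in> N \<and>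
      M \<times> N \<subseteq> {z \<in> D \<times> {0..1}. \<phi> (fst z) (snd z) \<in> U}"
    if U: "openin Z U" and w: "w \<in> D" and t: "t \<in> {0..1}" and wt: "\<phi> w t \<in> U" for U w t
  proof -
    have "openin (top_of_set {0..1}) {t \<in> {0..1}. \<phi> w t \<in> U}"
      using path(1)[OF w] U unfolding pathin_def continuous_map_def by simp
    then obtain e where e: "e > 0" "\<And>u. u \<in> {0..1} \<Longrightarrow> dist u t < e \<Longrightarrow> \<phi> w u \<in> U"
      unfolding openin_euclidean_subtopology_iff using t wt by blast
    \<comment> \<open>Half the radius keeps this closed neighbourhood inside the open ball on which
      \<open>\<phi> w\<close> stays in \<open>U\<close>.\<close>
    define C where "C = {0..1} \<inter> cball t (e / 2)"
    define G where "G = {\<gamma>. pathin Z \<gamma> \<and> \<gamma> \<in> extensional {0..1} \<and> \<gamma> ` C \<subseteq> U}"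
    have "compactin (top_of_set {0..1}) C"
      unfolding compactin_subtopology C_def by (simp add: compact_Int)
    then have "openin (path_space Z) G"
      unfolding path_space_def by (intro topology_generated_by_Basis) (use U in \<open>auto simp: G_def\<close>)
    then have 1: "openin (top_of_set D) {w \<in> D. \<phi> w \<in> G}"
      using \<phi> unfolding continuous_map_def by simp
    have 2: "openin (top_of_set {0..1}) ({0..1} \<inter> ball t (e / 2))" by (simp add: openin_open_Int)
    have 3: "w \<in> {w \<in> D. \<phi> w \<in> G}"
      using w path[OF w] e by (auto simp: G_def C_def dist_commute)
    have 4: "{w \<in> D. \<phi> w \<in> G} \<times> ({0..1} \<inter> ball t (e / 2)) \<subseteq> {z \<in> D \<times> {0..1}. \<phi> (fst z) (snd z) \<in> U}"
      by (auto simp: G_def C_def image_subset_iff)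
    have 5: "t \<in> {0..1} \<inter> ball t (e / 2)" using t e(1) by simp
    show ?thesis using 1 2 3 4 5 by blast
  qed
  then have "openin (prod_topology (top_of_set D) (top_of_set {0..1::real}))
      {z \<in> D \<times> {0..1}. \<phi> (fst z) (snd z) \<in> U}" if "openin Z U" for U
    unfolding openin_prod_topology_alt using that by simp
  moreover have "\<phi> w t \<in> topspace Z" if "w \<in> D" "t \<in> {0..1}" for w t
    using path(1)[OF that(1)] that(2) unfolding pathin_def by (auto simp: continuous_map_def)
  ultimately show ?thesis by (auto simp: continuous_map_def)
qed

lemma topspace_hofiber_id:
  "topspace (hofiber id (subtopology Z S) Z y) =
    {(x, \<gamma>). x \<in> topspace Z \<inter> S \<and> pathin Z \<gamma> \<and> \<gamma> \<in> extensional {0..1} \<and> \<gamma> 0 = x \<and> \<gamma> 1 = y}"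
  unfolding hofiber_def topspace_subtopology topspace_prod_topology topspace_path_space by auto

text \<open>Adjoint form of a family of paths. Together with \<open>hofiber_map_uncurry\<close> it
  reduces questions about the fibre to maps into \<open>Z\<close>; the restriction is needed since
  points of \<open>path_space\<close> are extensional.\<close>

definition fiber_map :: "('e \<times> real \<Rightarrow> 'b) \<Rightarrow> 'e \<Rightarrow> 'b \<times> (real \<Rightarrow> 'b)" where
  "fiber_map \<Gamma> w = (\<Gamma> (w, 0), restrict (\<lambda>t. \<Gamma> (w, t)) {0..1})"

lemma continuous_map_fiber_map:
  assumes \<Gamma>: "continuous_map (top_of_set (D \<times> {0..1})) Z \<Gamma>"
    and ends: "\<And>w. w \<in> D \<Longrightarrow> \<Gamma> (w, 0) \<in> S" "\<And>w. w \<in> D \<Longrightarrow> \<Gamma> (w, 1) = y"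
  shows "continuous_map (top_of_set D) (hofiber id (subtopology Z S) Z y) (fiber_map \<Gamma>)"
proof -
  have c: "continuous_map (top_of_set D) (path_space Z) (\<lambda>w. restrict (\<lambda>t. \<Gamma> (w, t)) {0..1})"
    by (rule continuous_map_curry[OF \<Gamma>])
  have "continuous_map (top_of_set D) Z (\<lambda>w. \<Gamma> (w, 0))"
    by (rule continuous_map_compose_on[OF \<Gamma>]) (auto intro!: continuous_intros)
  then have c0: "continuous_map (top_of_set D) (subtopology Z S) (\<lambda>w. \<Gamma> (w, 0))"
    using ends by (auto simp: continuous_map_in_subtopology)
  show ?thesis
    unfolding hofiber_def continuous_map_in_subtopology fiber_map_def
    using c c0 ends continuous_map_image_subset_topspace[OF c] continuous_map_image_subset_topspace[OF c0]
    by (auto simp: continuous_map_paired)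
qed

lemma hofiber_map_uncurry:
  assumes \<phi>: "continuous_map (top_of_set D) (hofiber id (subtopology Z S) Z y) \<phi>"
  shows "continuous_map (top_of_set (D \<times> {0..1::real})) Z (\<lambda>z. snd (\<phi> (fst z)) (snd z))"
    and "\<And>w. w \<in> D \<Longrightarrow> snd (\<phi> w) 0 \<in> S" "\<And>w. w \<in> D \<Longrightarrow> snd (\<phi> w) 1 = y"
    and "\<And>w. w \<in> D \<Longrightarrow> \<phi> w = (snd (\<phi> w) 0, restrict (snd (\<phi> w)) {0..1})"
proof -
  have "continuous_map (top_of_set D) (path_space Z) (snd \<circ> \<phi>)"
    using \<phi> unfolding hofiber_def continuous_map_in_subtopology continuous_map_pairwise by blast
  from continuous_map_uncurry[OF this]
  show "continuous_map (top_of_set (D \<times> {0..1::real})) Z (\<lambda>z. snd (\<phi> (fst z)) (snd z))" by simp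
  fix w assume "w \<in> D"
  then have "\<phi> w \<in> topspace (hofiber id (subtopology Z S) Z y)"
    using continuous_map_image_subset_topspace[OF \<phi>] by auto
  then show "snd (\<phi> w) 0 \<in> S" "snd (\<phi> w) 1 = y" "\<phi> w = (snd (\<phi> w) 0, restrict (snd (\<phi> w)) {0..1})"
    unfolding topspace_hofiber_id by (auto simp: extensional_restrict prod_eq_iff)
qed

lemma continuous_map_if_le:
  fixes p q :: "'e::topological_space \<Rightarrow> real"
  assumes "continuous_on C p" "continuous_on C q"
    and "continuous_map (top_of_set {x\<in>C. p x \<le> q x}) Z f" "continuous_map (top_of_set {x\<in>C. q x \<le> p x}) Z g"
    and "\<And>x. x \<in> C \<Longrightarrow> p x = q x \<Longrightarrow> f x = g x"
  shows "continuous_map (top_of_set C) Z (\<lambda>x. if p x \<le> q x then f x else g x)"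
proof (rule continuous_map_cases_le)
  have "C \<inter> {x\<in>C. p x \<le> q x} = {x\<in>C. p x \<le> q x}" "C \<inter> {x\<in>C. q x \<le> p x} = {x\<in>C. q x \<le> p x}" by auto
  then show "continuous_map (subtopology (top_of_set C) {x \<in> topspace (top_of_set C). p x \<le> q x}) Z f"
    "continuous_map (subtopology (top_of_set C) {x \<in> topspace (top_of_set C). q x \<le> p x}) Z g"
    using assms(3,4) by (simp_all add: subtopology_subtopology)
qed (use assms in auto)

text \<open>The track \<open>k\<close> of a deformation of the bottom is prepended to the paths of a filling by cones;
  over the collar \<open>1/2 \<le> norm w \<le> 1\<close> only a part of the track, of length \<open>1 - \<delta> w\<close>, is used.\<close>

lemma fill_hofiber:
  fixes B :: "'e::euclidean_space \<times> real \<Rightarrow> 'b"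
  assumes deform: "\<And>f. continuous_map (top_of_set (cball (0::'e) 1)) Z f \<Longrightarrow>
      \<exists>g. homotopic_with (\<lambda>h. \<forall>w\<in>cball 0 1. f w \<in> S \<longrightarrow> h w \<in> S) (top_of_set (cball 0 1)) Z f g
        \<and> g ` cball 0 1 \<subseteq> S"
    and y: "y \<in> topspace Z"
    and B: "continuous_map (top_of_set (sphere 0 1 \<times> {0..1})) Z B"
    and ends: "\<And>u. u \<in> sphere 0 1 \<Longrightarrow> B (u, 0) \<in> S" "\<And>u. u \<in> sphere 0 1 \<Longrightarrow> B (u, 1) = y"
  shows "\<exists>\<Gamma>. continuous_map (top_of_set (cball 0 1 \<times> {0..1})) Z \<Gamma> \<and>
    (\<forall>w\<in>cball 0 1. \<Gamma> (w, 0) \<in> S \<and> \<Gamma> (w, 1) = y) \<and>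
    (\<forall>u\<in>sphere 0 1. \<forall>t\<in>{0..1}. \<Gamma> (u, t) = B (u, t))"
proof -
  let ?D = "cball (0::'e) 1"
  \<comment> \<open>As the radius decreases from 1 to 1/2, the boundary path in direction
    \<open>w\<close> is shortened to its final part, until only the constant path at
    \<open>y\<close> is left. The starting points at intermediate radii need not lie in
    \<open>S\<close>.\<close>
  define G where "G = (\<lambda>z::'e \<times> real. if norm (fst z) \<le> 1 / 2 then y
     else B (fst z /\<^sub>R norm (fst z), 1 - (2 * norm (fst z) - 1) * (1 - snd z)))"
  have G: "continuous_map (top_of_set (?D \<times> {0..1})) Z G"
    unfolding G_def
  proof (rule continuous_map_if_le)
    show "continuous_map (top_of_set {z \<in> ?D \<times> {0..1}. 1 / 2 \<le> norm (fst z)}) Z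
        (\<lambda>z. B (fst z /\<^sub>R norm (fst z), 1 - (2 * norm (fst z) - 1) * (1 - snd z)))"
    proof (rule continuous_map_compose_on[OF B])
      show "continuous_on {z \<in> ?D \<times> {0..1}. 1 / 2 \<le> norm (fst z)}
          (\<lambda>z. (fst z /\<^sub>R norm (fst z), 1 - (2 * norm (fst z) - 1) * (1 - snd z)))"
        by (intro continuous_intros) auto
      fix z :: "'e \<times> real" assume "z \<in> {z \<in> ?D \<times> {0..1}. 1 / 2 \<le> norm (fst z)}"
      then obtain w t where z: "z = (w, t)" "1 / 2 \<le> norm w" "norm w \<le> 1" "0 \<le> t" "t \<le> 1" by (cases z) auto
      have "w \<noteq> 0" using z by auto
      moreover have "0 \<le> (2 * norm w - 1) * (1 - t)" "(2 * norm w - 1) * (1 - t) \<le> 1"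
        using z by (auto intro: mult_le_one)
      ultimately show "(fst z /\<^sub>R norm (fst z), 1 - (2 * norm (fst z) - 1) * (1 - snd z)) \<in> sphere 0 1 \<times> {0..1}"
        using z(1) by auto
    qed
    fix z :: "'e \<times> real" assume "z \<in> ?D \<times> {0..1}" and n: "norm (fst z) = 1 / 2"
    have "norm (fst z) \<noteq> 0" unfolding n by simp
    then have "fst z /\<^sub>R norm (fst z) \<in> sphere 0 1" by simp
    then have "y = B (fst z /\<^sub>R norm (fst z), 1)" by (rule ends(2)[symmetric])
    moreover have "1 - (2 * norm (fst z) - 1) * (1 - snd z) = 1" unfolding n by simp
    ultimately show "y = B (fst z /\<^sub>R norm (fst z), 1 - (2 * norm (fst z) - 1) * (1 - snd z))"
      by (simp only:)
  qed (use y in \<open>auto intro!: continuous_intros\<close>)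
  have Gbd: "G (u, t) = B (u, t)" if "norm u = 1" for u t using that by (simp add: G_def)
  have G1: "G (w, 1) = y" for w
  proof (cases "w = 0")
    case False
    then have "w /\<^sub>R norm w \<in> sphere 0 1" by simp
    then show ?thesis using ends(2)[of "w /\<^sub>R norm w"] by (simp add: G_def)
  qed (simp add: G_def)
  \<comment> \<open>Only the starting points are deformed, so the hypothesis is used over the disc
    and not over its product with the interval.\<close>
  have "continuous_map (top_of_set ?D) Z (\<lambda>w. G (w, 0))"
    by (rule continuous_map_compose_on[OF G]) (auto intro!: continuous_intros)
  from deform[OF this] obtain g
    where g: "homotopic_with (\<lambda>h. \<forall>w\<in>?D. G (w, 0) \<in> S \<longrightarrow> h w \<in> S) (top_of_set ?D) Z (\<lambda>w. G (w, 0)) g" "g ` ?D \<subseteq> S"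
    by (elim exE conjE)
  obtain k where k: "continuous_map (top_of_set ({0..1::real} \<times> ?D)) Z k"
      and k0: "\<And>w. k (0, w) = G (w, 0)" and k1: "\<And>w. k (1, w) = g w"
      and kS: "\<And>t w. t \<in> {0..1} \<Longrightarrow> w \<in> ?D \<Longrightarrow> G (w, 0) \<in> S \<Longrightarrow> k (t, w) \<in> S"
    using g(1) by (rule homotopic_with_top_of_setE) blast
  \<comment> \<open>Times from -1 to 0 run backwards along the track, from the point reached in
    \<open>S\<close> to the start of the path in \<open>G\<close>.\<close>
  define J where "J = (\<lambda>z::'e \<times> real. if snd z \<le> 0 then k (- snd z, fst z) else G z)"
  have J: "continuous_map (top_of_set (?D \<times> {-1..1})) Z J"
    unfolding J_def
  proof (rule continuous_map_if_le)
    show "continuous_map (top_of_set {z \<in> ?D \<times> {-1..1}. snd z \<le> 0}) Z (\<lambda>z. k (- snd z, fst z))"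
      by (rule continuous_map_compose_on[OF k]) (auto intro!: continuous_intros)
    show "continuous_map (top_of_set {z \<in> ?D \<times> {-1..1}. 0 \<le> snd z}) Z G"
      by (rule continuous_map_compose_on[OF G continuous_on_id, simplified]) auto
  qed (auto simp: k0 intro!: continuous_intros)
  \<comment> \<open>The same collar functions as in \<open>compression\<close>, for the Euclidean
    norm: \<open>c\<close> doubles the inner half and sends the collar to the unit sphere.\<close>
  define \<delta> where "\<delta> w = max 0 (2 * norm w - 1)" for w :: 'e
  define c where "c w = (2 / max 1 (2 * norm w)) *\<^sub>R w" for w :: 'e
  have \<delta>: "0 \<le> \<delta> w" "\<delta> w \<le> 1" if "w \<in> ?D" for w using that by (auto simp: \<delta>_def)
  have c: "c w \<in> ?D" for w by (auto simp: c_def max_def field_simps)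
  \<comment> \<open>Time 0 to 1 is mapped affinely onto \<open>-(1 - \<delta>)\<close> to 1. On the
    unit sphere \<open>\<delta>\<close> is 1, so time is unchanged and the values of
    \<open>B\<close> are preserved.\<close>
  define \<Gamma> where "\<Gamma> = (\<lambda>z. J (c (fst z), snd z * (2 - \<delta> (fst z)) - (1 - \<delta> (fst z))))"
  have "continuous_map (top_of_set (?D \<times> {0..1})) Z \<Gamma>"
    unfolding \<Gamma>_def
  proof (rule continuous_map_compose_on[OF J])
    show "continuous_on (?D \<times> {0..1}) (\<lambda>z. (c (fst z), snd z * (2 - \<delta> (fst z)) - (1 - \<delta> (fst z))))"
      unfolding c_def \<delta>_def by (intro continuous_intros) auto
    fix z :: "'e \<times> real" assume "z \<in> ?D \<times> {0..1}"
    then obtain w t where z: "z = (w, t)" "w \<in> ?D" "0 \<le> t" "t \<le> 1" by auto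
    have "t * (2 - \<delta> w) \<le> 2 - \<delta> w"
      using z \<delta>[OF z(2)] by (intro mult_left_le_one_le) auto
    moreover have "0 \<le> t * (2 - \<delta> w)" using z \<delta>[OF z(2)] by simp
    moreover have "p - (1 - \<delta> w) \<in> {-1..1}" if "p \<le> 2 - \<delta> w" "0 \<le> p" for p
      using that \<delta>[OF z(2)] by simp
    ultimately have "t * (2 - \<delta> w) - (1 - \<delta> w) \<in> {-1..1}" by blast
    then show "(c (fst z), snd z * (2 - \<delta> (fst z)) - (1 - \<delta> (fst z))) \<in> ?D \<times> {-1..1}"
      using c z(1) by simp
  qed
  moreover have "\<Gamma> (w, 0) \<in> S" if w: "w \<in> ?D" for w
  proof -
    have eq: "\<Gamma> (w, 0) = k (1 - \<delta> w, c w)" using \<delta>[OF w] by (simp add: \<Gamma>_def J_def)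
    show ?thesis
    proof (cases "norm w \<le> 1 / 2")
      case True
      then have "\<delta> w = 0" by (simp add: \<delta>_def)
      then show ?thesis using eq k1 g(2) c[of w] by auto
    next
      case False
      then have "w \<noteq> 0" by auto
      then have "norm (c w) = 1" using False by (simp add: c_def max_def)
      then have "G (c w, 0) \<in> S" using Gbd ends(1) by simp
      then show ?thesis unfolding eq using \<delta>[OF w] by (intro kS c) auto
    qed
  qed
  moreover have "\<Gamma> (w, 1) = y" if "w \<in> ?D" for w
    using G1 by (simp add: \<Gamma>_def J_def)
  moreover have "\<Gamma> (u, t) = B (u, t)" if "u \<in> sphere 0 1" "t \<in> {0..1}" for u t
  proof -
    have "\<delta> u = 1" "c u = u" "norm u = 1" using that by (auto simp: \<delta>_def c_def)
    then show ?thesis using that Gbd[of u] by (auto simp: \<Gamma>_def J_def k0)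
  qed
  ultimately show ?thesis by blast
qed

context deformable_pair
begin

lemma hofiber_nonempty:
  assumes "y \<in> topspace Z"
  shows "topspace (hofiber id (subtopology Z S) Z y) \<noteq> {}"
proof -
  obtain s where s: "s \<in> S" "path_component_of Z s y"
    using path_component_meets[OF assms] path_component_of_sym by metis
  then obtain \<gamma> where \<gamma>: "pathin Z \<gamma>" "\<gamma> 0 = s" "\<gamma> 1 = y" unfolding path_component_of_def by blast
  have "pathin Z (restrict \<gamma> {0..1})"
    using \<gamma>(1) unfolding pathin_def by (rule continuous_map_eq) simp
  then have "(s, restrict \<gamma> {0..1}) \<in> topspace (hofiber id (subtopology Z S) Z y)"
    unfolding topspace_hofiber_id using \<gamma> s subset by auto
  then show ?thesis by blast
qed

text \<open>Two points of the fibre are a map on the 0-sphere of the real line; filling it over the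
  interval joins them by a path.\<close>

lemma hofiber_path_connected:
  assumes y: "y \<in> topspace Z"
  shows "path_connected_space (hofiber id (subtopology Z S) Z y)" (is "path_connected_space ?F")
  unfolding path_connected_space_def
proof (intro ballI)
  fix a b assume ab: "a \<in> topspace ?F" "b \<in> topspace ?F"
  define B where "B = (\<lambda>z::real \<times> real. if fst z \<le> 0 then snd a (snd z) else snd b (snd z))"
  have pa: "pathin Z (snd a)" "snd a 0 \<in> S" "snd a 1 = y" "a = (snd a 0, restrict (snd a) {0..1})"
    and pb: "pathin Z (snd b)" "snd b 0 \<in> S" "snd b 1 = y" "b = (snd b 0, restrict (snd b) {0..1})"
    using ab unfolding topspace_hofiber_id by (auto simp: extensional_restrict)
  have ne: "u \<noteq> 0" if "u \<in> sphere (0::real) 1" for u using that by auto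
  have B: "continuous_map (top_of_set (sphere 0 1 \<times> {0..1})) Z B"
    unfolding B_def
  proof (rule continuous_map_if_le)
    show "continuous_map (top_of_set {z \<in> sphere 0 1 \<times> {0..1}. fst z \<le> 0}) Z (\<lambda>z. snd a (snd z))"
      by (rule continuous_map_compose_on[OF pa(1)[unfolded pathin_def]]) (auto intro!: continuous_intros)
    show "continuous_map (top_of_set {z \<in> sphere 0 1 \<times> {0..1}. 0 \<le> fst z}) Z (\<lambda>z. snd b (snd z))"
      by (rule continuous_map_compose_on[OF pb(1)[unfolded pathin_def]]) (auto intro!: continuous_intros)
  qed (use ne in \<open>auto intro!: continuous_intros\<close>)
  have "\<exists>\<Gamma>. continuous_map (top_of_set (cball 0 1 \<times> {0..1})) Z \<Gamma> \<and>
    (\<forall>w\<in>cball 0 1. \<Gamma> (w, 0) \<in> S \<and> \<Gamma> (w, 1) = y) \<and> (\<forall>u\<in>sphere 0 1. \<forall>t\<in>{0..1}. \<Gamma> (u, t) = B (u, t))"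
    by (rule fill_hofiber[OF deform_real[OF compact_cball] y B]) (use pa pb in \<open>auto simp: B_def\<close>)
  then obtain \<Gamma> where \<Gamma>: "continuous_map (top_of_set (cball (0::real) 1 \<times> {0..1})) Z \<Gamma>"
     "\<And>w. w \<in> cball 0 1 \<Longrightarrow> \<Gamma> (w, 0) \<in> S" "\<And>w. w \<in> cball 0 1 \<Longrightarrow> \<Gamma> (w, 1) = y"
     "\<And>u t. u \<in> sphere 0 1 \<Longrightarrow> t \<in> {0..1} \<Longrightarrow> \<Gamma> (u, t) = B (u, t)" by blast
  note \<Phi> = continuous_map_fiber_map[OF \<Gamma>(1-3)]
  have "pathin ?F (\<lambda>t. fiber_map \<Gamma> (2 * t - 1))"
    unfolding pathin_def
    by (rule continuous_map_compose_on[OF \<Phi>]) (auto intro!: continuous_intros simp: abs_le_iff)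
  moreover have "fiber_map \<Gamma> (-1) = a"
    by (subst pa(4)) (auto simp: fiber_map_def \<Gamma>(4) B_def restrict_def fun_eq_iff)
  moreover have "fiber_map \<Gamma> 1 = b"
    by (subst pb(4)) (auto simp: fiber_map_def \<Gamma>(4) B_def restrict_def fun_eq_iff)
  ultimately show "\<exists>g. pathin ?F g \<and> g 0 = a \<and> g 1 = b"
    by (intro exI[of _ "\<lambda>t. fiber_map \<Gamma> (2 * t - 1)"]) simp
qed

text \<open>After uncurrying, the loop descends to a family over the circle, which
  \<open>fill_hofiber\<close> extends over the disc. There it can be contracted linearly.\<close>

lemma hofiber_loop_null:
  assumes y: "y \<in> topspace Z" and g: "pathin (hofiber id (subtopology Z S) Z y) g" "g 1 = g 0"
  shows "homotopic_with (\<lambda>h. h 0 = g 0 \<and> h 1 = g 0) (top_of_set {0..1})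
    (hofiber id (subtopology Z S) Z y) g (\<lambda>t. g 0)" (is "homotopic_with _ _ ?F _ _")
proof -
  note u = hofiber_map_uncurry[OF g(1)[unfolded pathin_def]]
  let ?D = "{t::real. \<bar>t\<bar> \<le> 1}"
  define H where "H = (\<lambda>z::real \<times> real. snd (g ((snd z + 1) / 2)) (fst z))"
  have H: "continuous_map (top_of_set ({0..1::real} \<times> ?D)) Z H"
  proof -
    have "continuous_map (top_of_set ({0..1::real} \<times> ?D)) Z
        (\<lambda>z. (\<lambda>z. snd (g (fst z)) (snd z)) ((snd z + 1) / 2, fst z))"
      by (rule continuous_map_compose_on[OF u(1)]) (auto intro!: continuous_intros)
    then show ?thesis by (simp add: H_def)
  qed
  have "{w::real. \<bar>w\<bar> \<le> 1} = {-1..1}" by auto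
  then have comp: "compact ?D" by simp
  have gend: "g ((v + 1) / 2) = g 0" if "\<bar>v\<bar> = 1" for v
  proof -
    have "v = 1 \<or> v = -1" using that by linarith
    then show ?thesis using g(2) by auto
  qed
  have "H (t, v) = H (t, v')" if "t \<in> {0..1}" "v \<in> ?D" "v' \<in> ?D" "wrap_circle v = wrap_circle v'" for t v v'
    using wrap_circle_eq[of v v'] that gend[of v] gend[of v'] by (auto simp: H_def)
  from quotient_homotopy[OF comp continuous_on_wrap_circle wrap_circle_image H this]
  obtain H' where H': "continuous_map (top_of_set ({0..1::real} \<times> sphere 0 1)) Z H'"
      "\<And>t v. t \<in> {0..1} \<Longrightarrow> v \<in> ?D \<Longrightarrow> H' (t, wrap_circle v) = H (t, v)" by blast
  define B where "B = (\<lambda>z::complex \<times> real. H' (snd z, fst z))"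
  have B: "continuous_map (top_of_set (sphere 0 1 \<times> {0..1})) Z B"
    unfolding B_def by (rule continuous_map_compose_on[OF H'(1)]) (auto intro!: continuous_intros)
  have Bg: "B (wrap_circle v, t) = snd (g ((v + 1) / 2)) t" if "t \<in> {0..1}" "v \<in> ?D" for v t
    using H'(2)[OF that] by (simp add: B_def H_def)
  have lift: "\<exists>v\<in>?D. z = wrap_circle v" if "z \<in> sphere 0 1" for z using that wrap_circle_image by blast
  have in01: "(v + 1) / 2 \<in> {0..1}" if "v \<in> ?D" for v :: real using that by auto
  have ends: "B (z, 0) \<in> S" "B (z, 1) = y" if z: "z \<in> sphere 0 1" for z
  proof -
    obtain v where v: "v \<in> ?D" "z = wrap_circle v" using lift[OF z] by blast
    show "B (z, 0) \<in> S" "B (z, 1) = y"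
      using Bg[of _ v] u(2,3)[OF in01[OF v(1)]] v by simp_all
  qed
  from fill_hofiber[OF deform[OF compact_cball] y B ends]
  obtain \<Gamma> where \<Gamma>: "continuous_map (top_of_set (cball (0::complex) 1 \<times> {0..1})) Z \<Gamma>"
     "\<And>w. w \<in> cball 0 1 \<Longrightarrow> \<Gamma> (w, 0) \<in> S" "\<And>w. w \<in> cball 0 1 \<Longrightarrow> \<Gamma> (w, 1) = y"
     "\<And>u t. u \<in> sphere 0 1 \<Longrightarrow> t \<in> {0..1} \<Longrightarrow> \<Gamma> (u, t) = B (u, t)" by blast
  note \<Phi> = continuous_map_fiber_map[OF \<Gamma>(1-3)]
  have \<Phi>g: "fiber_map \<Gamma> (wrap_circle v) = g ((v + 1) / 2)" if v: "v \<in> ?D" for v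
  proof -
    have "\<Gamma> (wrap_circle v, t) = snd (g ((v + 1) / 2)) t" if "t \<in> {0..1}" for t
      using \<Gamma>(4)[of "wrap_circle v" t] Bg[OF that v] that by (simp add: norm_wrap_circle)
    then show ?thesis
      by (subst u(4)[OF in01[OF v]]) (auto simp: fiber_map_def restrict_def fun_eq_iff)
  qed
  have \<Phi>1: "fiber_map \<Gamma> 1 = g 0" using \<Phi>g[of 1] g(2) by (simp add: wrap_circle_ends)
  \<comment> \<open>Segments in the disc towards 1, the point where the loop begins and ends. They
    leave 1 fixed, so the endpoints stay at \<open>g 0\<close> throughout.\<close>
  define k where "k = (\<lambda>z::real \<times> real. fiber_map \<Gamma> ((1 - fst z) *\<^sub>R wrap_circle (2 * snd z - 1) + fst z *\<^sub>R 1))"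
  have "continuous_map (top_of_set ({0..1::real} \<times> {0..1})) ?F k"
    unfolding k_def
  proof (rule continuous_map_compose_on[OF \<Phi>])
    show "continuous_on ({0..1} \<times> {0..1}) (\<lambda>z. (1 - fst z) *\<^sub>R wrap_circle (2 * snd z - 1) + fst z *\<^sub>R (1::complex))"
      by (intro continuous_intros continuous_on_compose2[OF continuous_on_wrap_circle[of UNIV]]) auto
    fix z :: "real \<times> real" assume z: "z \<in> {0..1} \<times> {0..1}"
    have "convex (cball (0::complex) 1)" by simp
    then show "(1 - fst z) *\<^sub>R wrap_circle (2 * snd z - 1) + fst z *\<^sub>R 1 \<in> cball 0 1"
      by (rule convexD) (use z in \<open>auto simp: norm_wrap_circle\<close>)
  qed
  then show ?thesis
  proof (rule homotopic_with_top_of_setI)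
    fix t :: real assume t: "t \<in> {0..1}"
    then show "k (0, t) = g t" using \<Phi>g[of "2 * t - 1"] by (simp add: k_def abs_le_iff)
    show "k (1, t) = g 0" using \<Phi>1 by (simp add: k_def)
  next
    fix s :: real
    have "(1 - s) *\<^sub>R 1 + s *\<^sub>R 1 = (1::complex)" by (simp flip: scaleR_left_distrib)
    then show "k (s, 0) = g 0 \<and> k (s, 1) = g 0" using \<Phi>1 by (simp add: k_def wrap_circle_ends)
  qed auto
qed

lemma simply_connected_hofiber:
  assumes "y \<in> topspace Z"
  shows "simply_connected_space (hofiber id (subtopology Z S) Z y)"
  unfolding simply_connected_space_def
  using hofiber_nonempty[OF assms] hofiber_path_connected[OF assms] hofiber_loop_null[OF assms] by blast

end

theorem theorem11p5:
  fixes d :: "'a \<Rightarrow> 'a \<Rightarrow> ennreal" and X Y :: "'a set" and r :: real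
  assumes "pseudometric_on (X \<union> Y) d"
    and "0 \<le> r"
    and "finite (X \<inter> Y)"
    and "metric_gluing d X Y"
    and "strong_simplex_assumption d r X Y"
  shows "(\<forall>\<sigma>\<in>VR d r (X \<union> Y) - VR_P d r X Y.
            card (\<sigma> \<inter> X) = 1 \<or> card (\<sigma> \<inter> Y) = 1 \<longrightarrow>
            contractible (realization (St (VR d r (X \<union> Y)) \<sigma> (X \<inter> Y))))
       \<and> (\<forall>y\<in>topspace (realization (VR d r (X \<union> Y))).
            simply_connected_space
              (hofiber id (realization (VR d r X \<union> VR d r Y)) (realization (VR d r (X \<union> Y))) y))
       \<and> bij_betw (pi0_map id (realization (VR d r (X \<union> Y))))
            (path_components_of (realization (VR d r X \<union> VR d r Y)))
            (path_components_of (realization (VR d r (X \<union> Y))))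
       \<and> (\<forall>x\<in>topspace (realization (VR d r X \<union> VR d r Y)).
            bij_betw (induced id sphere1 1 (realization (VR d r (X \<union> Y))) x)
              (pi1 (realization (VR d r X \<union> VR d r Y)) x)
              (pi1 (realization (VR d r (X \<union> Y))) x)
          \<and> induced id sphere2 (axis 1 1) (realization (VR d r (X \<union> Y))) x
              ` pi2 (realization (VR d r X \<union> VR d r Y)) x
            = pi2 (realization (VR d r (X \<union> Y))) x)"
proof -
  interpret vr_gluing d X Y r by unfold_locales (fact assms)+
  \<comment> \<open>Folding this equation turns the statements about \<open>subtopology\<close> into
    statements about the realization of \<open>L\<close>.\<close>
  have L: "realization L = subtopology (realization K) (topspace (realization L))"
    by (rule realization_subcomplex[OF is_complex_VR is_complex_L L_subset_K])
  interpret deformable_pair "realization K" "topspace (realization L)"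
  proof
    show "topspace (realization L) \<subseteq> topspace (realization K)"
      using L_subset_K by (auto simp: topspace_realization)
  qed (rule planar_deformation)
  show ?thesis
    using contractible_obstruction simply_connected_hofiber[folded L] bij_betw_pi0[folded L]
      pi1_bij[folded L] pi2_surj[folded L] by blast
qed

end
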